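(* Let $h\ge2$ be an integer. There exists a multiplicative basis $A$ of order $h$ for $\mathbb{Z}^+$ such that $$\limsup_{x\to\infty}A(x)\frac{(\log x)^{1-\frac1h}}{x}=\frac{2}{\sqrt{\pi}}.$$
   Context: $\mathbb{Z}^+$ denotes the set of positive integers and $\log$ the natural logarithm. A set $A\subseteq\mathbb{Z}^+$ is a multiplicative basis of order $h$ for $\mathbb{Z}^+$ if every positive integer can be written in the form $a_1\cdots a_h$ with $a_i\in A$ for all $1\le i\le h$ (repetitions allowed). The counting function of $A$ is $A(x)=|\{a\in A:a\le x\}|$. *)

theory Defs
  imports Complex_Main "HOL-Library.Liminf_Limsup" "HOL-Library.Extended_Real"
begin

definition mult_basis :: "nat \<Rightarrow> nat set \<Rightarrow> bool" where
  "mult_basis h A \<longleftrightarrow> A \<subseteq> {0<..} \<and>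
     (\<forall>n>0. \<exists>a :: nat \<Rightarrow> nat. (\<forall>i\<in>{1..h}. a i \<in> A) \<and> n = (\<Prod>i=1..h. a i))"

definition counting_fun :: "nat set \<Rightarrow> real \<Rightarrow> nat" where
  "counting_fun A x = card {a \<in> A. real a \<le> x}"

end

(* Split the primes greedily into h classes of equal weight sum(-log(1 - 1/p)) and let A be the
   union of the h sets of integers all of whose prime factors lie in one class; A is a basis because
   every integer factors along the classes.  With k = 1/h, the balance of the classes gives
   F(1+s) ~ s^(-k) for each Dirichlet series F, and Karamata's method turns this into the mean value
   sum f(n)/n log(x/n).  The pointwise count S(x) = sum_{n <= x} f(n) is then controlled without the
   prime number theorem: in f log^2 = f * (L_f log + L_f * L_f), L_f = f Lambda, the right-hand
   factor is k^2 times Selberg's expression plus (k - k^2) Lambda log.  The first part only sees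
   mean values, the second reproduces S with coefficient (1-k)/(1+k) < 1, so
   b = limsup S(x) (log x)^(1-k) / x satisfies (1+k) b <= 2k/Gamma(k) + (1-k) b, that is
   b <= 1/Gamma(k).
   Summing over the classes gives limsup at most h/Gamma(1/h) = 1/Gamma(1+1/h) <= 1/Gamma(3/2) =
   2/sqrt(pi), and a maximal superset of A subject to this bound on its counting function attains
   equality. *)

theory Submission
  imports Defs "HOL-Analysis.Analysis" "HOL-Number_Theory.Prime_Powers"
    "HOL-Computational_Algebra.Squarefree" "HOL-Real_Asymp.Real_Asymp"
begin

section \<open>Sums over integers and Chebyshev--Mertens estimates\<close>

text \<open>Mean values of f do not bound S(x) pointwise: f log = f * L_f would need the summatory
  function of L_f at each point, and that is known only as k psi(x) + o(x), with psi itself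
  controlled only up to a constant factor. Passing to log^2 brings in psi(x) log x + sum Lambda(n)
  psi(x/n), which Selberg's formula gives up to O(x). Comparing a class with k psi instead of k x
  requires classes balanced to within o(1 / log N), because partial summation from the weights
  -log(1 - 1/p) to log p costs a factor N log N. This rate is what the greedy choice has to deliver.
  Upper bounds on the counts suffice, so Selberg's formula, the polynomial approximation and the
  contraction are carried out on one side only; the lower bound for the limsup comes entirely from
  the extension of A. The constant 2/sqrt(pi) is h/Gamma(1/h) at h = 2. The comparison for larger h
  is delicate because Gamma is not monotone on the interval from 1 to 3/2: it drops below Gamma(3/2)
  shortly before 3/2.\<close>

definition nats_upto :: "real \<Rightarrow> nat set" where
  "nats_upto x = {n. 0 < n \<and> real n \<le> x}"

lemma nats_upto_altdef: "nats_upto x = {1..nat \<lfloor>x\<rfloor>}"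
  unfolding nats_upto_def set_eq_iff mem_Collect_eq atLeastAtMost_iff by (auto simp: Suc_le_eq; linarith)

lemma finite_nats_upto [simp, intro]: "finite (nats_upto x)"
  by (simp add: nats_upto_altdef)

lemma mem_nats_upto: "n \<in> nats_upto x \<longleftrightarrow> 0 < n \<and> real n \<le> x"
  by (simp add: nats_upto_def)

lemma nats_upto_of_nat: "nats_upto (real n) = {1..n}"
  by (simp add: nats_upto_altdef)

lemma nats_upto_mono: "x \<le> y \<Longrightarrow> nats_upto x \<subseteq> nats_upto y"
  by (auto simp: nats_upto_def)

lemma nats_upto_empty: "x < 1 \<Longrightarrow> nats_upto x = {}"
  by (auto simp: nats_upto_def)

lemma card_nats_upto: "x \<ge> 0 \<Longrightarrow> real (card (nats_upto x)) = of_int \<lfloor>x\<rfloor>"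
  by (simp add: nats_upto_altdef)

lemma card_nats_upto_bounds:
  assumes "x \<ge> 0"
  shows "real (card (nats_upto x)) \<le> x" "x - 1 < real (card (nats_upto x))"
  using assms by (auto simp: card_nats_upto; linarith)+

text \<open>Pairs (n, d) with d dvd n correspond to pairs (d, m) with d m \<le> x through n = d m.
  This turns summatory functions of Dirichlet convolutions into iterated sums.\<close>

lemma sum_nats_upto_divisors:
  fixes g :: "nat \<Rightarrow> nat \<Rightarrow> 'a :: comm_monoid_add"
  shows "(\<Sum>n\<in>nats_upto x. \<Sum>d | d dvd n. g d (n div d)) =
         (\<Sum>d\<in>nats_upto x. \<Sum>m\<in>nats_upto (x / real d). g d m)"
proof -
  have "(\<Sum>n\<in>nats_upto x. \<Sum>d | d dvd n. g d (n div d)) =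
        (\<Sum>(n,d)\<in>(SIGMA n:nats_upto x. {d. d dvd n}). g d (n div d))"
    by (subst sum.Sigma) (auto simp: mem_nats_upto)
  also have "\<dots> = (\<Sum>(d,m)\<in>(SIGMA d:nats_upto x. nats_upto (x / real d)). g d m)"
  proof (rule sum.reindex_bij_witness[of _ "\<lambda>(d,m). (d * m, d)" "\<lambda>(n,d). (d, n div d)"])
    fix a assume a: "a \<in> (SIGMA n:nats_upto x. {d. d dvd n})"
    then obtain d m where dm: "a = (d * m, d)" "0 < d * m" "real (d * m) \<le> x"
      by (auto simp: mem_nats_upto elim!: dvdE)
    have "d > 0" "m > 0" using dm by auto
    moreover have "real d \<le> real (d * m)" using \<open>m > 0\<close> by (cases m) auto
    ultimately have "real d \<le> x" using dm by linarith
    thus "(case a of (n, d) \<Rightarrow> (d, n div d)) \<in> (SIGMA d:nats_upto x. nats_upto (x / real d))"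
      using dm \<open>d > 0\<close> \<open>m > 0\<close> by (auto simp: mem_nats_upto field_simps)
  next
    fix b assume b: "b \<in> (SIGMA d:nats_upto x. nats_upto (x / real d))"
    then obtain d m where "b = (d, m)" "0 < d" "0 < m" "real m \<le> x / real d"
      by (auto simp: mem_nats_upto)
    thus "(case b of (d, m) \<Rightarrow> (d * m, d)) \<in> (SIGMA n:nats_upto x. {d. d dvd n})"
      by (auto simp: mem_nats_upto field_simps)
  qed (auto simp: mem_nats_upto)
  also have "\<dots> = (\<Sum>d\<in>nats_upto x. \<Sum>m\<in>nats_upto (x / real d). g d m)"
    by (subst sum.Sigma) auto
  finally show ?thesis .
qed

lemma sum_nats_upto_swap:
  fixes g :: "nat \<Rightarrow> nat \<Rightarrow> 'a :: comm_monoid_add"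
  shows "(\<Sum>d\<in>nats_upto x. \<Sum>m\<in>nats_upto (x / real d). g d m) =
         (\<Sum>m\<in>nats_upto x. \<Sum>d\<in>nats_upto (x / real m). g d m)"
proof -
  have swap_mem: "prod.swap a \<in> (SIGMA d:nats_upto x. nats_upto (x / real d))"
    if "a \<in> (SIGMA d:nats_upto x. nats_upto (x / real d))" for a
  proof -
    obtain d m where a: "a = (d, m)" by (cases a)
    have "0 < d" "0 < m" "real m * real d \<le> x"
      using that by (auto simp: a mem_nats_upto field_simps)
    moreover have "real m * 1 \<le> real m * real d"
      using \<open>0 < d\<close> by (intro mult_left_mono) auto
    ultimately have "real m \<le> x" by linarith
    thus ?thesis using \<open>0 < d\<close> \<open>0 < m\<close> \<open>real m * real d \<le> x\<close> by (auto simp: a mem_nats_upto field_simps)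
  qed
  have "(\<Sum>d\<in>nats_upto x. \<Sum>m\<in>nats_upto (x / real d). g d m) =
        (\<Sum>(d,m)\<in>(SIGMA d:nats_upto x. nats_upto (x / real d)). g d m)"
    by (subst sum.Sigma) auto
  also have "\<dots> = (\<Sum>(m,d)\<in>(SIGMA m:nats_upto x. nats_upto (x / real m)). g d m)"
  proof (rule sum.reindex_bij_witness[of _ prod.swap prod.swap])
    fix a assume "a \<in> (SIGMA d:nats_upto x. nats_upto (x / real d))"
    thus "prod.swap a \<in> (SIGMA d:nats_upto x. nats_upto (x / real d))" by (rule swap_mem)
  next
    fix a assume "a \<in> (SIGMA d:nats_upto x. nats_upto (x / real d))"
    thus "prod.swap a \<in> (SIGMA d:nats_upto x. nats_upto (x / real d))" by (rule swap_mem)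
  qed auto
  also have "\<dots> = (\<Sum>m\<in>nats_upto x. \<Sum>d\<in>nats_upto (x / real m). g d m)"
    by (subst sum.Sigma) auto
  finally show ?thesis .
qed

text \<open>With d = ln (n + 1) - ln n, the expression n ln n - n + 1 grows by ln (n + 1) + n d - 1.
  From 1 / (n + 1) \<le> d \<le> 1 / n follow n d \<le> 1, which carries the lower bound, and (n +
  1) d \<ge> 1, which carries the upper one.\<close>

lemma ln_sum_bounds_nat:
  assumes "n \<ge> 1"
  shows "(\<Sum>k=1..n. ln (real k)) \<ge> n * ln n - n + 1"
    and "(\<Sum>k=1..n. ln (real k)) \<le> n * ln n - n + 1 + ln n"
proof -
  have "(\<Sum>k=1..n. ln (real k)) \<ge> n * ln n - n + 1 \<and> (\<Sum>k=1..n. ln (real k)) \<le> n * ln n - n + 1 + ln n"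
    using assms
  proof (induction n rule: dec_induct)
    case (step n)
    define d where "d = ln (real (Suc n)) - ln (real n)"
    have "ln (1 + 1 / real n) \<le> 1 / real n" by (rule ln_add_one_self_le_self) simp
    moreover have "1 + 1 / real n = real (Suc n) / real n" using step by (simp add: field_simps)
    ultimately have d1: "d \<le> 1 / real n"
      using step by (simp add: d_def ln_div)
    have "ln (real n / real (Suc n)) \<le> real n / real (Suc n) - 1"
      using step by (intro ln_le_minus_one) auto
    also have "real n / real (Suc n) - 1 = - (1 / real (Suc n))" by (simp add: field_simps)
    finally have d2: "d \<ge> 1 / real (Suc n)"
      using step by (simp add: d_def ln_div)
    have "real n * d \<le> 1" using d1 step by (simp add: field_simps)
    moreover have "real (Suc n) * d \<ge> 1" using d2 by (simp add: field_simps)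
    ultimately show ?case using step.IH by (simp add: d_def algebra_simps)
  qed auto
  thus "(\<Sum>k=1..n. ln (real k)) \<ge> n * ln n - n + 1"
    and "(\<Sum>k=1..n. ln (real k)) \<le> n * ln n - n + 1 + ln n" by auto
qed

text \<open>The derivative of t ln t - t is ln t. The mean value theorem thus transfers the integer
  bounds from the floor of x to x.\<close>

lemma mult_ln_minus_self_diff:
  assumes "1 \<le> a" "a \<le> (b::real)"
  shows "a * ln a - a \<le> b * ln b - b" "b * ln b - b \<le> a * ln a - a + (b - a) * ln b"
proof -
  have *: "\<exists>z. a \<le> z \<and> z \<le> b \<and> (b * ln b - b) - (a * ln a - a) = (b - a) * ln z"
  proof (cases "a = b")
    case False
    hence "a < b" using assms by simp
    have "\<exists>z. a < z \<and> z < b \<and> (b * ln b - b) - (a * ln a - a) = (b - a) * ln z"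
      by (rule MVT2[OF \<open>a < b\<close>]) (use assms in \<open>auto intro!: derivative_eq_intros\<close>)
    thus ?thesis using less_imp_le by blast
  qed auto
  then obtain z where z: "a \<le> z" "z \<le> b" "(b * ln b - b) - (a * ln a - a) = (b - a) * ln z"
    by blast
  have "0 \<le> (b - a) * ln z" using z assms by (intro mult_nonneg_nonneg) auto
  moreover have "(b - a) * ln z \<le> (b - a) * ln b"
    using z assms by (intro mult_left_mono) auto
  ultimately show "a * ln a - a \<le> b * ln b - b" "b * ln b - b \<le> a * ln a - a + (b - a) * ln b"
    using z by linarith+
qed

lemma ln_sum_bounds:
  assumes "x \<ge> 1"
  shows "\<bar>(\<Sum>n\<in>nats_upto x. ln (real n)) - (x * ln x - x + 1)\<bar> \<le> ln x"
proof -
  define n where "n = nat \<lfloor>x\<rfloor>"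
  have n: "n \<ge> 1" "real n \<le> x" "x < real n + 1"
    using assms unfolding n_def by linarith+
  have "(\<Sum>n\<in>nats_upto x. ln (real n)) = (\<Sum>k=1..n. ln (real k))"
    by (simp add: nats_upto_altdef n_def)
  moreover note ln_sum_bounds_nat[OF n(1)]
  moreover have "real n * ln n - n \<le> x * ln x - x" "x * ln x - x \<le> n * ln n - n + (x - n) * ln x"
    using mult_ln_minus_self_diff[of "real n" x] n by auto
  moreover have "(x - n) * ln x \<le> 1 * ln x" using n assms by (intro mult_right_mono) auto
  moreover have "ln (real n) \<le> ln x" using n by (subst ln_le_cancel_iff) auto
  ultimately show ?thesis by linarith
qed

section \<open>Chebyshev's function and Mertens' estimate\<close>

definition psi :: "real \<Rightarrow> real" where
  "psi x = (\<Sum>n\<in>nats_upto x. mangoldt n)"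

lemma psi_nonneg: "psi x \<ge> 0"
  unfolding psi_def by (intro sum_nonneg mangoldt_nonneg)

lemma ln_sum_conv_mangoldt:
  "(\<Sum>n\<in>nats_upto x. ln (real n)) = (\<Sum>d\<in>nats_upto x. mangoldt d * real (card (nats_upto (x / real d))))"
proof -
  have "(\<Sum>n\<in>nats_upto x. ln (real n)) = (\<Sum>n\<in>nats_upto x. \<Sum>d | d dvd n. mangoldt d)"
    by (intro sum.cong refl, subst mangoldt_sum) (auto simp: mem_nats_upto)
  also have "\<dots> = (\<Sum>d\<in>nats_upto x. \<Sum>m\<in>nats_upto (x / real d). mangoldt d)"
    by (rule sum_nats_upto_divisors)
  finally show ?thesis by (simp add: mult_ac)
qed

text \<open>Chebyshev's argument: in L x - 2 L (x/2) each \<open>mangoldt d\<close> has the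
  coefficient floor y - 2 floor (y/2) with y = x / d, which is never negative and equals 1 for x/2 <
  d \<le> x. The logarithmic sums leave x ln 2 + 3 ln x, at most 4 x.\<close>

lemma psi_half_bound:
  assumes "x \<ge> 1"
  shows "psi x \<le> psi (x / 2) + 4 * x"
proof (cases "x \<ge> 2")
  case True
  define L where "L = (\<lambda>x. \<Sum>n\<in>nats_upto x. ln (real n))"
  have sub: "nats_upto (x/2) \<subseteq> nats_upto x" using assms by (intro nats_upto_mono) auto
  \<comment> \<open>For d > x/2 the floor of x / (2 d) is 0, so both logarithmic sums may range over
    \<open>nats_upto x\<close>.\<close>
  have L2: "L (x/2) = (\<Sum>d\<in>nats_upto x. mangoldt d * real (card (nats_upto (x / 2 / real d))))"
    unfolding L_def ln_sum_conv_mangoldt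
  proof (rule sum.mono_neutral_left[OF _ sub], safe)
    fix d assume "d \<in> nats_upto x" "d \<notin> nats_upto (x/2)"
    hence "x / 2 / real d < 1" by (auto simp: mem_nats_upto field_simps)
    thus "mangoldt d * real (card (nats_upto (x / 2 / real d))) = 0"
      by (simp add: nats_upto_empty)
  qed auto
  have "psi x - psi (x/2) = (\<Sum>d\<in>nats_upto x - nats_upto (x/2). mangoldt d)"
    unfolding psi_def by (simp add: sum_diff sub)
  also have "\<dots> = (\<Sum>d\<in>nats_upto x. if d \<in> nats_upto (x/2) then 0 else mangoldt d)"
    by (intro sum.mono_neutral_cong_left) auto
  also have "\<dots> \<le> (\<Sum>d\<in>nats_upto x. mangoldt d * (real (card (nats_upto (x / real d)))
                    - 2 * real (card (nats_upto (x / 2 / real d)))))"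
  proof (intro sum_mono)
    fix d assume d: "d \<in> nats_upto x"
    define y where "y = x / real d"
    have y: "y \<ge> 1" using d by (auto simp: y_def mem_nats_upto field_simps)
    have yd: "x / 2 / real d = y / 2" by (simp add: y_def)
    have "real (card (nats_upto y)) - 2 * real (card (nats_upto (y / 2))) \<ge> 0"
    proof -
      have "2 * \<lfloor>y / 2\<rfloor> \<le> \<lfloor>y\<rfloor>" by linarith
      hence "2 * real_of_int \<lfloor>y / 2\<rfloor> \<le> real_of_int \<lfloor>y\<rfloor>" by linarith
      thus ?thesis using y by (simp add: card_nats_upto)
    qed
    moreover have "real (card (nats_upto y)) - 2 * real (card (nats_upto (y / 2))) \<ge> 1"
      if "d \<notin> nats_upto (x/2)"
    proof -
      have "y / 2 < 1" using that d by (auto simp: y_def mem_nats_upto field_simps)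
      thus ?thesis using y by (simp add: card_nats_upto nats_upto_empty)
    qed
    ultimately show "(if d \<in> nats_upto (x/2) then 0 else mangoldt d) \<le> 
       mangoldt d * (real (card (nats_upto (x / real d))) - 2 * real (card (nats_upto (x / 2 / real d))))"
      unfolding yd y_def[symmetric]
      using mult_left_mono[of 1 _ "mangoldt d :: real"] mangoldt_nonneg[of d]
      by (auto intro!: mult_nonneg_nonneg)
  qed
  also have "\<dots> = L x - 2 * L (x/2)"
    unfolding L2 by (simp add: L_def ln_sum_conv_mangoldt ring_distribs sum_subtractf sum_distrib_left mult_ac)
  also have "\<dots> \<le> (x * ln x - x + 1 + ln x) - 2 * (x/2 * ln (x/2) - x/2 + 1 - ln (x/2))"
    using ln_sum_bounds[of x] ln_sum_bounds[of "x/2"] True by (simp add: L_def abs_le_iff)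
  also have "\<dots> = x * ln 2 + 3 * ln x - 2 * ln 2 - 1"
    using True by (simp add: ln_div algebra_simps)
  also have "\<dots> \<le> x * 1 + 3 * x"
  proof -
    have "x * ln 2 \<le> x * 1" using True ln_2_less_1 by (intro mult_left_mono) auto
    moreover have "ln x \<le> x" using True ln_le_minus_one[of x] by linarith
    ultimately show ?thesis using ln_gt_zero[of 2] by linarith
  qed
  finally show ?thesis by simp
next
  case False
  hence "\<lfloor>x\<rfloor> = 1" using assms by linarith
  hence "psi x = 0" by (simp add: psi_def nats_upto_altdef)
  thus ?thesis using psi_nonneg[of "x/2"] assms by simp
qed

text \<open>Iterated halving produces the geometric series 4 x (1 + 1/2 + 1/4 + ...) = 8 x; the
  floor of x serves as induction measure.\<close>

lemma psi_bound: "x \<ge> 0 \<Longrightarrow> psi x \<le> 8 * x"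
proof (induction "nat \<lfloor>x\<rfloor>" arbitrary: x rule: less_induct)
  case less
  show ?case
  proof (cases "x \<ge> 1")
    case True
    have "2 * \<lfloor>x / 2\<rfloor> \<le> \<lfloor>x\<rfloor>" "\<lfloor>x\<rfloor> \<ge> 1" using True by linarith+
    hence "nat \<lfloor>x / 2\<rfloor> < nat \<lfloor>x\<rfloor>" by linarith
    hence "psi (x/2) \<le> 8 * (x / 2)" using True by (intro less) auto
    thus ?thesis using psi_half_bound[OF True] by simp
  next
    case False
    thus ?thesis using less by (simp add: psi_def nats_upto_empty)
  qed
qed

text \<open>Replacing the floor of x / d by x / d in \<open>ln_sum_conv_mangoldt\<close> costs at
  most psi x \<le> 8 x, and the sum of logarithms is x ln x + O(x). Division by x leaves the
  explicit constant 9, the source of the later constants 18 and 19.\<close>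

lemma mertens:
  assumes "x \<ge> 1"
  shows "\<bar>(\<Sum>n\<in>nats_upto x. mangoldt n / real n) - ln x\<bar> \<le> 9"
proof -
  define M where "M = (\<Sum>n\<in>nats_upto x. mangoldt n / real n)"
  define L where "L = (\<Sum>n\<in>nats_upto x. ln (real n))"
  have "L \<le> (\<Sum>d\<in>nats_upto x. mangoldt d * (x / real d))"
    unfolding L_def ln_sum_conv_mangoldt
    by (intro sum_mono mult_left_mono mangoldt_nonneg card_nats_upto_bounds) (use assms in auto)
  also have "\<dots> = x * M" by (simp add: M_def sum_distrib_left mult_ac)
  finally have 1: "L \<le> x * M" .
  have "x * M - psi x = (\<Sum>d\<in>nats_upto x. mangoldt d * (x / real d - 1))"
    by (simp add: M_def psi_def sum_distrib_left right_diff_distrib sum_subtractf mult_ac)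
  also have "\<dots> \<le> L"
    unfolding L_def ln_sum_conv_mangoldt
    by (intro sum_mono mult_left_mono mangoldt_nonneg less_imp_le[OF card_nats_upto_bounds(2)])
       (use assms in auto)
  finally have 2: "x * M \<le> L + 8 * x" using psi_bound[of x] assms by linarith
  have L: "\<bar>L - (x * ln x - x + 1)\<bar> \<le> ln x" using ln_sum_bounds[OF assms] by (simp add: L_def)
  have ln: "ln x \<le> x - 1" using assms by (intro ln_le_minus_one) auto
  have "x * (M - ln x) \<ge> x * (- 9)" using 1 L ln assms by (simp add: algebra_simps)
  moreover have "x * (M - ln x) \<le> x * 9" using 2 L ln assms by (simp add: algebra_simps)
  ultimately have "-9 \<le> M - ln x" "M - ln x \<le> 9"
    using assms mult_le_cancel_left_pos[of x "-9" "M - ln x"] mult_le_cancel_left_pos[of x "M - ln x" 9]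
    by linarith+
  thus ?thesis by (simp add: M_def abs_le_iff)
qed

section \<open>Selberg's formula\<close>

definition mu :: "nat \<Rightarrow> real" where
  "mu n = (if squarefree n then (-1) ^ card (prime_factors n) else 0)"

lemma abs_mu_le: "\<bar>mu n\<bar> \<le> 1"
  by (simp add: mu_def)

lemma mu_1 [simp]: "mu (Suc 0) = 1"
  by (simp add: mu_def)

lemma mu_prime_mult:
  assumes "prime p" "\<not> p dvd d" "d > 0"
  shows "mu (p * d) = - mu d"
proof -
  have cop: "coprime p d" using assms prime_imp_coprime by blast
  have sq: "squarefree (p * d) \<longleftrightarrow> squarefree d"
    using squarefree_mult_coprime[OF cop] squarefree_multD[of p d] assms by (auto simp: squarefree_prime)
  have "prime_factors (p * d) = insert p (prime_factors d)"
    using assms by (subst prime_factors_product) (auto simp: prime_factorization_prime)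
  moreover have "p \<notin> prime_factors d" using assms by auto
  ultimately show ?thesis by (simp add: mu_def sq)
qed

text \<open>For a prime p dividing n, multiplication by p pairs the squarefree divisors prime to p
  with those divisible by p, and \<open>mu\<close> changes sign within each pair.\<close>

lemma sum_divisors_mu:
  assumes "n > 0"
  shows "(\<Sum>d | d dvd n. mu d) = (if n = 1 then 1 else 0)"
proof (cases "n = 1")
  case False
  then obtain p where p: "prime p" "p dvd n" using prime_factor_nat by blast
  define D where "D = {d. d dvd n \<and> squarefree d \<and> \<not> p dvd d}"
  define D' where "D' = {d. d dvd n \<and> squarefree d \<and> p dvd d}"
  have fin: "finite {d. d dvd n}" using assms by simp
  have finD: "finite D" "finite D'" unfolding D_def D'_def by (auto intro: finite_subset[OF _ fin])
  have "(\<Sum>d | d dvd n. mu d) = (\<Sum>d\<in>D \<union> D'. mu d)"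
    by (rule sum.mono_neutral_right) (use fin in \<open>auto simp: D_def D'_def mu_def\<close>)
  also have "\<dots> = (\<Sum>d\<in>D. mu d) + (\<Sum>d\<in>D'. mu d)"
    by (rule sum.union_disjoint) (use finD in \<open>auto simp: D_def D'_def\<close>)
  also have "(\<Sum>d\<in>D'. mu d) = (\<Sum>d\<in>D. mu (p * d))"
  proof (rule sum.reindex_bij_witness[of _ "\<lambda>d. p * d" "\<lambda>d. d div p"])
    fix d assume d: "d \<in> D'"
    then obtain e where e: "d = p * e" by (auto simp: D'_def elim: dvdE)
    have "\<not> p dvd e"
    proof
      assume "p dvd e"
      hence "p ^ 2 dvd d" by (auto simp: e power2_eq_square)
      hence "is_unit p" using d by (auto simp: D'_def squarefree_def)
      thus False using p by simp
    qed
    thus "p * (d div p) = d" "d div p \<in> D" "mu (p * (d div p)) = mu d"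
      using d p by (auto simp: D'_def D_def e dest: dvd_mult_right squarefree_multD)
  next
    fix d assume d: "d \<in> D"
    have "coprime p d" using d p prime_imp_coprime by (auto simp: D_def)
    thus "(p * d) div p = d" "p * d \<in> D'"
      using d p by (auto simp: D_def D'_def squarefree_mult_coprime squarefree_prime divides_mult prime_gt_0_nat)
  qed
  also have "\<dots> = (\<Sum>d\<in>D. - mu d)"
    by (intro sum.cong refl mu_prime_mult) (use p assms in \<open>auto simp: D_def intro: Nat.gr0I\<close>)
  finally show ?thesis using False by (simp add: sum_negf)
qed auto

lemma sum_divisors_swap:
  fixes g :: "nat \<Rightarrow> nat \<Rightarrow> 'a :: comm_monoid_add"
  assumes "n > 0"
  shows "(\<Sum>d | d dvd n. \<Sum>e | e dvd n div d. g d e) = (\<Sum>e | e dvd n. \<Sum>d | d dvd n div e. g d e)"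
proof -
  have fin: "finite {k. k dvd n div d}" if "d dvd n" for d
    using assms that by (auto elim!: dvdE)
  have "(\<Sum>d | d dvd n. \<Sum>e | e dvd n div d. g d e) =
        (\<Sum>(d,e)\<in>(SIGMA d:{d. d dvd n}. {e. e dvd n div d}). g d e)"
    by (subst sum.Sigma) (use assms fin in auto)
  also have "\<dots> = (\<Sum>(e,d)\<in>(SIGMA e:{e. e dvd n}. {d. d dvd n div e}). g d e)"
    by (rule sum.reindex_bij_witness[of _ prod.swap prod.swap])
       (use assms in \<open>auto elim!: dvdE simp: mult_ac\<close>)
  also have "\<dots> = (\<Sum>e | e dvd n. \<Sum>d | d dvd n div e. g d e)"
    by (subst sum.Sigma) (use assms fin in auto)
  finally show ?thesis .
qed

text \<open>Moebius inversion of \<open>mangoldt_sum\<close> evaluates the convolution of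
  \<open>mu\<close> and ln. Writing ln (n / d) = ln n - ln d, the ln n part vanishes for n > 1 by
  \<open>sum_divisors_mu\<close> and for n = 1 because ln 1 = 0.\<close>

lemma sum_divisors_mu_ln:
  assumes "n > 0"
  shows "(\<Sum>d | d dvd n. mu d * ln (real d)) = - mangoldt n"
proof -
  have "(\<Sum>d | d dvd n. mu d * ln (real (n div d))) = (\<Sum>d | d dvd n. \<Sum>e | e dvd n div d. mu d * mangoldt e)"
  proof (intro sum.cong refl)
    fix d assume "d \<in> {d. d dvd n}"
    hence "n div d > 0" using assms by (auto elim!: dvdE)
    thus "mu d * ln (real (n div d)) = (\<Sum>e | e dvd n div d. mu d * mangoldt e)"
      by (simp flip: sum_distrib_left add: mangoldt_sum)
  qed
  also have "\<dots> = (\<Sum>e | e dvd n. \<Sum>d | d dvd n div e. mu d * mangoldt e)"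
    using assms by (rule sum_divisors_swap)
  also have "\<dots> = (\<Sum>e | e dvd n. if e = n then mangoldt e else 0)"
  proof (intro sum.cong refl)
    fix e assume e: "e \<in> {e. e dvd n}"
    hence "n div e > 0" using assms by (auto elim!: dvdE)
    moreover have "n div e = 1 \<longleftrightarrow> e = n" using e assms by (auto elim!: dvdE)
    ultimately show "(\<Sum>d | d dvd n div e. mu d * mangoldt e) = (if e = n then mangoldt e else 0)"
      by (simp flip: sum_distrib_right add: sum_divisors_mu)
  qed
  also have "\<dots> = mangoldt n" using assms by simp
  finally have *: "(\<Sum>d | d dvd n. mu d * ln (real (n div d))) = mangoldt n" .
  have "(\<Sum>d | d dvd n. mu d * ln (real (n div d))) = (\<Sum>d | d dvd n. mu d * (ln (real n) - ln (real d)))"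
    by (intro sum.cong refl arg_cong2[of _ _ _ _ "(*)"])
       (use assms in \<open>auto elim!: dvdE simp: ln_mult\<close>)
  also have "\<dots> = ln (real n) * (\<Sum>d | d dvd n. mu d) - (\<Sum>d | d dvd n. mu d * ln (real d))"
    by (simp add: right_diff_distrib sum_subtractf sum_distrib_left mult_ac)
  also have "ln (real n) * (\<Sum>d | d dvd n. mu d) = 0"
    using assms by (simp add: sum_divisors_mu)
  finally show ?thesis using * by linarith
qed

text \<open>Moebius inversion with the extra weight ln (x / d) = ln x - ln d. After collecting d m =
  n, the ln x part survives only at n = 1, and the ln d part produces
  \<open>mangoldt n\<close>.\<close>

lemma tatuzawa_iseki:
  fixes F :: "real \<Rightarrow> real"
  assumes x: "x \<ge> 1"
  shows "(\<Sum>d\<in>nats_upto x. mu d * ln (x / real d) * (\<Sum>m\<in>nats_upto (x / real d). F (x / real d / real m))) =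
         F x * ln x + (\<Sum>n\<in>nats_upto x. mangoldt n * F (x / real n))"
proof -
  have "(\<Sum>d\<in>nats_upto x. mu d * ln (x / real d) * (\<Sum>m\<in>nats_upto (x / real d). F (x / real d / real m)))
      = (\<Sum>d\<in>nats_upto x. \<Sum>m\<in>nats_upto (x / real d). mu d * ln (x / real d) * F (x / real (d * m)))"
    by (simp add: sum_distrib_left)
  also have "\<dots> = (\<Sum>n\<in>nats_upto x. \<Sum>d | d dvd n. mu d * ln (x / real d) * F (x / real (d * (n div d))))"
    by (rule sum_nats_upto_divisors[symmetric])
  also have "\<dots> = (\<Sum>n\<in>nats_upto x. (if n = 1 then F x * ln x else 0) + mangoldt n * F (x / real n))"
  proof (intro sum.cong refl)
    fix n assume n: "n \<in> nats_upto x"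
    hence n0: "n > 0" by (simp add: mem_nats_upto)
    have "(\<Sum>d | d dvd n. mu d * ln (x / real d) * F (x / real (d * (n div d)))) =
          (\<Sum>d | d dvd n. mu d * (ln x - ln (real d)) * F (x / real n))"
      by (intro sum.cong refl) (use x n0 in \<open>auto elim!: dvdE simp: ln_div\<close>)
    also have "\<dots> = (ln x * (\<Sum>d | d dvd n. mu d) - (\<Sum>d | d dvd n. mu d * ln (real d))) * F (x / real n)"
      by (simp add: right_diff_distrib sum_subtractf sum_distrib_left left_diff_distrib sum_distrib_right mult_ac)
    also have "\<dots> = (if n = 1 then F x * ln x else 0) + mangoldt n * F (x / real n)"
      using n0 by (simp add: sum_divisors_mu sum_divisors_mu_ln)
    finally show "(\<Sum>d | d dvd n. mu d * ln (x / real d) * F (x / real (d * (n div d)))) =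
       (if n = 1 then F x * ln x else 0) + mangoldt n * F (x / real n)" .
  qed
  also have "\<dots> = F x * ln x + (\<Sum>n\<in>nats_upto x. mangoldt n * F (x / real n))"
    using x by (simp add: sum.distrib mem_nats_upto)
  finally show ?thesis .
qed

lemma harm_ln_bounds:
  assumes "n > 0"
  shows "harm n - ln (real n) - euler_mascheroni \<in> {0..1 / real n}"
proof -
  have "euler_mascheroni \<le> harm n - ln (real n)"
    by (rule LIMSEQ_le_const2[OF euler_mascheroni_LIMSEQ])
       (use euler_mascheroni_sequence_decreasing[OF assms] in blast)
  moreover have "harm n - ln (real n) - euler_mascheroni \<le> 1 / real n"
  proof (cases n)
    case (Suc m)
    have "euler_mascheroni \<ge> harm (Suc m) - ln (real_of_nat (m + 2)) + 1/real_of_nat (2 * (m + 2))"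
      by (rule euler_mascheroni_lower)
    moreover have "ln (real_of_nat (m + 2)) - ln (real n) \<le> 1 / real n"
    proof -
      have "ln (real_of_nat (m + 2)) - ln (real n) = ln (1 + 1 / real n)"
      proof -
        have "real_of_nat (m + 2) = real n * (1 + 1 / real n)"
          using assms Suc by (simp add: field_simps)
        moreover have "ln (real n * (1 + 1 / real n)) = ln (real n) + ln (1 + 1 / real n)"
          using assms by (intro ln_mult_pos) (auto intro: add_pos_nonneg)
        ultimately show ?thesis by (metis add_diff_cancel_left')
      qed
      thus ?thesis by (simp add: ln_add_one_self_le_self)
    qed
    moreover have "1/real_of_nat (2 * (m + 2)) \<ge> 0" by simp
    ultimately show ?thesis unfolding Suc by linarith
  qed (use assms in auto)
  ultimately show ?thesis by simp
qed

lemma sum_inverse_nats_upto_bounds: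
  assumes "x \<ge> 1"
  shows "\<bar>(\<Sum>n\<in>nats_upto x. 1 / real n) - ln x - euler_mascheroni\<bar> \<le> 2 / x"
proof -
  define n where "n = nat \<lfloor>x\<rfloor>"
  have n: "n \<ge> 1" "real n \<le> x" "x < real n + 1"
    using assms unfolding n_def by linarith+
  have "(\<Sum>n\<in>nats_upto x. 1 / real n) = harm n"
    by (simp add: nats_upto_altdef n_def harm_def inverse_eq_divide)
  moreover have "harm n - ln (real n) - euler_mascheroni \<in> {0..1 / real n}"
    using n by (intro harm_ln_bounds) auto
  moreover have "0 \<le> ln x - ln (real n)" using n by simp
  moreover have "ln x - ln (real n) \<le> 1 / real n"
  proof -
    have "ln x - ln (real n) = ln (x / real n)" using n by (simp add: ln_div)
    also have "\<dots> \<le> x / real n - 1" using n by (intro ln_le_minus_one) auto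
    also have "\<dots> = (x - real n) / real n" using n by (simp add: field_simps)
    also have "\<dots> \<le> 1 / real n" using n by (intro divide_right_mono) auto
    finally show ?thesis .
  qed
  moreover have "1 / real n \<le> 2 / x" using n by (simp add: field_simps)
  ultimately show ?thesis by auto
qed

text \<open>1 / sqrt n is at most 2 (sqrt n - sqrt (n - 1)), and this telescopes.\<close>

lemma sum_inverse_sqrt_le:
  assumes "x \<ge> 0"
  shows "(\<Sum>n\<in>nats_upto x. sqrt (x / real n)) \<le> 2 * x"
proof -
  have *: "(\<Sum>n=1..N. 1 / sqrt (real n)) \<le> 2 * sqrt (real N)" for N
  proof (induction N)
    case (Suc N)
    define a b where "a = sqrt (real N)" and "b = sqrt (real (Suc N))"
    have ab: "b > 0" "a \<ge> 0" "a \<le> b" "b\<^sup>2 - a\<^sup>2 = 1" by (auto simp: a_def b_def)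
    have "1 = (b - a) * (b + a)" using ab(4) by (simp add: algebra_simps power2_eq_square)
    also have "\<dots> \<le> (b - a) * (2 * b)" using ab by (intro mult_left_mono) auto
    finally have "1 / b \<le> 2 * b - 2 * a" using ab by (simp add: field_simps)
    thus ?case using Suc.IH by (simp add: a_def b_def)
  qed auto
  have "(\<Sum>n\<in>nats_upto x. sqrt (x / real n)) = sqrt x * (\<Sum>n=1..nat \<lfloor>x\<rfloor>. 1 / sqrt (real n))"
    by (simp add: nats_upto_altdef sum_distrib_left real_sqrt_divide)
  also have "\<dots> \<le> sqrt x * (2 * sqrt (real (nat \<lfloor>x\<rfloor>)))"
    using assms by (intro mult_left_mono *) auto
  also have "\<dots> \<le> sqrt x * (2 * sqrt x)"
    using assms by (intro mult_left_mono) auto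
  also have "\<dots> = 2 * x" using assms by simp
  finally show ?thesis .
qed

text \<open>With y the fourth root of x, ln x = 4 ln y \<le> 4 y, which gives 4 y times 5 y. Growth
  like a square root is slow enough for the errors at x / d to add up to O(x).\<close>

lemma ln_mult_ln_le_sqrt:
  assumes "x \<ge> 1"
  shows "ln x * (1 + ln x) \<le> 20 * sqrt x"
proof -
  define y where "y = sqrt (sqrt x)"
  have y: "y \<ge> 1" "x = y ^ 4" using assms by (auto simp: y_def power4_eq_xxxx simp flip: mult.assoc)
    (simp add: mult.assoc)
  have "ln x = 4 * ln y" using y by (simp add: ln_realpow)
  also have "\<dots> \<le> 4 * y" using y ln_le_minus_one[of y] by simp
  finally have 1: "ln x \<le> 4 * y" .
  have "ln x * (1 + ln x) \<le> (4 * y) * (y + 4 * y)"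
    using 1 y assms by (intro mult_mono add_mono) auto
  also have "\<dots> = 20 * y ^ 2" by (simp add: power2_eq_square)
  also have "y ^ 2 = sqrt x" using assms by (simp add: y_def)
  finally show ?thesis .
qed

lemma sum_psi_nats_upto: "(\<Sum>n\<in>nats_upto x. psi (x / real n)) = (\<Sum>n\<in>nats_upto x. ln (real n))"
proof -
  have "(\<Sum>n\<in>nats_upto x. psi (x / real n)) = (\<Sum>n\<in>nats_upto x. \<Sum>m\<in>nats_upto (x / real n). mangoldt m)"
    by (simp add: psi_def)
  also have "\<dots> = (\<Sum>m\<in>nats_upto x. \<Sum>n\<in>nats_upto (x / real m). mangoldt m)"
    by (rule sum_nats_upto_swap)
  also have "\<dots> = (\<Sum>n\<in>nats_upto x. ln (real n))"
    by (simp add: ln_sum_conv_mangoldt mult_ac)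
  finally show ?thesis .
qed

text \<open>\<open>tatuzawa_iseki\<close> is applied to a function F, close to psi x - x, whose sums
  over x / m are O(1 + ln x). Its left side is then bounded by a multiple of the sum of ln (x/d) (1
  + ln (x/d)), hence O(x), and Mertens' estimate evaluates the contribution of - x to its right
  side.\<close>

theorem selberg_upper:
  obtains C where "C \<ge> 0" "\<And>x. x \<ge> 1 \<Longrightarrow>
    psi x * ln x + (\<Sum>n\<in>nats_upto x. mangoldt n * psi (x / real n)) \<le> 2 * x * ln x + C * x"
proof -
  \<comment> \<open>This constant makes \<open>\<Sum>F(x/m)\<close> of order \<open>ln x\<close>.\<close>
  define g :: real where "g = euler_mascheroni + 1"
  have g0: "g \<ge> 0" using euler_mascheroni_pos by (simp add: g_def)
  define F where "F = (\<lambda>x. psi x - x + g)"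
  define K where "K = 5 + g"
  have G: "\<bar>\<Sum>m\<in>nats_upto x. F (x / real m)\<bar> \<le> K * (1 + ln x)" if x: "x \<ge> 1" for x
  proof -
    define L where "L = (\<Sum>n\<in>nats_upto x. ln (real n))"
    define H where "H = (\<Sum>n\<in>nats_upto x. 1 / real n)"
    have "(\<Sum>m\<in>nats_upto x. F (x / real m)) = L - x * H + g * real (card (nats_upto x))"
      by (simp add: F_def L_def H_def sum.distrib sum_subtractf sum_psi_nats_upto sum_distrib_left mult_ac)
    moreover have "\<bar>L - (x * ln x - x + 1)\<bar> \<le> ln x"
      using ln_sum_bounds[OF x] by (simp add: L_def)
    moreover have "\<bar>x * H - x * ln x - x * euler_mascheroni\<bar> \<le> 2"
    proof -
      have "x * \<bar>H - ln x - euler_mascheroni\<bar> \<le> x * (2 / x)"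
        using sum_inverse_nats_upto_bounds[OF x] x unfolding H_def by (intro mult_left_mono) auto
      also have "x * \<bar>H - ln x - euler_mascheroni\<bar> = \<bar>x * (H - ln x - euler_mascheroni)\<bar>"
        using x by (simp add: abs_mult)
      also have "x * (H - ln x - euler_mascheroni) = x * H - x * ln x - x * euler_mascheroni"
        by (simp add: algebra_simps)
      finally show ?thesis using x by simp
    qed
    moreover have "g * real (card (nats_upto x)) \<le> g * x" "g * x - g \<le> g * real (card (nats_upto x))"
      using card_nats_upto_bounds[of x] x g0 mult_left_mono[of "x - 1" "real (card (nats_upto x))" g]
      by (auto intro!: mult_left_mono simp: right_diff_distrib)
    moreover have "g * x = x * euler_mascheroni + x" by (simp add: g_def algebra_simps)
    moreover have "ln x \<ge> 0" using x by simp
    ultimately have "\<bar>\<Sum>m\<in>nats_upto x. F (x / real m)\<bar> \<le> ln x + 3 + g"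
      unfolding abs_le_iff by linarith
    also have "\<dots> \<le> K * (1 + ln x)"
      using g0 \<open>ln x \<ge> 0\<close> by (simp add: K_def algebra_simps)
    finally show ?thesis .
  qed
  have K0: "K \<ge> 0" using g0 by (simp add: K_def)
  define C where "C = 40 * K + 9 + 9 * g"
  have "psi x * ln x + (\<Sum>n\<in>nats_upto x. mangoldt n * psi (x / real n)) \<le> 2 * x * ln x + C * x"
    if x: "x \<ge> 1" for x
  proof -
    have "F x * ln x + (\<Sum>n\<in>nats_upto x. mangoldt n * F (x / real n)) =
       (\<Sum>d\<in>nats_upto x. mu d * ln (x / real d) * (\<Sum>m\<in>nats_upto (x / real d). F (x / real d / real m)))"
      using tatuzawa_iseki[OF x, of F] by simp
    also have "\<dots> \<le> (\<Sum>d\<in>nats_upto x. K * (20 * sqrt (x / real d)))"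
    proof (intro sum_mono)
      fix d assume "d \<in> nats_upto x"
      hence y: "x / real d \<ge> 1" by (auto simp: mem_nats_upto field_simps)
      define y where "y = x / real d"
      define S where "S = (\<Sum>m\<in>nats_upto y. F (y / real m))"
      have "mu d * ln y * S \<le> \<bar>mu d * ln y * S\<bar>" by simp
      also have "\<dots> = \<bar>mu d\<bar> * ln y * \<bar>S\<bar>" using y by (simp add: abs_mult y_def)
      also have "\<dots> \<le> 1 * ln y * (K * (1 + ln y))"
        using y G[of y] K0 by (intro mult_mono abs_mu_le) (auto simp: S_def y_def)
      also have "\<dots> = K * (ln y * (1 + ln y))" by simp
      also have "\<dots> \<le> K * (20 * sqrt y)"
        using K0 y by (intro mult_left_mono ln_mult_ln_le_sqrt) (auto simp: y_def)
      finally show "mu d * ln (x / real d) * (\<Sum>m\<in>nats_upto (x / real d). F (x / real d / real m))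
          \<le> K * (20 * sqrt (x / real d))" by (simp add: S_def y_def)
    qed
    also have "\<dots> = 20 * K * (\<Sum>d\<in>nats_upto x. sqrt (x / real d))"
      by (simp add: sum_distrib_left mult_ac)
    also have "\<dots> \<le> 20 * K * (2 * x)"
      using K0 x by (intro mult_left_mono sum_inverse_sqrt_le) auto
    finally have 1: "F x * ln x + (\<Sum>n\<in>nats_upto x. mangoldt n * F (x / real n)) \<le> 40 * K * x"
      by simp
    define M where "M = (\<Sum>n\<in>nats_upto x. mangoldt n / real n)"
    have 2: "(\<Sum>n\<in>nats_upto x. mangoldt n * F (x / real n)) =
          (\<Sum>n\<in>nats_upto x. mangoldt n * psi (x / real n)) - x * M + g * psi x"
      by (simp add: F_def algebra_simps sum.distrib sum_subtractf M_def sum_distrib_left psi_def)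
    have "x * M \<le> x * (ln x + 9)"
      using mertens[OF x] x by (intro mult_left_mono) (auto simp: M_def)
    moreover have "F x * ln x = psi x * ln x - x * ln x + g * ln x"
      by (simp add: F_def algebra_simps)
    moreover have "g * psi x \<ge> 0" "g * ln x \<ge> 0" using g0 psi_nonneg x by auto
    moreover have "C * x = 40 * K * x + 9 * x + 9 * (g * x)" "g * x \<ge> 0"
      using x g0 by (simp_all add: C_def algebra_simps)
    ultimately show ?thesis using 1 2 by (simp add: algebra_simps)
  qed
  moreover have "C \<ge> 0" using K0 g0 by (simp add: C_def)
  ultimately show ?thesis using that by blast
qed

section \<open>Integers generated by a set of primes\<close>

text \<open>P is allowed to contain composites, so a colour class of all naturals can be used as it
  is, and \<open>gen_series UNIV\<close> is the zeta function.\<close>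

definition gen :: "nat set \<Rightarrow> nat set" where
  "gen P = {n. 0 < n \<and> prime_factors n \<subseteq> P}"

lemma gen_UNIV: "gen UNIV = {0<..}"
  by (auto simp: gen_def)

lemma one_in_gen [simp]: "Suc 0 \<in> gen P"
  by (simp add: gen_def)

lemma gen_pos: "n \<in> gen P \<Longrightarrow> n > 0"
  by (simp add: gen_def)

lemma gen_mult_iff: "m * n \<in> gen P \<longleftrightarrow> m \<in> gen P \<and> n \<in> gen P"
  by (cases "m = 0"; cases "n = 0") (auto simp: gen_def prime_factors_product)

lemma gen_remove_prime:
  assumes "prime p" "p \<in> P"
  shows "gen P = gen (P - {p}) \<union> (\<lambda>n. p * n) ` gen P" "gen (P - {p}) \<inter> (\<lambda>n. p * n) ` gen P = {}"
proof -
  have p: "p > 0" using assms prime_gt_0_nat by blast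
  have pf: "prime_factors p = {p}" using assms by (simp add: prime_factorization_prime)
  show "gen P = gen (P - {p}) \<union> (\<lambda>n. p * n) ` gen P"
  proof (intro equalityI subsetI)
    fix n assume n: "n \<in> gen P"
    show "n \<in> gen (P - {p}) \<union> (\<lambda>n. p * n) ` gen P"
    proof (cases "p dvd n")
      case True
      then obtain m where "n = p * m" by blast
      thus ?thesis using n gen_mult_iff by blast
    next
      case False
      thus ?thesis using n by (auto simp: gen_def)
    qed
  next
    fix n assume "n \<in> gen (P - {p}) \<union> (\<lambda>n. p * n) ` gen P"
    moreover have "p \<in> gen P" using assms p pf by (auto simp: gen_def)
    ultimately show "n \<in> gen P" by (auto simp: gen_mult_iff) (auto simp: gen_def)
  qed
  show "gen (P - {p}) \<inter> (\<lambda>n. p * n) ` gen P = {}"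
    using assms p pf by (auto simp: gen_def prime_factors_product)
qed

lemma powr_summable_on:
  assumes "\<sigma> > 1"
  shows "(\<lambda>n. real n powr - \<sigma>) summable_on A"
proof -
  have "(\<lambda>n. real n powr - \<sigma>) summable_on UNIV"
    using assms by (subst summable_on_UNIV_nonneg_real_iff) (auto simp: summable_real_powr_iff)
  thus ?thesis by (rule summable_on_subset_banach) auto
qed

definition gen_series :: "nat set \<Rightarrow> real \<Rightarrow> real" where
  "gen_series P \<sigma> = (\<Sum>\<^sub>\<infinity>n\<in>gen P. real n powr - \<sigma>)"

lemma gen_series_ge_1:
  assumes "\<sigma> > 1"
  shows "gen_series P \<sigma> \<ge> 1"
proof -
  have "(\<Sum>\<^sub>\<infinity>n\<in>{Suc 0}. real n powr - \<sigma>) \<le> gen_series P \<sigma>"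
    unfolding gen_series_def by (intro infsum_mono2 powr_summable_on assms) auto
  thus ?thesis by simp
qed

text \<open>The members divisible by p form p times \<open>gen P\<close> itself, so the series F
  satisfies F = F' + p powr - \<sigma> times F, where F' omits p. This yields the Euler factor
  without expanding a geometric series.\<close>

lemma gen_series_remove_prime:
  assumes "\<sigma> > 1" "prime p" "p \<in> P"
  shows "gen_series P \<sigma> * (1 - real p powr - \<sigma>) = gen_series (P - {p}) \<sigma>"
proof -
  have inj: "inj_on (\<lambda>n. p * n) (gen P)"
    using assms prime_gt_0_nat[of p] by (auto simp: inj_on_def)
  have "gen_series P \<sigma> = (\<Sum>\<^sub>\<infinity>n\<in>gen (P - {p}) \<union> (\<lambda>n. p * n) ` gen P. real n powr - \<sigma>)"
    using gen_remove_prime(1)[OF assms(2,3)] by (simp add: gen_series_def)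
  also have "\<dots> = gen_series (P - {p}) \<sigma> + (\<Sum>\<^sub>\<infinity>n\<in>(\<lambda>n. p * n) ` gen P. real n powr - \<sigma>)"
    unfolding gen_series_def
    by (intro infsum_Un_disjoint powr_summable_on assms gen_remove_prime)
  also have "(\<Sum>\<^sub>\<infinity>n\<in>(\<lambda>n. p * n) ` gen P. real n powr - \<sigma>) =
             (\<Sum>\<^sub>\<infinity>n\<in>gen P. real p powr - \<sigma> * real n powr - \<sigma>)"
    by (subst infsum_reindex[OF inj]) (auto simp: o_def powr_mult)
  also have "\<dots> = real p powr - \<sigma> * gen_series P \<sigma>"
    unfolding gen_series_def by (subst infsum_cmult_right) (auto intro: powr_summable_on assms)
  finally show ?thesis by (simp add: algebra_simps)
qed

lemma gen_series_remove_primes: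
  assumes "\<sigma> > 1" "finite Q" "Q \<subseteq> P" "\<And>p. p \<in> Q \<Longrightarrow> prime p"
  shows "gen_series P \<sigma> * (\<Prod>p\<in>Q. 1 - real p powr - \<sigma>) = gen_series (P - Q) \<sigma>"
  using assms(2-)
proof (induction Q rule: finite_induct)
  case (insert p Q)
  have "gen_series P \<sigma> * (\<Prod>p\<in>insert p Q. 1 - real p powr - \<sigma>) =
        (gen_series P \<sigma> * (\<Prod>p\<in>Q. 1 - real p powr - \<sigma>)) * (1 - real p powr - \<sigma>)"
    using insert.hyps by simp
  also have "\<dots> = gen_series (P - Q) \<sigma> * (1 - real p powr - \<sigma>)"
    using insert by simp
  also have "\<dots> = gen_series (P - Q - {p}) \<sigma>"
    by (intro gen_series_remove_prime) (use insert assms in auto)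
  also have "P - Q - {p} = P - insert p Q" by auto
  finally show ?case .
qed auto

section \<open>Logarithms of Euler products\<close>

definition euler_log :: "real \<Rightarrow> nat \<Rightarrow> real" where
  "euler_log \<sigma> p = - ln (1 - real p powr - \<sigma>)"

lemma powr_neg_prime_bounds:
  assumes "\<sigma> \<ge> 1" "prime p"
  shows "0 < real p powr - \<sigma>" "real p powr - \<sigma> \<le> 1 / real p" "real p powr - \<sigma> \<le> 1 / 2"
proof -
  have p: "real p \<ge> 2" using assms prime_ge_2_nat[of p] by simp
  show "0 < real p powr - \<sigma>" using p by simp
  have "real p powr - \<sigma> \<le> real p powr -1" using p assms by (intro powr_mono) auto
  thus *: "real p powr - \<sigma> \<le> 1 / real p" using p by (simp add: powr_minus_divide)
  have "1 / real p \<le> 1 / 2" using p by (simp add: field_simps)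
  thus "real p powr - \<sigma> \<le> 1 / 2" using * by linarith
qed

text \<open>For t \<le> 1/2, - ln (1 - t) lies between t and t + 2 t^2. The error 2 / p^2 does not
  depend on \<sigma>, which later makes tails uniform down to \<sigma> = 1.\<close>

lemma euler_log_bounds:
  assumes "\<sigma> \<ge> 1" "prime p"
  shows "real p powr - \<sigma> \<le> euler_log \<sigma> p" "euler_log \<sigma> p \<le> real p powr - \<sigma> + 2 / real p ^ 2"
proof -
  note b = powr_neg_prime_bounds[OF assms]
  have p: "real p \<ge> 2" using assms prime_ge_2_nat[of p] by simp
  show "real p powr - \<sigma> \<le> euler_log \<sigma> p"
    using ln_one_minus_pos_upper_bound[of "real p powr - \<sigma>"] b by (simp add: euler_log_def)
  have "euler_log \<sigma> p \<le> real p powr - \<sigma> + 2 * (real p powr - \<sigma>)\<^sup>2"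
    using ln_one_minus_pos_lower_bound[of "real p powr - \<sigma>"] b by (simp add: euler_log_def)
  moreover have "(real p powr - \<sigma>)\<^sup>2 \<le> (1 / real p)\<^sup>2"
    using b by (intro power_mono) auto
  ultimately show "euler_log \<sigma> p \<le> real p powr - \<sigma> + 2 / real p ^ 2"
    by (simp add: power_divide)
qed

lemma euler_log_nonneg: "\<sigma> \<ge> 1 \<Longrightarrow> prime p \<Longrightarrow> euler_log \<sigma> p \<ge> 0"
  using euler_log_bounds(1)[of \<sigma> p] powr_neg_prime_bounds(1)[of \<sigma> p] by linarith

text \<open>Once the primes below N are removed from P, the members other than 1 have only prime
  factors \<ge> N and are themselves \<ge> N. The remaining series is therefore squeezed between 1
  and 1 plus a tail of the convergent sum, and its logarithm is what the partial sums still
  miss.\<close>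

theorem euler_product_log:
  assumes "\<sigma> > 1"
  shows "(\<lambda>n. if prime n \<and> n \<in> P then euler_log \<sigma> n else 0) sums ln (gen_series P \<sigma>)"
proof -
  define Q where "Q = (\<lambda>N. {p. p < N \<and> prime p \<and> p \<in> P})"
  have finQ: "finite (Q N)" for N by (simp add: Q_def)
  define T where "T = (\<lambda>N. \<Sum>\<^sub>\<infinity>n\<in>{N..}. real n powr - \<sigma>)"
  have T0: "T \<longlonglongrightarrow> 0"
  proof -
    have "summable (\<lambda>n. real n powr - \<sigma>)" using assms by (simp add: summable_real_powr_iff)
    hence "(\<lambda>N. \<Sum>n. real (n + N) powr - \<sigma>) \<longlonglongrightarrow> 0"
      by (rule suminf_exist_split2)
    moreover have "T = (\<lambda>N. \<Sum>n. real (n + N) powr - \<sigma>)"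
    proof
      fix N :: nat
      have "{N..} = (\<lambda>n. n + N) ` UNIV"
      proof (intro equalityI subsetI)
        fix n assume "n \<in> {N..}"
        thus "n \<in> (\<lambda>n. n + N) ` UNIV" by (intro image_eqI[of _ _ "n - N"]) auto
      qed auto
      hence "((\<lambda>n. real n powr - \<sigma>) has_sum T N) ((\<lambda>n. n + N) ` UNIV)"
        using powr_summable_on[OF assms] by (simp add: T_def)
      hence "((\<lambda>n. real (n + N) powr - \<sigma>) has_sum T N) UNIV"
        by (subst (asm) has_sum_reindex) (auto simp: o_def)
      thus "T N = (\<Sum>n. real (n + N) powr - \<sigma>)" by (intro sums_unique has_sum_imp_sums)
    qed
    ultimately show ?thesis by simp
  qed
  have "(\<lambda>N. gen_series (P - Q N) \<sigma>) \<longlonglongrightarrow> 1"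
  proof (rule tendsto_sandwich)
    show "eventually (\<lambda>N. 1 \<le> gen_series (P - Q N) \<sigma>) sequentially"
      using gen_series_ge_1[OF assms] by simp
    show "eventually (\<lambda>N. gen_series (P - Q N) \<sigma> \<le> 1 + T N) sequentially"
    proof (intro always_eventually allI)
      fix N
      have sub: "gen (P - Q N) - {Suc 0} \<subseteq> {N..}"
      proof
        fix n assume n: "n \<in> gen (P - Q N) - {Suc 0}"
        then obtain p where p: "prime p" "p dvd n" using prime_factor_nat[of n] by auto
        have "p \<in> P - Q N" using n p by (auto simp: gen_def in_prime_factors_iff)
        hence "N \<le> p" using p by (auto simp: Q_def)
        also have "p \<le> n" using n p by (auto simp: gen_def intro: dvd_imp_le)
        finally show "n \<in> {N..}" by simp
      qed
      have "gen_series (P - Q N) \<sigma> = (\<Sum>\<^sub>\<infinity>n\<in>{Suc 0} \<union> (gen (P - Q N) - {Suc 0}). real n powr - \<sigma>)"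
        unfolding gen_series_def by (intro arg_cong[of _ _ "infsum _"]) auto
      also have "\<dots> = 1 + (\<Sum>\<^sub>\<infinity>n\<in>gen (P - Q N) - {Suc 0}. real n powr - \<sigma>)"
        by (subst infsum_Un_disjoint) (auto intro: powr_summable_on assms)
      also have "(\<Sum>\<^sub>\<infinity>n\<in>gen (P - Q N) - {Suc 0}. real n powr - \<sigma>) \<le> T N"
        unfolding T_def using sub by (intro infsum_mono2 powr_summable_on assms) auto
      finally show "gen_series (P - Q N) \<sigma> \<le> 1 + T N" by simp
    qed
    show "(\<lambda>N. 1 + T N) \<longlonglongrightarrow> 1" using tendsto_add[OF tendsto_const T0] by simp
  qed auto
  hence "(\<lambda>N. ln (gen_series (P - Q N) \<sigma>)) \<longlonglongrightarrow> ln 1"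
    by (intro tendsto_ln) auto
  moreover have "ln (gen_series (P - Q N) \<sigma>) = ln (gen_series P \<sigma>) - (\<Sum>p\<in>Q N. euler_log \<sigma> p)" for N
  proof -
    have pos: "1 - real p powr - \<sigma> > 0" if "p \<in> Q N" for p
      using powr_neg_prime_bounds[of \<sigma> p] that assms by (auto simp: Q_def)
    have "gen_series (P - Q N) \<sigma> = gen_series P \<sigma> * (\<Prod>p\<in>Q N. 1 - real p powr - \<sigma>)"
      by (rule gen_series_remove_primes[symmetric]) (use assms finQ in \<open>auto simp: Q_def\<close>)
    hence "ln (gen_series (P - Q N) \<sigma>) = ln (gen_series P \<sigma>) + ln (\<Prod>p\<in>Q N. 1 - real p powr - \<sigma>)"
      using gen_series_ge_1[OF assms, of P] pos by (subst ln_mult_pos[symmetric]) (auto intro!: prod_pos)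
    also have "ln (\<Prod>p\<in>Q N. 1 - real p powr - \<sigma>) = (\<Sum>p\<in>Q N. ln (1 - real p powr - \<sigma>))"
      by (intro ln_prod finQ less_imp_neq[OF pos, symmetric])
    finally show ?thesis by (simp add: euler_log_def sum_negf)
  qed
  ultimately have "(\<lambda>N. ln (gen_series P \<sigma>) - (\<Sum>p\<in>Q N. euler_log \<sigma> p)) \<longlonglongrightarrow> 0" by simp
  from tendsto_diff[OF tendsto_const[of "ln (gen_series P \<sigma>)"] this]
  have "(\<lambda>N. \<Sum>p\<in>Q N. euler_log \<sigma> p) \<longlonglongrightarrow> ln (gen_series P \<sigma>)" by simp
  moreover have "(\<Sum>p\<in>Q N. euler_log \<sigma> p) = (\<Sum>n<N. if prime n \<and> n \<in> P then euler_log \<sigma> n else 0)" for N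
    by (rule sum.mono_neutral_cong_left) (auto simp: Q_def)
  ultimately show ?thesis by (simp add: sums_def)
qed

section \<open>Greedy colouring of the primes\<close>

text \<open>Each new weight is given to a class of least current load; the loads are built by
  recursion and only then identified with sums over colour classes.\<close>

lemma greedy_colouring_exists:
  fixes w :: "nat \<Rightarrow> real"
  assumes "h > 0"
  obtains c :: "nat \<Rightarrow> nat" where
    "\<And>n. c n < h"
    "\<And>n j. j < h \<Longrightarrow> (\<Sum>m\<in>{1..n}. if c m = c (Suc n) then w m else 0) \<le> (\<Sum>m\<in>{1..n}. if c m = j then w m else 0)"
proof -
  define least where "least = (\<lambda>l :: nat \<Rightarrow> real. arg_min_on l {..<h})"
  have least: "least l < h" "j < h \<Longrightarrow> l (least l) \<le> l j" for l :: "nat \<Rightarrow> real" and j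
    using arg_min_if_finite(1)[of "{..<h}" l] arg_min_least[of "{..<h}" j l] assms
    by (auto simp: least_def)
  define load where "load = rec_nat (\<lambda>_. 0) (\<lambda>n l. l(least l := l (least l) + w (Suc n)))"
  have load_0: "load 0 = (\<lambda>_. 0)" by (simp add: load_def)
  have load_Suc: "load (Suc n) = (load n)(least (load n) := load n (least (load n)) + w (Suc n))" for n
    by (simp add: load_def)
  \<comment> \<open>The colour of n depends on the loads from 1, ..., n - 1. Truncated subtraction
    gives 0 the colour of 1, which is harmless since the sums start at 1.\<close>
  define c where "c = (\<lambda>n. least (load (n - 1)))"
  have load: "load n i = (\<Sum>m\<in>{1..n}. if c m = i then w m else 0)" for n i
    by (induction n) (auto simp: load_0 load_Suc c_def)
  have "c n < h" for n by (simp add: c_def least)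
  moreover have "j < h \<Longrightarrow> load n (c (Suc n)) \<le> load n j" for n j
    by (simp add: c_def least)
  ultimately show ?thesis using that unfolding load by blast
qed

text \<open>If the spread of the loads exceeded every new weight throughout, the largest load would never
  change, so the total weight added could not exceed \<open>h * b\<close>.\<close>
lemma
  fixes w :: "nat \<Rightarrow> real" and c :: "nat \<Rightarrow> nat"
  defines "load \<equiv> (\<lambda>n i. \<Sum>m\<in>{1..n}. if c m = i then w m else 0)"
  assumes h: "h > 0" and w: "\<And>n. w n \<ge> 0" and c: "\<And>n. c n < h"
    and greedy: "\<forall>n. \<forall>j<h. load n (c (Suc n)) \<le> load n j"
  shows greedy_spread_mono:
      "\<lbrakk>m \<le> n; \<And>k. m < k \<Longrightarrow> k \<le> n \<Longrightarrow> w k \<le> b; b \<ge> 0; \<forall>i<h. \<forall>j<h. load m i - load m j \<le> b\<rbrakk>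
         \<Longrightarrow> \<forall>i<h. \<forall>j<h. load n i - load n j \<le> b"
    and greedy_spread_le:
      "\<lbrakk>m \<le> n; \<And>k. m < k \<Longrightarrow> w k \<le> d; d \<ge> 0; \<forall>i<h. \<forall>j<h. load m i - load m j \<le> b;
        (\<Sum>k\<in>{m<..n}. w k) > h * b\<rbrakk>
         \<Longrightarrow> \<forall>i<h. \<forall>j<h. load n i - load n j \<le> d"
proof -
  have load_Suc: "load (Suc n) i = load n i + (if c (Suc n) = i then w (Suc n) else 0)" for n i
    by (simp add: load_def)
  \<comment> \<open>Only the chosen class grows. It was least loaded, so afterwards it leads any
    other class by at most the new weight, and no other difference increases beyond b.\<close>
  have spread_Suc: "\<forall>i<h. \<forall>j<h. load (Suc n) i - load (Suc n) j \<le> b"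
    if "w (Suc n) \<le> b" "b \<ge> 0" "\<forall>i<h. \<forall>j<h. load n i - load n j \<le> b" for n b
  proof (intro allI impI)
    fix i j assume "i < h" "j < h"
    thus "load (Suc n) i - load (Suc n) j \<le> b"
      using that spec[OF greedy, of n] w[of "Suc n"] unfolding load_Suc by fastforce
  qed
  show mono: "\<forall>i<h. \<forall>j<h. load n i - load n j \<le> b"
    if "m \<le> n" "\<And>k. m < k \<Longrightarrow> k \<le> n \<Longrightarrow> w k \<le> b" "b \<ge> 0" "\<forall>i<h. \<forall>j<h. load m i - load m j \<le> b" for m n b
    using that
  proof (induction n rule: dec_induct)
    case (step n)
    have "\<forall>i<h. \<forall>j<h. load n i - load n j \<le> b"
      by (rule step.IH) (use step.prems in auto)
    thus ?case using step.prems step.hyps by (intro spread_Suc) auto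
  qed auto
  show "\<forall>i<h. \<forall>j<h. load n i - load n j \<le> d"
    if mn: "m \<le> n" and wd: "\<And>k. m < k \<Longrightarrow> w k \<le> d" and d: "d \<ge> 0"
      and b: "\<forall>i<h. \<forall>j<h. load m i - load m j \<le> b" and sum: "(\<Sum>k\<in>{m<..n}. w k) > h * b"
  proof (rule ccontr)
    assume contra: "\<not> (\<forall>i<h. \<forall>j<h. load n i - load n j \<le> d)"
    \<comment> \<open>A spread of at most d at some intermediate time would persist up to n, because
      all weights after m are at most d.\<close>
    have large: "\<exists>i<h. \<exists>j<h. load k i - load k j > d" if "m \<le> k" "k \<le> n" for k
    proof (rule ccontr)
      assume "\<not> (\<exists>i<h. \<exists>j<h. load k i - load k j > d)"
      hence "\<forall>i<h. \<forall>j<h. load k i - load k j \<le> d" by (meson not_less)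
      hence "\<forall>i<h. \<forall>j<h. load n i - load n j \<le> d"
        using that wd d by (intro mono[of k n]) auto
      thus False using contra by simp
    qed
    define M where "M = Max (load m ` {..<h})"
    \<comment> \<open>Some pair has load i' - load j' > d, so the least load is below M - d; adding
      a weight of at most d to it cannot pass M.\<close>
    have M: "load k i \<le> M" if "m \<le> k" "k \<le> n" "i < h" for k i
      using that
    proof (induction k arbitrary: i rule: dec_induct)
      case base
      thus ?case by (auto simp: M_def)
    next
      case (step k)
      obtain i' j' where ij: "i' < h" "j' < h" "load k i' - load k j' > d"
        using large[of k] step by auto
      have "load k i' \<le> M" using step ij by auto
      moreover have "w (Suc k) \<le> d" using step wd by auto
      moreover have "load k (c (Suc k)) \<le> load k j'" using greedy ij by blast
      moreover have "load k i \<le> M" using step by auto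
      ultimately show ?case using ij by (auto simp: load_Suc)
    qed
    have tot: "(\<Sum>i<h. load k i) = (\<Sum>m\<in>{1..k}. w m)" for k
    proof -
      have "(\<Sum>i<h. load k i) = (\<Sum>m\<in>{1..k}. \<Sum>i<h. if c m = i then w m else 0)"
        unfolding load_def by (rule sum.swap)
      thus ?thesis using c by simp
    qed
    have "M \<in> load m ` {..<h}" unfolding M_def by (rule Max_in) (use h in auto)
    then obtain i0 where i0: "i0 < h" "M = load m i0" by auto
    have "(\<Sum>m\<in>{1..n}. w m) = (\<Sum>i<h. load n i)" by (rule tot[symmetric])
    also have "\<dots> \<le> (\<Sum>i<h. M)" using mn by (intro sum_mono M) auto
    also have "\<dots> \<le> (\<Sum>i<h. load m i + b)"
    proof (intro sum_mono)
      fix i assume "i \<in> {..<h}"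
      thus "M \<le> load m i + b" using b i0 by (auto simp: algebra_simps)
    qed
    also have "\<dots> = (\<Sum>m\<in>{1..m}. w m) + h * b" by (simp add: sum.distrib tot)
    finally have "(\<Sum>m\<in>{1..n}. w m) - (\<Sum>m\<in>{1..m}. w m) \<le> h * b" by simp
    moreover have "{1..n} = {1..m} \<union> {m<..n}" using mn by auto
    hence "(\<Sum>m\<in>{1..n}. w m) = (\<Sum>m\<in>{1..m}. w m) + (\<Sum>m\<in>{m<..n}. w m)"
      by (simp only:) (subst sum.union_disjoint, auto)
    ultimately show False using sum by simp
  qed
qed

section \<open>The total weight of the primes and the balance of the colouring\<close>

definition prime_weight :: "nat \<Rightarrow> real" where
  "prime_weight n = (if prime n then euler_log 1 n else 0)"

lemma prime_weight_nonneg: "prime_weight n \<ge> 0"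
  by (simp add: prime_weight_def euler_log_nonneg)

lemma prime_weight_le: "prime_weight n \<le> 2 / real n"
proof (cases "prime n")
  case True
  have n: "real n \<ge> 2" using prime_ge_2_nat[OF True] by simp
  have "euler_log 1 n \<le> real n powr -1 + 2 / real n ^ 2" by (rule euler_log_bounds) (use True in auto)
  also have "\<dots> = 1 / real n + 2 / real n ^ 2" using n by (simp add: powr_minus_divide)
  also have "2 / real n ^ 2 \<le> 1 / real n" using n by (simp add: power2_eq_square field_simps)
  finally show ?thesis using True by (simp add: prime_weight_def)
qed (simp add: prime_weight_def)

lemma sum_inverse_squares_le: "(\<Sum>n\<in>{1..N}. 1 / real n ^ 2) \<le> 2"
proof (cases "N = 0")
  case False
  hence "N \<ge> 1" by simp
  hence "(\<Sum>n\<in>{1..N}. 1 / real n ^ 2) \<le> 2 - 1 / real N"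
  proof (induction N rule: dec_induct)
    case (step n)
    have "1 / real n - 1 / real (Suc n) = 1 / (real n * real (Suc n))"
      using step by (simp add: field_simps)
    moreover have "1 / real (Suc n) ^ 2 \<le> 1 / (real n * real (Suc n))"
      unfolding power2_eq_square using step by (intro divide_left_mono mult_right_mono) auto
    ultimately show ?case using step.IH by simp
  qed auto
  moreover have "1 / real N \<ge> 0" by simp
  ultimately show ?thesis by linarith
qed auto

text \<open>Every prime except 2 is some 2 k + 1, and 1 / (2 k + 1) \<le> 1 / (2 k), so half a
  harmonic sum suffices. A coefficient below 1 in front of ln N is all that the greedy argument
  needs. The constant absorbs the prime 2, Euler's constant and the 2 / n^2 terms.\<close>

lemma sum_prime_weight_upper:
  assumes "N \<ge> 1"
  shows "(\<Sum>n\<in>{1..N}. prime_weight n) \<le> 7 + ln (real N) / 2"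
proof -
  define odds where "odds = (\<lambda>k::nat. 2 * k + 1) ` {1..N}"
  have bd: "prime_weight n \<le> (if n = 2 then 1 / 2 else 0) + (if n \<in> odds then 1 / real n else 0) + 2 / real n ^ 2"
    if n: "n \<in> {1..N}" for n
  proof (cases "prime n")
    case True
    have n2: "n \<ge> 2" using prime_ge_2_nat[OF True] by simp
    have "euler_log 1 n \<le> real n powr -1 + 2 / real n ^ 2" by (rule euler_log_bounds) (use True in auto)
    also have "\<dots> = 1 / real n + 2 / real n ^ 2" using n2 by (simp add: powr_minus_divide)
    also have "1 / real n \<le> (if n = 2 then 1 / 2 else 0) + (if n \<in> odds then 1 / real n else 0)"
    proof (cases "n = 2")
      case False
      hence "odd n" using True prime_odd_nat[of n] n2 by auto
      then obtain k where k: "n = 2 * k + 1" by (elim oddE)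
      have "n \<in> odds" unfolding odds_def k using k n n2 by (intro imageI) auto
      thus ?thesis by simp
    qed auto
    finally show ?thesis using True by (simp add: prime_weight_def)
  qed (simp add: prime_weight_def)
  have "(\<Sum>n\<in>{1..N}. prime_weight n) \<le>
     (\<Sum>n\<in>{1..N}. if n = 2 then 1 / 2 else 0) + (\<Sum>n\<in>{1..N}. if n \<in> odds then 1 / real n else 0) +
     (\<Sum>n\<in>{1..N}. 2 / real n ^ 2)"
    unfolding sum.distrib[symmetric] by (intro sum_mono bd)
  moreover have "(\<Sum>n\<in>{1..N}. if n = 2 then 1 / 2 else 0 :: real) \<le> 1 / 2" by simp
  moreover have "(\<Sum>n\<in>{1..N}. if n \<in> odds then 1 / real n else 0) \<le> 1 + ln (real N) / 2"
  proof -
    have "(\<Sum>n\<in>{1..N}. if n \<in> odds then 1 / real n else 0) = (\<Sum>n\<in>{1..N} \<inter> odds. 1 / real n)"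
      by (rule sum.inter_restrict[symmetric]) auto
    also have "\<dots> \<le> (\<Sum>n\<in>odds. 1 / real n)"
      by (rule sum_mono2) (auto simp: odds_def)
    also have "\<dots> = (\<Sum>k\<in>{1..N}. 1 / real (2 * k + 1))"
      unfolding odds_def by (subst sum.reindex) (auto simp: inj_on_def)
    also have "\<dots> \<le> (\<Sum>k\<in>{1..N}. 1 / 2 * (1 / real k))"
      by (intro sum_mono) (auto simp: field_simps)
    also have "\<dots> = 1 / 2 * harm N" by (simp add: harm_def sum_distrib_left inverse_eq_divide)
    also have "harm N \<le> ln (real N) + euler_mascheroni + 1 / real N"
      using harm_ln_bounds[of N] assms by simp
    also have "1 / real N \<le> 1" using assms by simp
    finally show ?thesis using euler_mascheroni_less_13_over_22 by simp
  qed
  moreover have "(\<Sum>n\<in>{1..N}. 2 / real n ^ 2) \<le> 4"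
  proof -
    have "(\<Sum>n\<in>{1..N}. 2 / real n ^ 2) = 2 * (\<Sum>n\<in>{1..N}. 1 / real n ^ 2)"
      by (simp add: sum_distrib_left)
    thus ?thesis using sum_inverse_squares_le[of N] by linarith
  qed
  ultimately show ?thesis by linarith
qed

text \<open>The Euler product for a truncated sum: each n \<le> N generated with p available is
  either generated by Q or p times such a number that is again \<le> N. Hence admitting p increases
  the sum at most by the factor 1 / (1 - 1/p).\<close>

lemma sum_smooth_inverse_le:
  assumes "finite Q" "\<And>p. p \<in> Q \<Longrightarrow> prime p"
  shows "(\<Sum>n\<in>gen Q \<inter> {1..N}. 1 / real n) * (\<Prod>p\<in>Q. 1 - 1 / real p) \<le> 1"
  using assms
proof (induction Q rule: finite_induct)
  case empty
  have "gen {} \<inter> {1..N} \<subseteq> {Suc 0}"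
    by (auto simp: gen_def prime_factorization_empty_iff)
  hence "(\<Sum>n\<in>gen {} \<inter> {1..N}. 1 / real n) \<le> (\<Sum>n\<in>{Suc 0}. 1 / real n)"
    by (intro sum_mono2) auto
  thus ?case by simp
next
  case (insert p Q)
  define U where "U = (\<lambda>P. \<Sum>n\<in>gen P \<inter> {1..N}. 1 / real n)"
  have p: "prime p" "p > 0" using insert.prems prime_gt_0_nat by auto
  have pQ: "insert p Q - {p} = Q" using insert.hyps by auto
  have part: "gen (insert p Q) = gen Q \<union> (\<lambda>n. p * n) ` gen (insert p Q)"
    using gen_remove_prime(1)[of p "insert p Q"] p pQ by simp
  have "gen (insert p Q) \<inter> {1..N} \<subseteq> (gen Q \<inter> {1..N}) \<union> (\<lambda>n. p * n) ` (gen (insert p Q) \<inter> {1..N})"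
  proof
    fix n assume n: "n \<in> gen (insert p Q) \<inter> {1..N}"
    show "n \<in> (gen Q \<inter> {1..N}) \<union> (\<lambda>n. p * n) ` (gen (insert p Q) \<inter> {1..N})"
    proof (cases "n \<in> gen Q")
      case False
      hence "n \<in> (\<lambda>n. p * n) ` gen (insert p Q)" using part n by blast
      then obtain m where m: "n = p * m" "m \<in> gen (insert p Q)" by blast
      have "1 * m \<le> p * m" using p by (intro mult_right_mono) auto
      hence "m \<le> N" using n m(1) by (metis IntD2 atLeastAtMost_iff mult_1 order_trans)
      thus ?thesis using m gen_pos[OF m(2)] by auto
    qed (use n in auto)
  qed
  hence "U (insert p Q) \<le> (\<Sum>n\<in>(gen Q \<inter> {1..N}) \<union> (\<lambda>n. p * n) ` (gen (insert p Q) \<inter> {1..N}). 1 / real n)"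
    unfolding U_def by (intro sum_mono2) auto
  also have "\<dots> \<le> U Q + (\<Sum>n\<in>(\<lambda>n. p * n) ` (gen (insert p Q) \<inter> {1..N}). 1 / real n)"
    unfolding U_def by (subst sum.union_inter[symmetric]) (auto intro!: sum_nonneg)
  also have "(\<Sum>n\<in>(\<lambda>n. p * n) ` (gen (insert p Q) \<inter> {1..N}). 1 / real n) = 1 / real p * U (insert p Q)"
    unfolding U_def using p by (subst sum.reindex) (auto simp: inj_on_def sum_distrib_left)
  finally have "U (insert p Q) * (1 - 1 / real p) \<le> U Q" by (simp add: algebra_simps)
  moreover have "(\<Prod>p\<in>Q. 1 - 1 / real p) \<ge> 0"
    using insert.prems prime_gt_0_nat by (intro prod_nonneg) (auto simp: Suc_le_eq)
  ultimately have "U (insert p Q) * (1 - 1 / real p) * (\<Prod>p\<in>Q. 1 - 1 / real p) \<le> U Q * (\<Prod>p\<in>Q. 1 - 1 / real p)"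
    by (intro mult_right_mono)
  also have "\<dots> \<le> 1" unfolding U_def using insert by auto
  finally show ?case using insert.hyps by (simp add: U_def mult_ac)
qed

text \<open>Euler's argument: every n \<le> N is a product of primes \<le> N, so the harmonic sum,
  which exceeds ln N, is at most the product of 1 / (1 - 1/p). Taking logarithms gives the
  weights.\<close>

lemma sum_prime_weight_lower:
  assumes "N \<ge> 2"
  shows "(\<Sum>n\<in>{1..N}. prime_weight n) \<ge> ln (ln (real N))"
proof -
  define Q where "Q = {p\<in>{1..N}. prime p}"
  have Q: "finite Q" "\<And>p. p \<in> Q \<Longrightarrow> prime p" by (auto simp: Q_def)
  have pos: "1 - 1 / real p > 0" if "p \<in> Q" for p
    using prime_gt_1_nat[OF Q(2)[OF that]] by simp
  have sub: "{1..N} \<subseteq> gen Q"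
    by (auto simp: gen_def Q_def in_prime_factors_iff Suc_le_eq prime_gt_0_nat intro: order_trans[OF dvd_imp_le])
  have "harm N = (\<Sum>n\<in>gen Q \<inter> {1..N}. 1 / real n)"
    using sub by (simp add: harm_def inverse_eq_divide Int_absorb1)
  hence *: "harm N * (\<Prod>p\<in>Q. 1 - 1 / real p) \<le> 1"
    using sum_smooth_inverse_le[OF Q, of N] by simp
  have prod: "(\<Prod>p\<in>Q. 1 - 1 / real p) > 0" using pos by (intro prod_pos) auto
  have lnN: "ln (real N) > 0" using assms by simp
  have "ln (real N) \<le> ln (real N + 1)" using assms by simp
  also have "\<dots> \<le> harm N" by (rule ln_le_harm)
  also have "\<dots> \<le> 1 / (\<Prod>p\<in>Q. 1 - 1 / real p)"
    using * prod by (simp add: field_simps)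
  finally have "ln (ln (real N)) \<le> ln (1 / (\<Prod>p\<in>Q. 1 - 1 / real p))"
    using lnN prod by (subst ln_le_cancel_iff) auto
  also have "\<dots> = - ln (\<Prod>p\<in>Q. 1 - 1 / real p)" using prod by (simp add: ln_div)
  also have "\<dots> = (\<Sum>p\<in>Q. euler_log 1 p)"
  proof -
    have "ln (\<Prod>p\<in>Q. 1 - 1 / real p) = (\<Sum>p\<in>Q. ln (1 - 1 / real p))"
      by (intro ln_prod Q(1) less_imp_neq[OF pos, symmetric])
    moreover have "euler_log 1 p = - ln (1 - 1 / real p)" for p
      by (simp add: euler_log_def powr_minus_divide)
    ultimately show ?thesis by (simp add: sum_negf)
  qed
  also have "\<dots> = (\<Sum>n\<in>{1..N}. prime_weight n)"
    unfolding prime_weight_def Q_def by (rule sum.mono_neutral_cong_left) auto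
  finally show ?thesis .
qed

text \<open>Beyond y every weight is at most 2 / y. Once the weight of the primes in (y, N] exceeds
  h times the spread at y, the spread at N has fallen to 2 / y. With y a power of ln N of exponent
  above 1, this is o(1 / ln N), the rate needed in \<open>theta_balanced_bound\<close>.\<close>

theorem prime_colouring_exists:
  assumes h: "h > 0"
  obtains c :: "nat \<Rightarrow> nat" where "\<And>n. c n < h"
    "\<And>i. i < h \<Longrightarrow> (\<lambda>N. ln (real N) * (\<Sum>n\<in>{1..N}. (of_bool (c n = i) - 1 / real h) * prime_weight n)) \<longlonglongrightarrow> 0"
proof -
  obtain c where c: "\<And>n. c n < h" and greedy: "\<forall>n. \<forall>j<h.
      (\<Sum>m\<in>{1..n}. if c m = c (Suc n) then prime_weight m else 0) \<le> (\<Sum>m\<in>{1..n}. if c m = j then prime_weight m else 0)"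
    by (rule greedy_colouring_exists[OF h, of prime_weight]) blast
  define load where "load = (\<lambda>n i. \<Sum>m\<in>{1..n}. if c m = i then prime_weight m else 0)"
  have load: "(\<Sum>m\<in>{1..n}. if c m = i then prime_weight m else 0) = load n i" for n i
    by (simp add: load_def)
  note spread_mono = greedy_spread_mono[OF h prime_weight_nonneg c greedy, unfolded load]
  note spread_le = greedy_spread_le[OF h prime_weight_nonneg c greedy, unfolded load]
  have pw1: "prime_weight n \<le> 1" for n
  proof (cases "n \<ge> 2")
    case True
    thus ?thesis using prime_weight_le[of n] by (auto intro!: order_trans[OF prime_weight_le])
  next
    case False
    hence "\<not> prime n" using prime_ge_2_nat by blast
    thus ?thesis by (simp add: prime_weight_def)
  qed
  have spread1: "\<forall>i<h. \<forall>j<h. load n i - load n j \<le> 1" for n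
    by (rule spread_mono[of 0]) (use pw1 in \<open>auto simp: load_def\<close>)
  \<comment> \<open>The primes up to \<open>y\<close> weigh at most \<open>ln y / 2 + 7\<close> because they are odd, while those up to \<open>N\<close>
    weigh at least \<open>ln (ln N)\<close>, about \<open>9/10 * ln y\<close>; any exponent strictly between 1 and 2 would do.\<close>
  define y where "y = (\<lambda>N. nat \<lfloor>ln (real N) powr (10/9)\<rfloor>)"
  have ev: "eventually (\<lambda>N. \<forall>i<h. \<forall>j<h. load N i - load N j \<le> 2 / ln (real N) powr (10/9)) sequentially"
  proof -
    \<comment> \<open>4/9 is 1 - 1/2 * 10/9: the lower bound up to N minus the upper bound up to y.
      The initial spread is 1, so the excess has to exceed h.\<close>
    have "eventually (\<lambda>N::nat. 4/9 * ln (ln (real N)) > 7 + real h) sequentially" by real_asymp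
    moreover have "eventually (\<lambda>N::nat. ln (real N) powr (10/9) \<le> real N) sequentially" by real_asymp
    moreover have "eventually (\<lambda>N::nat. ln (real N) powr (10/9) \<ge> 2) sequentially" by real_asymp
    moreover have "eventually (\<lambda>N::nat. N \<ge> 3) sequentially" by (rule eventually_ge_at_top)
    ultimately show ?thesis
    proof eventually_elim
      case (elim N)
      define z where "z = ln (real N) powr (10/9)"
      have z: "z \<ge> 2" "z \<le> real N" using elim by (auto simp: z_def)
      have yN: "y N \<le> N" "y N \<ge> 1" "real (y N) \<le> z" "z \<le> real (y N) + 1"
        using z unfolding y_def z_def[symmetric] by linarith+
      have lnN: "ln (real N) > 0" using elim by simp
      have "{1..N} = {1..y N} \<union> {y N<..N}" using yN by auto
      hence "(\<Sum>k\<in>{1..N}. prime_weight k) = (\<Sum>k\<in>{1..y N}. prime_weight k) + (\<Sum>k\<in>{y N<..N}. prime_weight k)"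
        by (simp only:) (subst sum.union_disjoint, auto)
      moreover have "(\<Sum>k\<in>{1..N}. prime_weight k) \<ge> ln (ln (real N))"
        by (rule sum_prime_weight_lower) (use elim in auto)
      moreover have "(\<Sum>k\<in>{1..y N}. prime_weight k) \<le> 7 + ln (real (y N)) / 2"
        by (rule sum_prime_weight_upper) (use yN in auto)
      moreover have "ln (real (y N)) \<le> ln z"
        using yN by (subst ln_le_cancel_iff) auto
      moreover have "ln z = 10/9 * ln (ln (real N))" using lnN by (simp add: z_def ln_powr)
      ultimately have sum: "(\<Sum>k\<in>{y N<..N}. prime_weight k) > real h * 1" using elim by linarith
      have "\<forall>i<h. \<forall>j<h. load N i - load N j \<le> 2 / z"
      proof (rule spread_le[OF yN(1) _ _ spread1 sum])
        fix k assume k: "y N < k"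
        have "prime_weight k \<le> 2 / real k" by (rule prime_weight_le)
        also have "\<dots> \<le> 2 / z" using k yN z by (intro divide_left_mono) auto
        finally show "prime_weight k \<le> 2 / z" .
      qed (use z in auto)
      thus ?case by (simp add: z_def)
    qed
  qed
  have "(\<lambda>N. ln (real N) * (\<Sum>n\<in>{1..N}. (of_bool (c n = i) - 1 / real h) * prime_weight n)) \<longlonglongrightarrow> 0"
    if i: "i < h" for i
  proof -
    have ln_top: "filterlim (\<lambda>N. ln (real N)) at_top sequentially"
      by (rule filterlim_compose[OF ln_at_top filterlim_real_sequentially])
    have lim: "(\<lambda>N. 2 * ln (real N) powr (-(1/9))) \<longlonglongrightarrow> 0"
      by (rule tendsto_mult_right_zero[OF tendsto_neg_powr[OF _ ln_top]]) simp
    have ev': "eventually (\<lambda>N. norm (ln (real N) * (\<Sum>n\<in>{1..N}. (of_bool (c n = i) - 1 / real h) * prime_weight n))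
            \<le> 2 * ln (real N) powr (-(1/9))) sequentially"
      using ev eventually_ge_at_top[of 2]
    proof eventually_elim
      case (elim N)
      define b where "b = 2 / ln (real N) powr (10/9)"
      have tot: "(\<Sum>j<h. load N j) = (\<Sum>n\<in>{1..N}. prime_weight n)"
      proof -
        have "(\<Sum>j<h. load N j) = (\<Sum>n\<in>{1..N}. \<Sum>j<h. if c n = j then prime_weight n else 0)"
          unfolding load_def by (rule sum.swap)
        thus ?thesis using c by simp
      qed
      have "(\<Sum>n\<in>{1..N}. (of_bool (c n = i) - 1 / real h) * prime_weight n) =
            (\<Sum>n\<in>{1..N}. (if c n = i then prime_weight n else 0) - prime_weight n / real h)"
        by (intro sum.cong) (auto simp: left_diff_distrib)
      also have "\<dots> = load N i - (\<Sum>j<h. load N j) / real h"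
        unfolding tot by (simp add: load_def sum_subtractf sum_divide_distrib)
      \<comment> \<open>The deviation of a load from the mean is the average of its differences to
        all loads, each bounded by the spread.\<close>
      also have "\<dots> = (\<Sum>j<h. load N i - load N j) / real h"
        using h by (simp add: sum_subtractf field_simps)
      finally have *: "(\<Sum>n\<in>{1..N}. (of_bool (c n = i) - 1 / real h) * prime_weight n) =
          (\<Sum>j<h. load N i - load N j) / real h" .
      have "\<bar>\<Sum>j<h. load N i - load N j\<bar> \<le> (\<Sum>j<h. b)"
      proof (rule order_trans[OF sum_abs sum_mono])
        fix j assume "j \<in> {..<h}"
        thus "\<bar>load N i - load N j\<bar> \<le> b" using elim i by (auto simp: b_def abs_le_iff)
      qed
      hence "\<bar>(\<Sum>j<h. load N i - load N j) / real h\<bar> \<le> b" using h by (simp add: field_simps)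
      hence "ln (real N) * \<bar>(\<Sum>j<h. load N i - load N j) / real h\<bar> \<le> ln (real N) * b"
        using elim by (intro mult_left_mono) auto
      also have "ln (real N) * b = 2 * (ln (real N) powr 1 / ln (real N) powr (10/9))"
        using elim by (simp add: b_def)
      also have "ln (real N) powr 1 / ln (real N) powr (10/9) = ln (real N) powr (-(1/9))"
        by (subst powr_diff[symmetric]) simp
      finally show ?case unfolding * using elim by (simp add: abs_mult)
    qed
    show ?thesis by (rule Lim_null_comparison[OF ev' lim])
  qed
  from that[OF c this] show ?thesis .
qed

section \<open>Equidistributed prime classes\<close>

lemma sum_mult_by_parts:
  fixes a w :: "nat \<Rightarrow> real"
  assumes "N \<le> M"
  shows "(\<Sum>n\<in>{N..<M}. a n * w n) =
    (\<Sum>k\<in>{N..<M}. a k) * w M + (\<Sum>n\<in>{N..<M}. (\<Sum>k\<in>{N..<Suc n}. a k) * (w n - w (Suc n)))"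
  using assms
proof (induction M rule: dec_induct)
  case (step M)
  have "(\<Sum>k\<in>{N..<Suc M}. a k) = (\<Sum>k\<in>{N..<M}. a k) + a M" using step by simp
  thus ?case using step by (simp add: algebra_simps)
qed auto

lemma sum_mult_decreasing_le:
  fixes a w :: "nat \<Rightarrow> real"
  assumes "N \<le> M" and a: "\<And>m. N \<le> m \<Longrightarrow> m \<le> M \<Longrightarrow> \<bar>\<Sum>k\<in>{N..<m}. a k\<bar> \<le> e"
    and w: "\<And>n. N \<le> n \<Longrightarrow> w (Suc n) \<le> w n" "\<And>n. N \<le> n \<Longrightarrow> w n \<ge> 0"
  shows "\<bar>\<Sum>n\<in>{N..<M}. a n * w n\<bar> \<le> e * w N"
proof -
  have tele: "(\<Sum>n\<in>{N..<M}. e * (w n - w (Suc n))) = e * (w N - w M)"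
    using assms(1) by (simp flip: sum_distrib_left add: sum_Suc_diff'[of N M "\<lambda>n. - w n", simplified])
  have "\<bar>\<Sum>n\<in>{N..<M}. (\<Sum>k\<in>{N..<Suc n}. a k) * (w n - w (Suc n))\<bar> \<le> (\<Sum>n\<in>{N..<M}. e * (w n - w (Suc n)))"
  proof (rule order_trans[OF sum_abs sum_mono])
    fix n assume n: "n \<in> {N..<M}"
    have "\<bar>\<Sum>k\<in>{N..<Suc n}. a k\<bar> * (w n - w (Suc n)) \<le> e * (w n - w (Suc n))"
      using n w(1)[of n] by (intro mult_right_mono a) auto
    thus "\<bar>(\<Sum>k\<in>{N..<Suc n}. a k) * (w n - w (Suc n))\<bar> \<le> e * (w n - w (Suc n))"
      using n w(1)[of n] by (simp add: abs_mult)
  qed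
  moreover have "\<bar>(\<Sum>k\<in>{N..<M}. a k) * w M\<bar> \<le> e * w M"
    using a[of M] w(2)[of M] assms(1) by (simp add: abs_mult mult_right_mono)
  moreover have "e * (w N - w M) = e * w N - e * w M" by (simp add: algebra_simps)
  ultimately show ?thesis using tele sum_mult_by_parts[OF assms(1), of a w] by linarith
qed

text \<open>Partial summation in two ranges: the crude bound M on the partial sums is used only
  against weights up to w m, the small bound e from m on. It counts twice because the boundary term
  and the telescoped increments each contribute \<open>e * w (Suc N)\<close>.\<close>

lemma sum_mult_increasing_le:
  fixes a w :: "nat \<Rightarrow> real"
  assumes "1 \<le> m" "m \<le> N" and M: "\<And>n. \<bar>\<Sum>k\<in>{1..n}. a k\<bar> \<le> M"
    and e: "\<And>n. m \<le> n \<Longrightarrow> \<bar>\<Sum>k\<in>{1..n}. a k\<bar> \<le> e"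
    and w: "\<And>n. 1 \<le> n \<Longrightarrow> w n \<le> w (Suc n)" "w 1 \<ge> 0"
  shows "\<bar>\<Sum>n\<in>{1..N}. a n * w n\<bar> \<le> M * w m + 2 * e * w (Suc N)"
proof -
  define D where "D = (\<lambda>n. \<Sum>k\<in>{1..n}. a k)"
  have M0: "M \<ge> 0" using M[of 0] by simp
  have e0: "e \<ge> 0" using e[of m] by linarith
  have atl: "{1..<Suc n} = {1..n}" for n by auto
  have w0: "w n \<ge> 0" if "n \<ge> 1" for n
    using that by (induction n rule: dec_induct) (use w in \<open>auto intro: order_trans\<close>)
  have parts: "(\<Sum>n\<in>{1..N}. a n * w n) = D N * w (Suc N) + (\<Sum>n\<in>{1..N}. D n * (w n - w (Suc n)))"
    using sum_mult_by_parts[of 1 "Suc N" a w] unfolding atl D_def by simp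
  have bd: "\<bar>D n * (w n - w (Suc n))\<bar> \<le> (if n < m then M * (w (Suc n) - w n) else e * (w (Suc n) - w n))"
    if "n \<ge> 1" for n
  proof -
    have "\<bar>D n * (w n - w (Suc n))\<bar> = \<bar>D n\<bar> * (w (Suc n) - w n)"
      using w(1)[OF that] by (simp add: abs_mult)
    thus ?thesis
      using M[of n] e[of n] w(1)[OF that] by (auto simp: D_def intro!: mult_right_mono)
  qed
  have "\<bar>\<Sum>n\<in>{1..N}. D n * (w n - w (Suc n))\<bar> \<le>
        (\<Sum>n\<in>{1..N}. if n < m then M * (w (Suc n) - w n) else e * (w (Suc n) - w n))"
    by (rule order_trans[OF sum_abs sum_mono]) (use bd in auto)
  also have split: "{1..N} = {1..<m} \<union> {m..<Suc N}" using assms by auto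
  also have "(\<Sum>n\<in>{1..<m} \<union> {m..<Suc N}. if n < m then M * (w (Suc n) - w n) else e * (w (Suc n) - w n))
       = (\<Sum>n\<in>{1..<m}. M * (w (Suc n) - w n)) + (\<Sum>n\<in>{m..<Suc N}. e * (w (Suc n) - w n))"
    by (subst sum.union_disjoint) auto
  also have "\<dots> = M * (w m - w 1) + e * (w (Suc N) - w m)"
    using assms(1,2) by (simp flip: sum_distrib_left add: sum_Suc_diff')
  also have "\<dots> \<le> M * w m + e * w (Suc N)"
    using M0 e0 w(2) w0[of m] assms(1) by (intro add_mono mult_left_mono) auto
  finally have "\<bar>\<Sum>n\<in>{1..N}. D n * (w n - w (Suc n))\<bar> \<le> M * w m + e * w (Suc N)"
    unfolding split .
  moreover have "\<bar>D N * w (Suc N)\<bar> \<le> e * w (Suc N)"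
    using e[of N] w0[of "Suc N"] assms by (simp add: D_def abs_mult mult_right_mono)
  ultimately show ?thesis unfolding parts by linarith
qed

section \<open>The zeta function near its pole\<close>

lemma powr_telescope_bounds:
  assumes "s > 0" "n > 0"
  shows "(real n powr - s - real (Suc n) powr - s) / s \<in> {real (Suc n) powr - (1 + s)..real n powr - (1 + s)}"
proof -
  have "\<exists>z. real n < z \<and> z < real (Suc n) \<and>
     (real (Suc n) powr - s - real n powr - s) = (real (Suc n) - real n) * (- s * z powr (- s - 1))"
    by (rule MVT2) (use assms in \<open>auto intro!: derivative_eq_intros\<close>)
  then obtain z where z: "real n < z" "z < real (Suc n)"
    "(real (Suc n) powr - s - real n powr - s) = (real (Suc n) - real n) * (- s * z powr (- s - 1))" by blast
  have "(real n powr - s - real (Suc n) powr - s) / s = z powr - (1 + s)"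
  proof -
    have "real n powr - s - real (Suc n) powr - s = s * z powr (- s - 1)"
      using z(3) by (simp add: algebra_simps)
    moreover have "- (1 + s) = - s - 1" by simp
    ultimately show ?thesis using assms by (simp only:) simp
  qed
  moreover have "z powr - (1 + s) \<le> real n powr - (1 + s)" "z powr - (1 + s) \<ge> real (Suc n) powr - (1 + s)"
    using z assms by (auto intro!: powr_mono2')
  ultimately show ?thesis by simp
qed

text \<open>Comparison with the telescoping sum of the differences of n powr - s / s, whose value is
  1 / s; shifting the index by one turns the lower comparison into the upper one.\<close>

lemma gen_series_UNIV_bounds:
  assumes s: "s > 0"
  shows "gen_series UNIV (1 + s) \<in> {1 / s..1 + 1 / s}"
proof -
  define f where "f = (\<lambda>n::nat. real (Suc n) powr - s / s)"
  have "filterlim (\<lambda>n. real (Suc n)) at_top sequentially"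
    by (rule filterlim_compose[OF filterlim_real_sequentially filterlim_Suc])
  hence "f \<longlonglongrightarrow> 0" unfolding f_def
    by (intro tendsto_divide_zero tendsto_neg_powr) (use s in auto)
  from telescope_sums'[OF this] have tele: "(\<lambda>n. f n - f (Suc n)) sums (1 / s)"
    by (simp add: f_def)
  have *: "((\<lambda>n. real (Suc n) powr - (1 + s)) has_sum gen_series UNIV (1 + s)) UNIV"
  proof -
    have "((\<lambda>n. real n powr - (1 + s)) has_sum gen_series UNIV (1 + s)) {0<..}"
      unfolding gen_series_def gen_UNIV using powr_summable_on[of "1 + s" "{0<..}"] s by simp
    moreover have "{0<..} = range Suc" by (auto simp: image_iff gr0_conv_Suc)
    ultimately show ?thesis by (simp add: has_sum_reindex o_def)
  qed
  hence S: "(\<lambda>n. real (Suc n) powr - (1 + s)) sums gen_series UNIV (1 + s)"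
    by (rule has_sum_imp_sums)
  have bd: "f n - f (Suc n) \<in> {real (Suc (Suc n)) powr - (1 + s)..real (Suc n) powr - (1 + s)}" for n
    using powr_telescope_bounds[OF s, of "Suc n"] by (simp add: f_def diff_divide_distrib)
  have "1 / s \<le> gen_series UNIV (1 + s)"
    by (rule sums_le[OF _ tele S]) (use bd in auto)
  moreover have "(\<lambda>n. real (Suc (Suc n)) powr - (1 + s)) sums (gen_series UNIV (1 + s) - 1)"
    using sums_split_initial_segment[OF S, of 1] by simp
  from sums_le[OF _ this tele] have "gen_series UNIV (1 + s) - 1 \<le> 1 / s" using bd by auto
  ultimately show ?thesis by simp
qed

lemma gen_series_UNIV_asymp: "((\<lambda>s. s * gen_series UNIV (1 + s)) \<longlongrightarrow> 1) (at_right 0)"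
proof (rule tendsto_sandwich)
  have pos: "eventually (\<lambda>s::real. s > 0) (at_right 0)" by (rule eventually_at_right_less)
  show "eventually (\<lambda>s. 1 \<le> s * gen_series UNIV (1 + s)) (at_right 0)"
    using pos
  proof eventually_elim
    case (elim s)
    have "s * (1 / s) \<le> s * gen_series UNIV (1 + s)"
      using gen_series_UNIV_bounds[of s] elim by (intro mult_left_mono) auto
    thus ?case using elim by simp
  qed
  show "eventually (\<lambda>s. s * gen_series UNIV (1 + s) \<le> 1 + s) (at_right 0)"
    using pos
  proof eventually_elim
    case (elim s)
    have "s * gen_series UNIV (1 + s) \<le> s * (1 + 1 / s)"
      using gen_series_UNIV_bounds[of s] elim by (intro mult_left_mono) auto
    thus ?case using elim by (simp add: algebra_simps)
  qed
  show "((\<lambda>s::real. 1 + s) \<longlongrightarrow> 1) (at_right 0)" by (auto intro!: tendsto_eq_intros)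
qed auto

text \<open>A proper prime power p^k \<le> N has p \<le> sqrt N and, as ln 2 \<ge> 1/2, k \<le> 2 ln
  N. Counting the pairs (p, k) and bounding each term by ln N is enough.\<close>

lemma sum_mangoldt_nonprime_le:
  assumes "N \<ge> 1"
  shows "(\<Sum>n\<in>{1..N}. if prime n then 0 else mangoldt n) \<le> 2 * sqrt (real N) * ln (real N) ^ 2"
proof -
  define Q where "Q = {n\<in>{1..N}. primepow n \<and> \<not> prime n}"
  define K where "K = {1..nat \<lfloor>sqrt (real N)\<rfloor>} \<times> {1..nat \<lfloor>2 * ln (real N)\<rfloor>}"
  have lnN: "ln (real N) \<ge> 0" using assms by simp
  have "Q \<subseteq> (\<lambda>(m,k). m ^ k) ` K"
  proof
    fix n assume n: "n \<in> Q"
    then obtain p k where pk: "prime p" "k > 0" "n = p ^ k"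
      by (auto simp: Q_def primepow_def)
    have "k \<noteq> 1" using n pk by (auto simp: Q_def)
    hence k2: "k \<ge> 2" using pk by simp
    have p2: "p \<ge> 2" using pk prime_ge_2_nat by blast
    have nN: "n \<le> N" using n by (simp add: Q_def)
    have "p ^ 2 \<le> p ^ k" using k2 p2 by (intro power_increasing) auto
    hence "real (p ^ 2) \<le> real N" using pk nN by linarith
    hence "real p ^ 2 \<le> real N" by simp
    hence "real p \<le> sqrt (real N)" by (rule real_le_rsqrt)
    moreover have "real k \<le> 2 * ln (real N)"
    proof -
      have "real k * (1 / 2) \<le> real k * ln 2"
        using ln2_ge_two_thirds by (intro mult_left_mono) auto
      also have "\<dots> \<le> real k * ln (real p)" using p2 by (intro mult_left_mono) auto
      also have "\<dots> = ln (real n)" using pk p2 by (simp add: ln_realpow)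
      also have "\<dots> \<le> ln (real N)" using nN n by (subst ln_le_cancel_iff) (auto simp: Q_def)
      finally show ?thesis by simp
    qed
    ultimately have "(p, k) \<in> K" using p2 k2 by (auto simp: K_def le_nat_iff le_floor_iff)
    thus "n \<in> (\<lambda>(m,k). m ^ k) ` K" using pk by (auto intro!: image_eqI[of _ _ "(p, k)"])
  qed
  hence "card Q \<le> card ((\<lambda>(m,k). m ^ k) ` K)" by (intro card_mono) (auto simp: K_def)
  also have "\<dots> \<le> card K" by (rule card_image_le) (simp add: K_def)
  also have "\<dots> = nat \<lfloor>sqrt (real N)\<rfloor> * nat \<lfloor>2 * ln (real N)\<rfloor>" by (simp add: K_def)
  finally have "real (card Q) \<le> real (nat \<lfloor>sqrt (real N)\<rfloor> * nat \<lfloor>2 * ln (real N)\<rfloor>)" by (simp only: of_nat_le_iff)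
  also have "\<dots> \<le> sqrt (real N) * (2 * ln (real N))"
    unfolding of_nat_mult using lnN by (intro mult_mono) auto
  finally have card: "real (card Q) \<le> sqrt (real N) * (2 * ln (real N))" .
  have "(\<Sum>n\<in>{1..N}. if prime n then 0 else mangoldt n) = (\<Sum>n\<in>Q. mangoldt n)"
    by (rule sum.mono_neutral_cong_right) (auto simp: Q_def mangoldt_def)
  also have "\<dots> \<le> (\<Sum>n\<in>Q. ln (real N))"
  proof (rule sum_mono)
    fix n assume n: "n \<in> Q"
    hence "mangoldt n \<le> ln (real n)" by (intro mangoldt_le) (auto simp: Q_def)
    also have "\<dots> \<le> ln (real N)" using n by (subst ln_le_cancel_iff) (auto simp: Q_def)
    finally show "mangoldt n \<le> ln (real N)" .
  qed
  also have "\<dots> \<le> sqrt (real N) * (2 * ln (real N)) * ln (real N)"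
    using card lnN by (simp add: mult_right_mono)
  finally show ?thesis by (simp add: power2_eq_square mult_ac)
qed

text \<open>One colour class in isolation, with \<kappa> = 1/h; \<open>balanced\<close> is what
  \<open>prime_colouring_exists\<close> delivers for it.\<close>

locale balanced_primes =
  fixes P :: "nat set" and \<kappa> :: real
  assumes \<kappa>: "0 < \<kappa>" "\<kappa> < 1"
    and balanced: "(\<lambda>N. ln (real N) * (\<Sum>n\<in>{1..N}. (of_bool (n \<in> P) - \<kappa>) * prime_weight n)) \<longlonglongrightarrow> 0"
begin

definition discrepancy :: "nat \<Rightarrow> real" where
  "discrepancy N = (\<Sum>n\<in>{1..N}. (of_bool (n \<in> P) - \<kappa>) * prime_weight n)"

lemma abs_indicator_le: "\<bar>of_bool b - \<kappa>\<bar> \<le> 1"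
  using \<kappa> by (cases b) auto

lemma discrepancy_ln_small: "e > 0 \<Longrightarrow> eventually (\<lambda>N. \<bar>discrepancy N\<bar> * ln (real N) \<le> e) sequentially"
proof -
  assume "e > 0"
  hence "eventually (\<lambda>N. dist (ln (real N) * discrepancy N) 0 < e) sequentially"
    using balanced by (intro tendstoD) (auto simp: discrepancy_def)
  thus ?thesis using eventually_ge_at_top[of 1]
    by eventually_elim (auto simp: abs_mult mult.commute)
qed

lemma discrepancy_tendsto_0: "discrepancy \<longlonglongrightarrow> 0"
proof (rule Lim_null_comparison)
  show "eventually (\<lambda>N. norm (discrepancy N) \<le> norm (ln (real N) * discrepancy N)) sequentially"
    using eventually_ge_at_top[of 3]
  proof eventually_elim
    case (elim N)
    have "exp 1 \<le> real N" using exp_le elim by (intro order_trans[OF exp_le]) auto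
    hence "1 \<le> ln (real N)" using elim by (subst ln_ge_iff) auto
    hence "1 * \<bar>discrepancy N\<bar> \<le> ln (real N) * \<bar>discrepancy N\<bar>" by (intro mult_right_mono) auto
    thus ?case using \<open>1 \<le> ln (real N)\<close> by (simp add: abs_mult)
  qed
  show "(\<lambda>N. norm (ln (real N) * discrepancy N)) \<longlonglongrightarrow> 0"
    using balanced unfolding discrepancy_def by (rule tendsto_norm_zero)
qed

lemma discrepancy_bounded: obtains M where "M \<ge> 0" "\<And>N. \<bar>discrepancy N\<bar> \<le> M"
proof -
  have "Bseq discrepancy" using discrepancy_tendsto_0 by (intro convergent_imp_Bseq convergentI)
  then obtain M where "\<And>n. norm (discrepancy n) \<le> M" using Bseq_def by metis
  thus ?thesis using that[of M] norm_ge_zero[of "discrepancy 0"] by (metis order_trans real_norm_def)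
qed

text \<open>The class and the proportion \<kappa> of all primes have the same sum of ln p up to
  o(N), although the size of either sum is known only up to constants. Partial summation from the
  balanced weights uses up the full rate o(1 / ln N).\<close>

lemma theta_balanced_bound:
  assumes "e > 0"
  shows "eventually (\<lambda>N. \<bar>\<Sum>n\<in>{1..N}. (of_bool (n \<in> P) - \<kappa>) * (if prime n then ln (real n) else 0)\<bar> \<le> e * real N) sequentially"
proof -
  obtain M where M: "M \<ge> 0" "\<And>N. \<bar>discrepancy N\<bar> \<le> M" using discrepancy_bounded by blast
  \<comment> \<open>The range beyond m contributes 2 * (2 d / ln N) * (2 N ln N) = 8 d N, which
    becomes e N / 2.\<close>
  define d where "d = e / 16"
  have d: "d > 0" using assms by (simp add: d_def)
  obtain N0 where N0: "\<And>n. n \<ge> N0 \<Longrightarrow> \<bar>discrepancy n\<bar> * ln (real n) \<le> d"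
    using discrepancy_ln_small[OF d] unfolding eventually_sequentially by blast
  \<comment> \<open>Beyond sqrt N logarithms are at least ln N / 2, so the discrepancy is at most 2
    d / ln N there; before it, a bounded discrepancy meets weights of order only sqrt N ln
    N.\<close>
  define m where "m = (\<lambda>N. nat \<lceil>sqrt (real N)\<rceil>)"
  \<comment> \<open>The factor that turns the balanced weight of a prime into its logarithm; it is
    increasing and at most n ln n.\<close>
  define w where "w = (\<lambda>n. ln (real n) / euler_log 1 n)"
  have el: "euler_log 1 n \<ge> 1 / real n" if "n \<ge> 2" for n
    using ln_one_minus_pos_upper_bound[of "1 / real n"] that
    by (simp add: euler_log_def powr_minus_divide)
  have el_anti: "euler_log 1 (Suc n) \<le> euler_log 1 n" if "n \<ge> 2" for n
  proof -
    have "1 - 1 / real n > 0" "1 - 1 / real n \<le> 1 - 1 / real (Suc n)"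
      using that by (simp_all add: divide_left_mono)
    hence "ln (1 - 1 / real n) \<le> ln (1 - 1 / real (Suc n))"
      by (subst ln_le_cancel_iff) linarith+
    thus ?thesis by (simp add: euler_log_def powr_minus_divide del: of_nat_Suc)
  qed
  have w1: "w 1 = 0" by (simp add: w_def)
  have w_le: "w n \<le> real n * ln (real n)" if "n \<ge> 1" for n
  proof (cases "n = 1")
    case False
    hence n: "n \<ge> 2" using that by simp
    have "w n \<le> ln (real n) / (1 / real n)"
      unfolding w_def
    proof (rule divide_left_mono)
      have "1 / real n > 0" using n by simp
      hence "euler_log 1 n > 0" using el[OF n] by linarith
      thus "0 < euler_log 1 n * (1 / real n)" using n by (intro mult_pos_pos) auto
    qed (use el[OF n] n in auto)
    thus ?thesis by (simp add: mult.commute)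
  qed (use w1 in simp)
  have w_mono: "w n \<le> w (Suc n)" if "n \<ge> 1" for n
  proof (cases "n = 1")
    case True
    have "0 \<le> ln (real (Suc n)) / euler_log 1 (Suc n)"
      using el[of "Suc n"] that by (intro divide_nonneg_nonneg) (auto intro: order_trans[of 0 "1 / real (Suc n)"] simp del: of_nat_Suc)
    thus ?thesis using True by (simp add: w_def)
  next
    case False
    hence n: "n \<ge> 2" using that by simp
    have "1 / real (Suc n) > 0" by simp
    hence "euler_log 1 (Suc n) > 0" using el[of "Suc n"] n by linarith
    thus ?thesis unfolding w_def using el_anti[OF n] n by (intro frac_le) auto
  qed
  have "eventually (\<lambda>N::nat. M * ((sqrt (real N) + 1) * ln (sqrt (real N) + 1)) \<le> e / 2 * real N) sequentially"
    using assms by real_asymp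
  moreover have "eventually (\<lambda>N::nat. (real N + 1) * ln (real N + 1) \<le> 2 * real N * ln (real N)) sequentially"
    by real_asymp
  moreover have "eventually (\<lambda>N::nat. sqrt (real N) \<ge> real N0 + 2) sequentially" by real_asymp
  moreover have "eventually (\<lambda>N::nat. sqrt (real N) \<le> real N - 1) sequentially" by real_asymp
  ultimately show ?thesis
  proof eventually_elim
    case (elim N)
    have m: "real (m N) \<ge> sqrt (real N)" "real (m N) \<le> sqrt (real N) + 1" "m N \<ge> N0" "m N \<ge> 2" "m N \<le> N"
      using elim unfolding m_def by linarith+
    have N: "real N \<ge> 2" using m by linarith
    have lnm: "ln (real (m N)) \<ge> ln (real N) / 2"
    proof -
      have "ln (sqrt (real N)) \<le> ln (real (m N))" using m N by (subst ln_le_cancel_iff) auto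
      thus ?thesis using N by (simp add: ln_sqrt)
    qed
    have lnN: "ln (real N) > 0" using N by simp
    have D_le: "\<bar>discrepancy n\<bar> \<le> 2 * d / ln (real N)" if "m N \<le> n" for n
    proof -
      have "ln (real (m N)) \<le> ln (real n)" using that m by (subst ln_le_cancel_iff) auto
      hence "ln (real N) / 2 \<le> ln (real n)" using lnm by linarith
      hence "\<bar>discrepancy n\<bar> * (ln (real N) / 2) \<le> \<bar>discrepancy n\<bar> * ln (real n)" by (intro mult_left_mono) auto
      also have "\<dots> \<le> d" using N0 m that by auto
      finally show ?thesis using lnN by (simp add: field_simps)
    qed
    have "\<bar>\<Sum>n\<in>{1..N}. ((of_bool (n \<in> P) - \<kappa>) * prime_weight n) * w n\<bar> \<le>
          M * w (m N) + 2 * (2 * d / ln (real N)) * w (Suc N)"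
    proof (rule sum_mult_increasing_le)
      show "\<bar>\<Sum>k\<in>{1..n}. (of_bool (k \<in> P) - \<kappa>) * prime_weight k\<bar> \<le> M" for n
        using M(2)[of n] by (simp add: discrepancy_def)
      show "\<bar>\<Sum>k\<in>{1..n}. (of_bool (k \<in> P) - \<kappa>) * prime_weight k\<bar> \<le> 2 * d / ln (real N)" if "m N \<le> n" for n
        using D_le[OF that] by (simp add: discrepancy_def)
    qed (use m w1 w_mono in auto)
    also have "(\<Sum>n\<in>{1..N}. ((of_bool (n \<in> P) - \<kappa>) * prime_weight n) * w n) =
         (\<Sum>n\<in>{1..N}. (of_bool (n \<in> P) - \<kappa>) * (if prime n then ln (real n) else 0))"
    proof (intro sum.cong refl)
      fix n
      show "((of_bool (n \<in> P) - \<kappa>) * prime_weight n) * w n = (of_bool (n \<in> P) - \<kappa>) * (if prime n then ln (real n) else 0)"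
      proof (cases "prime n")
        case True
        hence "n \<ge> 2" by (rule prime_ge_2_nat)
        hence "euler_log 1 n \<noteq> 0" using el[of n] by auto
        thus ?thesis using True by (simp add: prime_weight_def w_def)
      qed (simp add: prime_weight_def)
    qed
    also have "M * w (m N) \<le> M * ((sqrt (real N) + 1) * ln (sqrt (real N) + 1))"
    proof -
      have "w (m N) \<le> real (m N) * ln (real (m N))" using m by (intro w_le) auto
      also have "\<dots> \<le> (sqrt (real N) + 1) * ln (sqrt (real N) + 1)"
        using m by (intro mult_mono) auto
      finally show ?thesis using M(1) by (intro mult_left_mono)
    qed
    also have "\<dots> \<le> e / 2 * real N" using elim by simp
    also have "2 * (2 * d / ln (real N)) * w (Suc N) \<le> 2 * (2 * d / ln (real N)) * (2 * real N * ln (real N))"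
    proof -
      have "w (Suc N) \<le> real (Suc N) * ln (real (Suc N))" by (intro w_le) auto
      also have "\<dots> \<le> 2 * real N * ln (real N)" using elim by (simp add: add.commute)
      finally show ?thesis using d lnN by (intro mult_left_mono) auto
    qed
    also have "\<dots> = e / 2 * real N" using lnN by (simp add: d_def field_simps)
    finally show ?case by simp
  qed
qed

definition psi_P :: "real \<Rightarrow> real" where
  "psi_P x = (\<Sum>n\<in>nats_upto x. of_bool (n \<in> gen P) * mangoldt n)"

text \<open>Proper prime powers contribute O(sqrt N ln^2 N), so \<open>theta_balanced_bound\<close>
  carries over. The additive constant makes the estimate valid for all x \<ge> 0, as required when
  it is summed over arguments y / n.\<close>

theorem psi_P_asymp:
  assumes "e > 0"
  obtains C where "C \<ge> 0" "\<And>x. x \<ge> 0 \<Longrightarrow> \<bar>psi_P x - \<kappa> * psi x\<bar> \<le> e * x + C"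
proof -
  have prime_gen: "n \<in> gen P \<longleftrightarrow> n \<in> P" if "prime n" for n
    using that prime_gt_0_nat[OF that] by (auto simp: gen_def prime_factorization_prime)
  have "eventually (\<lambda>N::nat. 2 * sqrt (real N) * ln (real N) ^ 2 \<le> e / 2 * real N) sequentially"
    using assms by real_asymp
  moreover have "eventually (\<lambda>N. \<bar>\<Sum>n\<in>{1..N}. (of_bool (n \<in> P) - \<kappa>) * (if prime n then ln (real n) else 0)\<bar>
      \<le> e / 2 * real N) sequentially"
    by (rule theta_balanced_bound) (use assms in auto)
  ultimately have "eventually (\<lambda>N. \<bar>psi_P (real N) - \<kappa> * psi (real N)\<bar> \<le> e * real N) sequentially"
    using eventually_ge_at_top[of 1]
  proof eventually_elim
    case (elim N)
    have "psi_P (real N) - \<kappa> * psi (real N) = (\<Sum>n\<in>{1..N}. (of_bool (n \<in> gen P) - \<kappa>) * mangoldt n)"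
      by (simp add: psi_P_def psi_def nats_upto_of_nat left_diff_distrib sum_subtractf sum_distrib_left)
    also have "\<dots> = (\<Sum>n\<in>{1..N}. (of_bool (n \<in> P) - \<kappa>) * (if prime n then ln (real n) else 0) +
         (of_bool (n \<in> gen P) - \<kappa>) * (if prime n then 0 else mangoldt n))"
      by (intro sum.cong refl) (auto simp: prime_gen)
    also have "\<bar>\<dots>\<bar> \<le> \<bar>\<Sum>n\<in>{1..N}. (of_bool (n \<in> P) - \<kappa>) * (if prime n then ln (real n) else 0)\<bar> +
        \<bar>\<Sum>n\<in>{1..N}. (of_bool (n \<in> gen P) - \<kappa>) * (if prime n then 0 else mangoldt n)\<bar>"
      unfolding sum.distrib by (rule abs_triangle_ineq)
    also have "\<bar>\<Sum>n\<in>{1..N}. (of_bool (n \<in> gen P) - \<kappa>) * (if prime n then 0 else mangoldt n)\<bar> \<le>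
        (\<Sum>n\<in>{1..N}. if prime n then 0 else mangoldt n)"
    proof (rule order_trans[OF sum_abs sum_mono])
      fix n
      have "\<bar>of_bool (n \<in> gen P) - \<kappa>\<bar> * mangoldt n \<le> 1 * mangoldt n"
        by (intro mult_right_mono abs_indicator_le mangoldt_nonneg)
      thus "\<bar>(of_bool (n \<in> gen P) - \<kappa>) * (if prime n then 0 else mangoldt n)\<bar> \<le> (if prime n then 0 else mangoldt n)"
        by (auto simp: abs_mult)
    qed
    also have "\<dots> \<le> 2 * sqrt (real N) * ln (real N) ^ 2"
      by (rule sum_mangoldt_nonprime_le) (use elim in auto)
    finally show ?case using elim by linarith
  qed
  then obtain N0 where N0: "\<And>N. N \<ge> N0 \<Longrightarrow> \<bar>psi_P (real N) - \<kappa> * psi (real N)\<bar> \<le> e * real N"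
    unfolding eventually_sequentially by blast
  define C where "C = (\<Sum>N\<in>{..N0}. \<bar>psi_P (real N) - \<kappa> * psi (real N)\<bar>)"
  have "\<bar>psi_P x - \<kappa> * psi x\<bar> \<le> e * x + C" if x: "x \<ge> 0" for x
  proof -
    define N where "N = nat \<lfloor>x\<rfloor>"
    have "nats_upto (real N) = nats_upto x" by (simp add: nats_upto_altdef N_def)
    hence eq: "psi_P x = psi_P (real N)" "psi x = psi (real N)" by (simp_all add: psi_P_def psi_def)
    have Nx: "real N \<le> x" using x by (simp add: N_def)
    have C0: "C \<ge> 0" by (auto simp: C_def intro: sum_nonneg)
    show ?thesis
    proof (cases "N \<ge> N0")
      case True
      have "e * real N \<le> e * x" using Nx assms by (intro mult_left_mono) auto
      thus ?thesis using N0[OF True] C0 unfolding eq by linarith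
    next
      case False
      have "\<bar>psi_P (real N) - \<kappa> * psi (real N)\<bar> \<le> C"
        unfolding C_def by (rule member_le_sum) (use False in auto)
      moreover have "e * x \<ge> 0" using assms x by simp
      ultimately show ?thesis unfolding eq by linarith
    qed
  qed
  moreover have "C \<ge> 0" by (auto simp: C_def intro: sum_nonneg)
  ultimately show ?thesis using that by blast
qed

end

section \<open>Karamata's method: moments and a polynomial majorant\<close>

text \<open>Substitution of (k + 1) v in the Gamma integral. These are the integrals of the
  monomials t^k, t = exp (- v), against the Gamma density.\<close>

lemma Gamma_has_integral_exp:
  assumes \<kappa>: "\<kappa> > (0::real)"
  shows "((\<lambda>v. indicator {0..} v * (v powr (\<kappa> - 1) * exp (- v) * exp (- v) ^ k)) has_integral
           (Gamma \<kappa> / real (Suc k) powr \<kappa>)) UNIV"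
proof -
  define f where "f = (\<lambda>t. indicator {0..} t * t powr (\<kappa> - 1) / exp t :: real)"
  have pos: "Gamma \<kappa> > 0" using \<kappa> by (rule Gamma_real_pos)
  have "has_bochner_integral lborel f (Gamma \<kappa>)"
    by (rule has_bochner_integral_nn_integral)
       (use pos Gamma_conv_nn_integral_real[OF \<kappa>] in \<open>auto simp: f_def\<close>)
  hence "has_bochner_integral lborel (\<lambda>v. f (0 + real (Suc k) * v)) (Gamma \<kappa> /\<^sub>R \<bar>real (Suc k)\<bar>)"
    by (subst lborel_has_bochner_integral_real_affine_iff[symmetric]) auto
  from has_bochner_integral_mult_right[OF this, of "real (Suc k) powr (1 - \<kappa>)"]
  have bi: "has_bochner_integral lborel (\<lambda>v. real (Suc k) powr (1 - \<kappa>) * f (0 + real (Suc k) * v))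
         (real (Suc k) powr (1 - \<kappa>) * (Gamma \<kappa> /\<^sub>R \<bar>real (Suc k)\<bar>))" by simp
  have 1: "real (Suc k) powr (1 - \<kappa>) * (Gamma \<kappa> /\<^sub>R \<bar>real (Suc k)\<bar>) = Gamma \<kappa> / real (Suc k) powr \<kappa>"
  proof -
    have "real (Suc k) powr (1 - \<kappa>) = real (Suc k) / real (Suc k) powr \<kappa>"
      by (subst powr_diff) simp
    thus ?thesis by (simp add: field_simps del: of_nat_Suc)
  qed
  have 2: "real (Suc k) powr (1 - \<kappa>) * f (0 + real (Suc k) * v) =
        indicator {0..} v * (v powr (\<kappa> - 1) * exp (- v) * exp (- v) ^ k)" for v
  proof (cases "v \<ge> 0")
    case True
    have "real (Suc k) powr (1 - \<kappa>) * (real (Suc k) * v) powr (\<kappa> - 1) = v powr (\<kappa> - 1)"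
      using True by (simp add: powr_mult powr_add[symmetric] mult.assoc[symmetric] del: of_nat_Suc)
    moreover have "exp (- v) * exp (- v) ^ k = 1 / exp (real (Suc k) * v)"
    proof -
      have "exp (- v) * exp (- v) ^ k = exp (- v) ^ Suc k" by simp
      also have "\<dots> = exp (real (Suc k) * (- v))" by (rule exp_of_nat_mult[symmetric])
      also have "real (Suc k) * (- v) = - (real (Suc k) * v)" by simp
      finally show ?thesis by (simp only: exp_minus inverse_eq_divide)
    qed
    moreover have "real (Suc k) * v \<ge> 0" using True by simp
    ultimately show ?thesis using True by (simp add: f_def mult.assoc del: of_nat_Suc)
  next
    case False
    hence "real (Suc k) * v < 0" by (intro mult_pos_neg) auto
    thus ?thesis using False by (simp add: f_def del: of_nat_Suc)
  qed
  from bi have "integrable lborel (\<lambda>v. indicator {0..} v * (v powr (\<kappa> - 1) * exp (- v) * exp (- v) ^ k))"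
    "integral\<^sup>L lborel (\<lambda>v. indicator {0..} v * (v powr (\<kappa> - 1) * exp (- v) * exp (- v) ^ k)) = Gamma \<kappa> / real (Suc k) powr \<kappa>"
    unfolding 1 2 has_bochner_integral_iff by auto
  thus ?thesis using has_integral_integral_lborel by metis
qed

lemma triangle_kernel_has_integral:
  assumes \<kappa>: "\<kappa> > (0::real)"
  shows "((\<lambda>v. indicator {0..1} v * (v powr (\<kappa> - 1) * (1 - v))) has_integral (1 / (\<kappa> * (\<kappa> + 1)))) UNIV"
proof -
  have "((\<lambda>v. v powr (\<kappa> - 1) - v powr \<kappa>) has_integral (1 powr (\<kappa> - 1 + 1) / (\<kappa> - 1 + 1) - 1 powr (\<kappa> + 1) / (\<kappa> + 1))) {0..1}"
    by (intro has_integral_diff has_integral_powr_from_0) (use \<kappa> in auto)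
  also have "1 powr (\<kappa> - 1 + 1) / (\<kappa> - 1 + 1) - 1 powr (\<kappa> + 1) / (\<kappa> + 1) = 1 / (\<kappa> * (\<kappa> + 1))"
    using \<kappa> by (simp add: field_simps)
  finally have "((\<lambda>v. if v \<in> {0..1} then v powr (\<kappa> - 1) - v powr \<kappa> else 0) has_integral (1 / (\<kappa> * (\<kappa> + 1)))) UNIV"
    by (simp only: has_integral_restrict_UNIV)
  moreover have "(if v \<in> {0..1} then v powr (\<kappa> - 1) - v powr \<kappa> else 0) = indicator {0..1} v * (v powr (\<kappa> - 1) * (1 - v))"
    for v :: real
  proof (cases "v > 0")
    case True
    have "v powr (\<kappa> - 1) * v = v powr \<kappa>"
      using True powr_add[of v "\<kappa> - 1" 1] by simp
    thus ?thesis by (auto simp: algebra_simps)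
  next
    case False
    thus ?thesis by (cases "v = 0") (auto simp: indicator_def)
  qed
  ultimately show ?thesis by simp
qed

lemma has_sum_finite_sum:
  fixes f :: "'i \<Rightarrow> 'a \<Rightarrow> real"
  assumes "finite I" "\<And>i. i \<in> I \<Longrightarrow> (f i has_sum s i) A"
  shows "((\<lambda>x. \<Sum>i\<in>I. f i x) has_sum (\<Sum>i\<in>I. s i)) A"
  using assms by (induction I rule: finite_induct) (auto intro!: has_sum_add has_sum_0)

text \<open>The kernel \<open>max 0 (1 + ln t)\<close> equals \<open>t * cut_log t\<close> on the unit interval, and this second factor
  is continuous, so that Weierstrass approximation applies to it.\<close>
definition cut_log :: "real \<Rightarrow> real" where
  "cut_log t = (1 + ln (max t (exp (-1)))) / max t (exp (-1))"

lemma cut_log_continuous: "continuous_on UNIV cut_log"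
proof -
  have "max t (exp (-1)) > 0" for t :: real by (simp add: less_max_iff_disj)
  hence "max t (exp (-1)) \<noteq> 0" for t :: real by (metis less_irrefl)
  thus ?thesis unfolding cut_log_def by (intro continuous_intros) auto
qed

lemma cut_log_nonneg: "cut_log t \<ge> 0"
proof -
  have m: "max t (exp (-1)) > 0" "max t (exp (-1)) \<ge> exp (-1)" by (auto simp: less_max_iff_disj)
  hence "ln (max t (exp (-1))) \<ge> -1" by (subst ln_ge_iff) auto
  thus ?thesis unfolding cut_log_def using m(1) by (intro divide_nonneg_nonneg) auto
qed

lemma cut_log_exp:
  assumes "v \<ge> 0"
  shows "exp (- v) * cut_log (exp (- v)) = (if v \<le> 1 then 1 - v else 0)"
proof (cases "v \<le> 1")
  case True
  hence "max (exp (- v)) (exp (- 1)) = exp (- v)" by simp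
  thus ?thesis using True by (simp add: cut_log_def)
next
  case False
  hence "max (exp (- v)) (exp (- 1)) = exp (- 1)" by simp
  thus ?thesis using False by (simp add: cut_log_def)
qed

text \<open>The target constant is 1 / Gamma \<kappa> times the integral of v powr (\<kappa> - 1) (1
  - v) over [0, 1], and the coefficient sum is the same functional applied to the polynomial. Only a
  majorant is constructed, since only an upper bound is wanted.\<close>

lemma karamata_polynomial:
  assumes \<kappa>: "\<kappa> > (0::real)" and e: "e > 0"
  obtains c :: "nat \<Rightarrow> real" and m where
    "\<And>t. t \<in> {0..1} \<Longrightarrow> cut_log t \<le> (\<Sum>k\<le>m. c k * t ^ k)"
    "(\<Sum>k\<le>m. c k / real (Suc k) powr \<kappa>) \<le> 1 / (Gamma \<kappa> * \<kappa> * (\<kappa> + 1)) + e"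
proof -
  define d where "d = e / 2"
  have d: "d > 0" using e by (simp add: d_def)
  have pos: "Gamma \<kappa> > 0" using \<kappa> by (rule Gamma_real_pos)
  obtain g where g: "real_polynomial_function g" "\<And>t. t \<in> {0..1} \<Longrightarrow> \<bar>cut_log t - g t\<bar> < d"
    by (rule Stone_Weierstrass_real_polynomial_function[of "{0..1}" cut_log d])
       (use d continuous_on_subset[OF cut_log_continuous] in auto)
  obtain b m where gb: "g = (\<lambda>t. \<Sum>k\<le>m. b k * t ^ k)"
    using real_polynomial_function_imp_sum[OF g(1)] by blast
  \<comment> \<open>Raising the approximating polynomial by its tolerance d makes it a majorant and
    at most doubles the error, to e.\<close>
  define c where "c = (\<lambda>k. b k + (if k = 0 then d else 0))"
  have c: "(\<Sum>k\<le>m. c k * t ^ k) = g t + d" for t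
    by (simp add: c_def gb ring_distribs sum.distrib if_distrib[of "\<lambda>x. x * _"] sum.delta cong: if_cong)
  have 1: "cut_log t \<le> (\<Sum>k\<le>m. c k * t ^ k)" "(\<Sum>k\<le>m. c k * t ^ k) \<le> cut_log t + e" if "t \<in> {0..1}" for t
    using g(2)[OF that] unfolding c d_def by linarith+
  define W where "W = (\<lambda>v k. indicator {0..} v * (v powr (\<kappa> - 1) * exp (- v) * exp (- v) ^ k) :: real)"
  have W: "((\<lambda>v. W v k) has_integral (Gamma \<kappa> / real (Suc k) powr \<kappa>)) UNIV" for k
    unfolding W_def by (rule Gamma_has_integral_exp[OF \<kappa>])
  have L: "((\<lambda>v. \<Sum>k\<le>m. c k * W v k) has_integral (\<Sum>k\<le>m. c k * (Gamma \<kappa> / real (Suc k) powr \<kappa>))) UNIV"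
    by (intro has_integral_sum has_integral_mult_right W) auto
  have R: "((\<lambda>v. indicator {0..1} v * (v powr (\<kappa> - 1) * (1 - v)) + e * W v 0) has_integral
             (1 / (\<kappa> * (\<kappa> + 1)) + e * (Gamma \<kappa> / real (Suc 0) powr \<kappa>))) UNIV"
    by (intro has_integral_add triangle_kernel_has_integral has_integral_mult_right W \<kappa>)
  have "(\<Sum>k\<le>m. c k * (Gamma \<kappa> / real (Suc k) powr \<kappa>)) \<le> 1 / (\<kappa> * (\<kappa> + 1)) + e * (Gamma \<kappa> / real (Suc 0) powr \<kappa>)"
  proof (rule has_integral_le[OF L R])
    fix v :: real
    show "(\<Sum>k\<le>m. c k * W v k) \<le> indicator {0..1} v * (v powr (\<kappa> - 1) * (1 - v)) + e * W v 0"
    proof (cases "v \<ge> 0")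
      case True
      define A where "A = v powr (\<kappa> - 1) * exp (- v)"
      have A: "A \<ge> 0" by (simp add: A_def)
      have "(\<Sum>k\<le>m. c k * W v k) = A * (\<Sum>k\<le>m. c k * exp (- v) ^ k)"
        using True by (simp add: W_def A_def sum_distrib_left mult_ac)
      also have "\<dots> \<le> A * (cut_log (exp (- v)) + e)"
        using A True by (intro mult_left_mono 1) auto
      also have "\<dots> = v powr (\<kappa> - 1) * (exp (- v) * cut_log (exp (- v))) + e * A"
        by (simp add: A_def algebra_simps)
      also have "\<dots> = indicator {0..1} v * (v powr (\<kappa> - 1) * (1 - v)) + e * W v 0"
        using True by (subst cut_log_exp[OF True]) (auto simp: W_def A_def)
      finally show ?thesis .
    next
      case False
      thus ?thesis by (simp add: W_def)
    qed
  qed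
  also have "(\<Sum>k\<le>m. c k * (Gamma \<kappa> / real (Suc k) powr \<kappa>)) = Gamma \<kappa> * (\<Sum>k\<le>m. c k / real (Suc k) powr \<kappa>)"
    by (simp add: sum_distrib_left mult_ac)
  finally have "(\<Sum>k\<le>m. c k / real (Suc k) powr \<kappa>) \<le> (1 / (\<kappa> * (\<kappa> + 1)) + e * Gamma \<kappa>) / Gamma \<kappa>"
    using pos by (simp add: pos_le_divide_eq mult.commute)
  also have "\<dots> = 1 / (Gamma \<kappa> * \<kappa> * (\<kappa> + 1)) + e"
    using pos by (simp add: add_divide_distrib mult_ac)
  finally have "(\<Sum>k\<le>m. c k / real (Suc k) powr \<kappa>) \<le> 1 / (Gamma \<kappa> * \<kappa> * (\<kappa> + 1)) + e" .
  thus ?thesis using that[of c m] 1 by blast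
qed

section \<open>The Dirichlet series of a balanced class\<close>

context balanced_primes
begin

lemma sum_discrepancy_interval:
  assumes "1 \<le> N" "N \<le> M"
  shows "(\<Sum>n\<in>{N..<M}. (of_bool (n \<in> P) - \<kappa>) * prime_weight n) = discrepancy (M - 1) - discrepancy (N - 1)"
proof -
  have "{1..M - 1} = {1..N - 1} \<union> {N..<M}" using assms by auto
  hence "discrepancy (M - 1) = discrepancy (N - 1) + (\<Sum>n\<in>{N..<M}. (of_bool (n \<in> P) - \<kappa>) * prime_weight n)"
    unfolding discrepancy_def by (simp only:) (rule sum.union_disjoint, auto)
  thus ?thesis by simp
qed

text \<open>The terms of ln F(1 + s) - \<kappa> ln zeta(1 + s), where F is the series of P. They
  still make sense at s = 0, where the two logarithms diverge, and there they are the balanced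
  weights.\<close>

definition diff_term :: "real \<Rightarrow> nat \<Rightarrow> real" where
  "diff_term s n = (of_bool (n \<in> P) - \<kappa>) * (if prime n then euler_log (1 + s) n else 0)"

lemma diff_term_0: "diff_term 0 n = (of_bool (n \<in> P) - \<kappa>) * prime_weight n"
  by (cases "prime n") (simp_all add: diff_term_def prime_weight_def)

lemma diff_term_sums:
  assumes "s > 0"
  shows "diff_term s sums (ln (gen_series P (1 + s)) - \<kappa> * ln (gen_series UNIV (1 + s)))"
proof -
  have "(\<lambda>n. (if prime n \<and> n \<in> P then euler_log (1 + s) n else 0) -
             \<kappa> * (if prime n \<and> n \<in> UNIV then euler_log (1 + s) n else 0)) sums
        (ln (gen_series P (1 + s)) - \<kappa> * ln (gen_series UNIV (1 + s)))"
    by (intro sums_diff sums_mult euler_product_log) (use assms in auto)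
  moreover have "(\<lambda>n. (if prime n \<and> n \<in> P then euler_log (1 + s) n else 0) -
             \<kappa> * (if prime n \<and> n \<in> UNIV then euler_log (1 + s) n else 0)) = diff_term s"
    by (auto simp: diff_term_def fun_eq_iff algebra_simps)
  ultimately show ?thesis by simp
qed

text \<open>Uniformity in s: up to an error 2 / n^2 the terms are v n times n powr - s. Partial sums
  of v are small because those of the balanced weights are, and the factor n powr - s decreases from
  at most 1, so partial summation preserves the bound.\<close>

lemma diff_term_tail:
  assumes e: "e > 0"
  obtains N0 where "N0 \<ge> 1" "\<And>N M s. N0 \<le> N \<Longrightarrow> N \<le> M \<Longrightarrow> s \<ge> 0 \<Longrightarrow> \<bar>\<Sum>n\<in>{N..<M}. diff_term s n\<bar> \<le> e"
proof -
  define d where "d = e / 4"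
  have d: "d > 0" using e by (simp add: d_def)
  have "summable (\<lambda>n. 2 * (1 / real n ^ 2))"
    by (intro summable_mult) (use inverse_power_summable[of 2, where ?'a = real] in \<open>simp add: inverse_eq_divide\<close>)
  then obtain N1 where N1: "\<And>m n. m \<ge> N1 \<Longrightarrow> norm (\<Sum>k\<in>{m..<n}. 2 * (1 / real k ^ 2)) < d"
    using d unfolding summable_Cauchy by blast
  have "eventually (\<lambda>n. dist (discrepancy n) 0 < d / 2) sequentially"
    using discrepancy_tendsto_0 by (rule tendstoD) (use d in auto)
  then obtain N2 where N2: "\<And>n. n \<ge> N2 \<Longrightarrow> \<bar>discrepancy n\<bar> < d / 2"
    unfolding eventually_sequentially by auto
  define v where "v = (\<lambda>n. (of_bool (n \<in> P) - \<kappa>) * (if prime n then 1 / real n else 0))"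
  define r where "r = (\<lambda>s n. (of_bool (n \<in> P) - \<kappa>) * (if prime n then euler_log (1 + s) n - real n powr - (1 + s) else 0))"
  have r: "\<bar>r s n\<bar> \<le> 2 * (1 / real n ^ 2)" if "s \<ge> 0" for s n
  proof (cases "prime n")
    case True
    have "0 \<le> euler_log (1 + s) n - real n powr - (1 + s)" "euler_log (1 + s) n - real n powr - (1 + s) \<le> 2 / real n ^ 2"
      using euler_log_bounds[of "1 + s" n] True that by auto
    hence "\<bar>of_bool (n \<in> P) - \<kappa>\<bar> * \<bar>euler_log (1 + s) n - real n powr - (1 + s)\<bar> \<le> 1 * (2 / real n ^ 2)"
      by (intro mult_mono abs_indicator_le) auto
    thus ?thesis using True unfolding r_def abs_mult by simp
  qed (simp add: r_def)
  have rsum: "\<bar>\<Sum>n\<in>{N..<M}. r s n\<bar> \<le> d" if "s \<ge> 0" "N \<ge> N1" for s N M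
  proof -
    have "\<bar>\<Sum>n\<in>{N..<M}. r s n\<bar> \<le> (\<Sum>n\<in>{N..<M}. 2 * (1 / real n ^ 2))"
      by (rule order_trans[OF sum_abs sum_mono]) (use r that in auto)
    also have "\<dots> \<le> norm (\<Sum>n\<in>{N..<M}. 2 * (1 / real n ^ 2))" by simp
    also have "\<dots> \<le> d" using N1[OF that(2), of M] by linarith
    finally show ?thesis .
  qed
  have split: "diff_term s n = v n * real n powr - s + r s n" for s n
    by (auto simp: diff_term_def v_def r_def powr_diff powr_minus_divide prime_gt_0_nat field_simps powr_add)
  define N0 where "N0 = max (max N1 (N2 + 1)) 1"
  have "\<bar>\<Sum>n\<in>{N..<M}. diff_term s n\<bar> \<le> e" if N: "N0 \<le> N" "N \<le> M" and s: "s \<ge> 0" for N M s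
  proof -
    have vsum: "\<bar>\<Sum>n\<in>{N..<m}. v n\<bar> \<le> 2 * d" if "N \<le> m" for m
    proof -
      have "(\<Sum>n\<in>{N..<m}. diff_term 0 n) = discrepancy (m - 1) - discrepancy (N - 1)"
        using sum_discrepancy_interval[of N m] that N by (simp add: diff_term_0 N0_def)
      moreover have "\<bar>discrepancy (m - 1)\<bar> < d / 2" "\<bar>discrepancy (N - 1)\<bar> < d / 2"
        using N that N2[of "m - 1"] N2[of "N - 1"] by (auto simp: N0_def)
      ultimately have "\<bar>\<Sum>n\<in>{N..<m}. diff_term 0 n\<bar> \<le> d" by linarith
      moreover have "(\<Sum>n\<in>{N..<m}. diff_term 0 n) = (\<Sum>n\<in>{N..<m}. v n) + (\<Sum>n\<in>{N..<m}. r 0 n)"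
      proof -
        have "diff_term 0 n = v n + r 0 n" for n
          using split[of 0 n] by (cases "n = 0") (simp_all add: v_def)
        thus ?thesis by (simp add: sum.distrib)
      qed
      moreover have "\<bar>\<Sum>n\<in>{N..<m}. r 0 n\<bar> \<le> d" using N by (intro rsum) (auto simp: N0_def)
      ultimately show ?thesis by linarith
    qed
    have "\<bar>\<Sum>n\<in>{N..<M}. v n * real n powr - s\<bar> \<le> 2 * d * real N powr - s"
    proof (rule sum_mult_decreasing_le[OF N(2)])
      fix n assume "N \<le> n"
      hence "n \<ge> 1" using N by (auto simp: N0_def)
      thus "real (Suc n) powr - s \<le> real n powr - s" using s by (intro powr_mono2') auto
    qed (use vsum in auto)
    also have "\<dots> \<le> 2 * d * 1"
    proof (intro mult_left_mono)
      have "real N \<ge> 1" using N by (auto simp: N0_def)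
      thus "real N powr - s \<le> 1" using s by (simp add: powr_le_one_le powr_minus_divide ge_one_powr_ge_zero)
    qed (use d in auto)
    finally have "\<bar>\<Sum>n\<in>{N..<M}. v n * real n powr - s\<bar> \<le> 2 * d" by simp
    moreover have "\<bar>\<Sum>n\<in>{N..<M}. r s n\<bar> \<le> d" using N s by (intro rsum) (auto simp: N0_def)
    moreover have "(\<Sum>n\<in>{N..<M}. diff_term s n) = (\<Sum>n\<in>{N..<M}. v n * real n powr - s) + (\<Sum>n\<in>{N..<M}. r s n)"
      by (simp add: split sum.distrib)
    ultimately show ?thesis using d by (simp add: d_def)
  qed
  thus ?thesis using that[of N0] by (auto simp: N0_def)
qed

text \<open>An Abelian limit: at s = 0 the partial sums are the discrepancy, which tends to 0. The
  uniform tail bound reduces the passage s \<rightarrow> 0 to finitely many continuous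
  terms.\<close>

theorem ln_gen_series_diff:
  "((\<lambda>s. ln (gen_series P (1 + s)) - \<kappa> * ln (gen_series UNIV (1 + s))) \<longlongrightarrow> 0) (at_right 0)"
proof (rule tendstoI)
  fix e :: real assume e: "e > 0"
  define L where "L = (\<lambda>s. ln (gen_series P (1 + s)) - \<kappa> * ln (gen_series UNIV (1 + s)))"
  define d where "d = e / 4"
  have d: "d > 0" using e by (simp add: d_def)
  obtain N1 where N1: "N1 \<ge> 1" "\<And>N M s. N1 \<le> N \<Longrightarrow> N \<le> M \<Longrightarrow> s \<ge> 0 \<Longrightarrow> \<bar>\<Sum>n\<in>{N..<M}. diff_term s n\<bar> \<le> d"
    using diff_term_tail[OF d] by metis
  have "eventually (\<lambda>n. dist (discrepancy n) 0 < d) sequentially"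
    using discrepancy_tendsto_0 d by (rule tendstoD)
  then obtain N2 where N2: "\<And>n. n \<ge> N2 \<Longrightarrow> \<bar>discrepancy n\<bar> < d"
    unfolding eventually_sequentially by auto
  define N where "N = max N1 (N2 + 1)"
  have N: "N \<ge> N1" "N - 1 \<ge> N2" "N \<ge> 1" using N1(1) by (auto simp: N_def)
  define S where "S = (\<lambda>s. \<Sum>n<N. diff_term s n)"
  have "diff_term 0 0 = 0" by (simp add: diff_term_def)
  hence "S 0 = (\<Sum>n\<in>{1..<N}. diff_term 0 n)"
    unfolding S_def using N(3) by (intro sum.mono_neutral_right) (auto simp: not_le less_Suc_eq)
  also have "\<dots> = (\<Sum>n\<in>{1..<N}. (of_bool (n \<in> P) - \<kappa>) * prime_weight n)"
    by (simp add: diff_term_0)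
  also have "\<dots> = discrepancy (N - 1)"
    using sum_discrepancy_interval[of 1 N] N by (simp add: discrepancy_def)
  finally have S0: "\<bar>S 0\<bar> < d" using N2[OF N(2)] by simp
  have "(S \<longlongrightarrow> S 0) (at_right 0)"
    unfolding S_def
  proof (intro tendsto_sum)
    fix n
    show "((\<lambda>s. diff_term s n) \<longlongrightarrow> diff_term 0 n) (at_right 0)"
    proof (cases "prime n")
      case True
      have "real n \<noteq> 0" "1 - real n powr - (1 + 0) \<noteq> 0"
        using True prime_gt_1_nat[OF True] by (auto simp: powr_minus_divide)
      thus ?thesis using True unfolding diff_term_def euler_log_def
        by (auto intro!: tendsto_eq_intros)
    qed (simp add: diff_term_def)
  qed
  hence "eventually (\<lambda>s. dist (S s) (S 0) < d) (at_right 0)" using d by (rule tendstoD)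
  moreover have "eventually (\<lambda>s::real. s > 0) (at_right 0)" by (rule eventually_at_right_less)
  ultimately show "eventually (\<lambda>s. dist (L s) 0 < e) (at_right 0)"
  proof eventually_elim
    case (elim s)
    have "(\<lambda>M. (\<Sum>n<M. diff_term s n)) \<longlonglongrightarrow> L s"
      using diff_term_sums[of s] elim by (simp add: sums_def L_def)
    hence lim: "(\<lambda>M. \<bar>(\<Sum>n<M. diff_term s n) - S s\<bar>) \<longlonglongrightarrow> \<bar>L s - S s\<bar>"
      by (intro tendsto_intros)
    have "\<bar>L s - S s\<bar> \<le> d"
    proof (rule LIMSEQ_le_const2[OF lim], rule exI[of _ N], intro allI impI)
      fix M assume M: "M \<ge> N"
      have "(\<Sum>n<M. diff_term s n) = S s + (\<Sum>n\<in>{N..<M}. diff_term s n)"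
        unfolding S_def lessThan_atLeast0 using M by (intro sum.atLeastLessThan_concat[symmetric]) auto
      thus "\<bar>(\<Sum>n<M. diff_term s n) - S s\<bar> \<le> d" using N1(2)[OF N(1) M, of s] elim by simp
    qed
    moreover have "\<bar>S s - S 0\<bar> < d" using elim by (simp add: dist_real_def)
    ultimately have "\<bar>L s\<bar> < e" using S0 e unfolding d_def by linarith
    thus ?case by (simp add: dist_real_def)
  qed
qed

theorem gen_series_asymp: "((\<lambda>s. s powr \<kappa> * gen_series P (1 + s)) \<longlongrightarrow> 1) (at_right 0)"
proof -
  have "((\<lambda>s. ln (s * gen_series UNIV (1 + s))) \<longlongrightarrow> ln 1) (at_right 0)"
    by (intro tendsto_ln gen_series_UNIV_asymp) auto
  hence "((\<lambda>s. exp ((ln (gen_series P (1 + s)) - \<kappa> * ln (gen_series UNIV (1 + s))) +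
            \<kappa> * ln (s * gen_series UNIV (1 + s)))) \<longlongrightarrow> exp (0 + \<kappa> * ln 1)) (at_right 0)"
    by (rule tendsto_exp[OF tendsto_add[OF ln_gen_series_diff tendsto_mult[OF tendsto_const]]])
  moreover have "eventually (\<lambda>s. exp ((ln (gen_series P (1 + s)) - \<kappa> * ln (gen_series UNIV (1 + s))) +
            \<kappa> * ln (s * gen_series UNIV (1 + s))) = s powr \<kappa> * gen_series P (1 + s)) (at_right 0)"
    using eventually_at_right_less[of "0::real"]
  proof eventually_elim
    case (elim s)
    have g: "gen_series P (1 + s) > 0" "gen_series UNIV (1 + s) > 0"
      using gen_series_ge_1[of "1 + s" P] gen_series_ge_1[of "1 + s" UNIV] elim by auto
    have "(ln (gen_series P (1 + s)) - \<kappa> * ln (gen_series UNIV (1 + s))) + \<kappa> * ln (s * gen_series UNIV (1 + s))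
       = ln (gen_series P (1 + s)) + \<kappa> * ln s"
      using g elim by (simp add: ln_mult_pos algebra_simps)
    also have "exp \<dots> = s powr \<kappa> * gen_series P (1 + s)"
      using g elim by (simp add: exp_add powr_def)
    finally show ?case .
  qed
  ultimately show ?thesis by (simp add: tendsto_cong)
qed

section \<open>Mean values of the indicator of the generated integers\<close>

definition f :: "nat \<Rightarrow> real" where "f n = of_bool (n \<in> gen P)"

lemma f_bounds: "f n \<ge> 0" "f n \<le> 1"
  by (auto simp: f_def)

definition log_sum :: "real \<Rightarrow> real" where "log_sum x = (\<Sum>n\<in>nats_upto x. f n / real n)"

text \<open>The extra logarithm is the one that Selberg's main term y ln y produces at y = x / m. It
  also makes the summation kernel continuous, so Weierstrass approximation applies directly.\<close>

definition riesz_sum :: "real \<Rightarrow> real" where "riesz_sum x = (\<Sum>n\<in>nats_upto x. f n / real n * ln (x / real n))"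

lemma log_sum_nonneg: "log_sum x \<ge> 0"
  unfolding log_sum_def by (intro sum_nonneg) (auto simp: f_bounds)

lemma sum_f_le_gen_series:
  assumes "\<And>n. n \<in> gen P \<Longrightarrow> g n \<ge> 0" "g summable_on gen P"
  shows "(\<Sum>n\<in>nats_upto x. f n * g n) \<le> (\<Sum>\<^sub>\<infinity>n\<in>gen P. g n)"
proof -
  have "(\<Sum>n\<in>nats_upto x. f n * g n) = (\<Sum>n\<in>nats_upto x \<inter> gen P. g n)"
    by (rule sum.mono_neutral_cong_right) (auto simp: f_def)
  also have "\<dots> \<le> (\<Sum>\<^sub>\<infinity>n\<in>gen P. g n)"
    by (rule finite_sum_le_infsum) (use assms in auto)
  finally show ?thesis .
qed

text \<open>Rankin's trick with s = 1 / ln x: for n \<le> x the factor n powr s is at most e, so 1 /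
  n is at most e times n powr - (1 + s). Small x are absorbed into K because ln x powr \<kappa>
  \<ge> 1 for x \<ge> e.\<close>

lemma log_sum_upper:
  obtains K where "K \<ge> 0" "\<And>x. x \<ge> exp 1 \<Longrightarrow> log_sum x \<le> K * ln x powr \<kappa>"
proof -
  have inv: "filterlim (\<lambda>u::real. inverse u) (at_right 0) at_top"
    by (rule filterlim_inverse_at_right_top)
  have "((\<lambda>u. inverse u powr \<kappa> * gen_series P (1 + inverse u)) \<longlongrightarrow> 1) at_top"
    by (rule filterlim_compose[OF gen_series_asymp inv])
  hence "eventually (\<lambda>u. inverse u powr \<kappa> * gen_series P (1 + inverse u) < 2) at_top"
    by (rule order_tendstoD) auto
  then obtain u0 where u0: "\<And>u. u \<ge> u0 \<Longrightarrow> inverse u powr \<kappa> * gen_series P (1 + inverse u) < 2"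
    unfolding eventually_at_top_linorder by blast
  define u1 where "u1 = max u0 1"
  have bd: "log_sum x \<le> 2 * exp 1 * ln x powr \<kappa>" if x: "ln x \<ge> u1" "x > 0" for x
  proof -
    define u where "u = ln x"
    have u: "u \<ge> 1" "u \<ge> u0" using x by (auto simp: u_def u1_def)
    have "log_sum x \<le> (\<Sum>n\<in>nats_upto x. f n * (exp 1 * real n powr - (1 + inverse u)))"
      unfolding log_sum_def
    proof (intro sum_mono)
      fix n assume n: "n \<in> nats_upto x"
      hence n0: "real n > 0" "real n \<le> x" by (auto simp: mem_nats_upto)
      have "real n powr inverse u \<le> x powr inverse u"
        using n0 u by (intro powr_mono2) auto
      also have "\<dots> = exp 1" using x u by (cases "x = 1") (auto simp: powr_def u_def field_simps)
      finally have "real n powr inverse u * real n powr - (1 + inverse u) \<le> exp 1 * real n powr - (1 + inverse u)"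
        by (intro mult_right_mono) auto
      also have "real n powr inverse u * real n powr - (1 + inverse u) = 1 / real n"
        using n0 by (simp add: powr_add[symmetric] powr_minus_divide)
      finally have "f n * (1 / real n) \<le> f n * (exp 1 * real n powr - (1 + inverse u))"
        by (intro mult_left_mono f_bounds)
      thus "f n / real n \<le> f n * (exp 1 * real n powr - (1 + inverse u))" by simp
    qed
    also have "\<dots> \<le> (\<Sum>\<^sub>\<infinity>n\<in>gen P. exp 1 * real n powr - (1 + inverse u))"
      by (intro sum_f_le_gen_series summable_on_cmult_right powr_summable_on) (use u in auto)
    also have "\<dots> = exp 1 * gen_series P (1 + inverse u)"
      unfolding gen_series_def by (intro infsum_cmult_right powr_summable_on) (use u in auto)
    also have "\<dots> \<le> exp 1 * (2 * u powr \<kappa>)"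
    proof (intro mult_left_mono)
      have lt2: "inverse u powr \<kappa> * gen_series P (1 + inverse u) < 2" by (rule u0) (use u in auto)
      show "gen_series P (1 + inverse u) \<le> 2 * u powr \<kappa>"
      proof -
        have "inverse u powr \<kappa> = 1 / u powr \<kappa>" using u by (simp add: inverse_eq_divide powr_divide)
        moreover have "u powr \<kappa> > 0" using u by simp
        moreover note lt2
        ultimately have "gen_series P (1 + inverse u) < 2 * u powr \<kappa>"
          by (simp only: divide_less_eq mult_1_left times_divide_eq_left if_True)
        thus ?thesis by simp
      qed
    qed auto
    finally show ?thesis by (simp add: u_def)
  qed
  define K where "K = 2 * exp 1 + log_sum (exp u1)"
  have "log_sum x \<le> K * ln x powr \<kappa>" if x: "x \<ge> exp 1" for x
  proof -
    have x0: "x > 0" using x by (meson exp_gt_zero less_le_trans)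
    have l: "ln x \<ge> 1" using x x0 by (subst ln_ge_iff) auto
    have p1: "ln x powr \<kappa> \<ge> 1" using l \<kappa> by (intro ge_one_powr_ge_zero) auto
    have mul: "a * 1 \<le> a * ln x powr \<kappa>" if "a \<ge> 0" for a
      using p1 that by (intro mult_left_mono) auto
    show ?thesis
    proof (cases "ln x \<ge> u1")
      case True
      thus ?thesis using bd[OF True x0] mul[OF log_sum_nonneg[of "exp u1"]] log_sum_nonneg[of "exp u1"]
        by (simp add: K_def distrib_right)
    next
      case False
      hence "x \<le> exp u1" using x0 by (metis exp_ln exp_le_cancel_iff linear)
      hence "log_sum x \<le> log_sum (exp u1)" unfolding log_sum_def
        by (intro sum_mono2 nats_upto_mono) (auto simp: f_bounds)
      moreover have "0 \<le> 2 * exp 1 * ln x powr \<kappa>" by simp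
      moreover have "K * ln x powr \<kappa> = 2 * exp 1 * ln x powr \<kappa> + log_sum (exp u1) * ln x powr \<kappa>"
        by (simp add: K_def distrib_right)
      ultimately show ?thesis using mul[OF log_sum_nonneg[of "exp u1"]] by linarith
    qed
  qed
  moreover have "K \<ge> 0" using log_sum_nonneg[of "exp u1"] by (simp add: K_def)
  ultimately show ?thesis using that by blast
qed

text \<open>With s = 1 / ln x and t = n powr - s, the kernel s ln (x / n) = 1 + ln t is bounded by t
  times the Karamata polynomial in t. Its k-th monomial sums to the series at 1 + (k + 1) s, of size
  ((k + 1) s) powr - \<kappa>.\<close>

theorem riesz_sum_upper:
  assumes e: "e > 0"
  shows "eventually (\<lambda>x. riesz_sum x \<le> (1 / (Gamma \<kappa> * \<kappa> * (\<kappa> + 1)) + e) * ln x powr (1 + \<kappa>)) at_top"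
proof -
  define C where "C = 1 / (Gamma \<kappa> * \<kappa> * (\<kappa> + 1))"
  obtain c m where c: "\<And>t. t \<in> {0..1} \<Longrightarrow> cut_log t \<le> (\<Sum>k\<le>m. c k * t ^ k)"
    and csum: "(\<Sum>k\<le>m. c k / real (Suc k) powr \<kappa>) \<le> C + e / 2"
    using karamata_polynomial[OF \<kappa>(1), of "e / 2"] e unfolding C_def by auto
  have "((\<lambda>s. \<Sum>k\<le>m. c k / real (Suc k) powr \<kappa> * ((real (Suc k) * s) powr \<kappa> * gen_series P (1 + real (Suc k) * s)))
       \<longlongrightarrow> (\<Sum>k\<le>m. c k / real (Suc k) powr \<kappa> * 1)) (at_right 0)"
  proof (intro tendsto_sum tendsto_mult tendsto_const)
    fix k
    have "filterlim (\<lambda>s. real (Suc k) * s) (at_right 0) (at_right 0)"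
      by (rule filterlim_times_pos[OF filterlim_ident]) auto
    from filterlim_compose[OF gen_series_asymp this]
    show "((\<lambda>s. (real (Suc k) * s) powr \<kappa> * gen_series P (1 + real (Suc k) * s)) \<longlongrightarrow> 1) (at_right 0)" .
  qed
  hence "eventually (\<lambda>s. (\<Sum>k\<le>m. c k / real (Suc k) powr \<kappa> * ((real (Suc k) * s) powr \<kappa> * gen_series P (1 + real (Suc k) * s)))
       < C + e) (at_right 0)"
    by (rule order_tendstoD) (use csum e in auto)
  hence "eventually (\<lambda>u. (\<Sum>k\<le>m. c k / real (Suc k) powr \<kappa> *
       ((real (Suc k) * inverse u) powr \<kappa> * gen_series P (1 + real (Suc k) * inverse u))) < C + e) at_top"
    using filterlim_inverse_at_right_top unfolding filterlim_iff by blast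
  hence "eventually (\<lambda>x. (\<Sum>k\<le>m. c k / real (Suc k) powr \<kappa> *
       ((real (Suc k) * inverse (ln x)) powr \<kappa> * gen_series P (1 + real (Suc k) * inverse (ln x)))) < C + e) at_top"
    using ln_at_top unfolding filterlim_iff by blast
  moreover have "eventually (\<lambda>x::real. x > exp 1) at_top" by (rule eventually_gt_at_top)
  ultimately show ?thesis unfolding C_def[symmetric]
  proof eventually_elim
    case (elim x)
    define u s where "u = ln x" and "s = inverse u"
    have x0: "x > 0" using elim by (meson exp_gt_zero less_trans)
    have u: "u > 1" using elim x0 unfolding u_def by (metis exp_ln exp_less_cancel_iff)
    have s: "s > 0" "u * s = 1" using u by (auto simp: s_def)
    define g where "g = (\<lambda>n. \<Sum>k\<le>m. c k * real n powr - (1 + real (Suc k) * s))"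
    have g_eq: "g n = 1 / real n * (real n powr - s * (\<Sum>k\<le>m. c k * (real n powr - s) ^ k))" if "n > 0" for n
    proof -
      have "real n powr - (1 + real (Suc k) * s) = 1 / real n * (real n powr - s * (real n powr - s) ^ k)" for k
      proof -
        have "1 / real n * (real n powr - s * (real n powr - s) ^ k) = real n powr - 1 * (real n powr - s) ^ Suc k"
          using that by (simp add: powr_minus_divide)
        also have "(real n powr - s) ^ Suc k = real n powr (real (Suc k) * (- s))"
          using that by (subst powr_power) (auto simp del: of_nat_Suc power_Suc)
        also have "real n powr - 1 * real n powr (real (Suc k) * (- s)) = real n powr - (1 + real (Suc k) * s)"
          by (subst powr_add[symmetric]) (simp del: of_nat_Suc)
        finally show ?thesis by simp
      qed
      thus ?thesis by (simp add: g_def sum_distrib_left mult_ac del: of_nat_Suc)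
    qed
    have t01: "real n powr - s \<in> {0..1}" if "n > 0" for n
    proof -
      have "real n powr s \<ge> 1" using that s by (intro ge_one_powr_ge_zero) auto
      hence "1 / real n powr s \<le> 1 / 1" using that by (intro divide_left_mono) auto
      thus ?thesis by (simp add: powr_minus_divide)
    qed
    \<comment> \<open>The majorant is nonnegative, so the finite sum may be enlarged to the whole of
      \<open>gen P\<close>.\<close>
    have g0: "g n \<ge> 0" if "n > 0" for n
      using c[OF t01[OF that]] cut_log_nonneg[of "real n powr - s"] unfolding g_eq[OF that]
      by (intro mult_nonneg_nonneg) auto
    have sm: "(\<lambda>n. c k * real n powr - (1 + real (Suc k) * s)) summable_on gen P" for k
      using s by (intro summable_on_cmult_right powr_summable_on) (auto simp: add_pos_nonneg)
    have g_sum: "(g has_sum (\<Sum>k\<le>m. \<Sum>\<^sub>\<infinity>n\<in>gen P. c k * real n powr - (1 + real (Suc k) * s))) (gen P)"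
      unfolding g_def by (intro has_sum_finite_sum has_sum_infsum sm) auto
    have "s * riesz_sum x = (\<Sum>n\<in>nats_upto x. f n * (1 / real n * (1 - s * ln (real n))))"
    proof -
      have "s * (f n / real n * ln (x / real n)) = f n * (1 / real n * (1 - s * ln (real n)))"
        if "n \<in> nats_upto x" for n
      proof -
        have "ln (x / real n) = u - ln (real n)"
          using that x0 by (simp add: u_def ln_div mem_nats_upto)
        hence "s * ln (x / real n) = u * s - s * ln (real n)" by (simp add: right_diff_distrib mult.commute)
        hence "s * ln (x / real n) = 1 - s * ln (real n)" using s by simp
        hence "s * (f n / real n * ln (x / real n)) = f n / real n * (1 - s * ln (real n))"
          by (metis mult.left_commute)
        thus ?thesis by simp
      qed
      thus ?thesis unfolding riesz_sum_def sum_distrib_left by (intro sum.cong refl)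
    qed
    also have "\<dots> \<le> (\<Sum>n\<in>nats_upto x. f n * g n)"
    proof (intro sum_mono mult_left_mono f_bounds)
      fix n assume "n \<in> nats_upto x"
      hence n: "n > 0" by (simp add: mem_nats_upto)
      define v where "v = s * ln (real n)"
      have v: "v \<ge> 0" using s n by (simp add: v_def)
      have t: "real n powr - s = exp (- v)" using n by (simp add: powr_def v_def)
      have "1 - v \<le> exp (- v) * cut_log (exp (- v))" unfolding cut_log_exp[OF v] by auto
      also have "\<dots> \<le> exp (- v) * (\<Sum>k\<le>m. c k * exp (- v) ^ k)"
        using c[OF t01[OF n]] unfolding t by (intro mult_left_mono) auto
      finally show "1 / real n * (1 - s * ln (real n)) \<le> g n"
        unfolding g_eq[OF n] t v_def by (intro mult_left_mono) auto
    qed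
    also have "\<dots> \<le> (\<Sum>\<^sub>\<infinity>n\<in>gen P. g n)"
      by (intro sum_f_le_gen_series g0 gen_pos has_sum_imp_summable[OF g_sum])
    also have "\<dots> = (\<Sum>k\<le>m. \<Sum>\<^sub>\<infinity>n\<in>gen P. c k * real n powr - (1 + real (Suc k) * s))"
      by (rule infsumI[OF g_sum])
    also have "\<dots> = (\<Sum>k\<le>m. c k * gen_series P (1 + real (Suc k) * s))"
      unfolding gen_series_def
      by (intro sum.cong refl infsum_cmult_right powr_summable_on) (use s in \<open>auto simp: add_pos_nonneg\<close>)
    finally have "s powr \<kappa> * (s * riesz_sum x) \<le> s powr \<kappa> * (\<Sum>k\<le>m. c k * gen_series P (1 + real (Suc k) * s))"
      by (intro mult_left_mono) auto
    also have "\<dots> = (\<Sum>k\<le>m. c k / real (Suc k) powr \<kappa> * ((real (Suc k) * s) powr \<kappa> * gen_series P (1 + real (Suc k) * s)))"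
      using s by (simp add: sum_distrib_left powr_mult field_simps del: of_nat_Suc)
    also have "\<dots> < C + e" using elim by (simp add: s_def u_def)
    finally have "s powr \<kappa> * (s * riesz_sum x) < C + e" .
    hence "u powr (1 + \<kappa>) * (s powr \<kappa> * (s * riesz_sum x)) \<le> u powr (1 + \<kappa>) * (C + e)"
      by (intro mult_left_mono) auto
    moreover have "u powr (1 + \<kappa>) * (s powr \<kappa> * (s * riesz_sum x)) = riesz_sum x"
    proof -
      have "u powr (1 + \<kappa>) * s powr \<kappa> * s = 1"
        using u by (simp add: s_def powr_add powr_divide field_simps)
      thus ?thesis by (simp add: mult.assoc[symmetric])
    qed
    ultimately have "riesz_sum x \<le> u powr (1 + \<kappa>) * (C + e)" by linarith
    thus ?case by (simp add: u_def mult.commute)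
  qed
qed

end

section \<open>The contraction argument\<close>

lemma sum_ln_quotient_le:
  assumes "x \<ge> 1"
  shows "(\<Sum>n\<in>nats_upto x. ln (x / real n)) \<le> 2 * x"
proof -
  have "(\<Sum>n\<in>nats_upto x. ln (x / real n)) = (\<Sum>n\<in>nats_upto x. ln x - ln (real n))"
    by (intro sum.cong refl) (use assms in \<open>auto simp: mem_nats_upto ln_div\<close>)
  also have "\<dots> = real (card (nats_upto x)) * ln x - (\<Sum>n\<in>nats_upto x. ln (real n))"
    by (simp add: sum_subtractf)
  also have "\<dots> \<le> x * ln x - (x * ln x - x + 1 - ln x)"
    using ln_sum_bounds[OF assms] card_nats_upto_bounds(1)[of x] assms
    by (intro diff_mono mult_right_mono) auto
  also have "\<dots> \<le> 2 * x" using ln_le_minus_one[of x] assms by simp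
  finally show ?thesis .
qed

text \<open>Bounding ln z by the harmonic sum up to z and swapping the sums leaves psi (y / k) / k.
  Chebyshev's 8 y / k and the bound 2 for the sum of 1 / k^2 give 16.\<close>

lemma sum_mangoldt_ln_quotient_le:
  assumes "y \<ge> 0"
  shows "(\<Sum>d\<in>nats_upto y. mangoldt d * ln (y / real d)) \<le> 16 * y"
proof -
  have "(\<Sum>d\<in>nats_upto y. mangoldt d * ln (y / real d)) \<le>
        (\<Sum>d\<in>nats_upto y. mangoldt d * (\<Sum>k\<in>nats_upto (y / real d). 1 / real k))"
  proof (intro sum_mono mult_left_mono mangoldt_nonneg)
    fix d assume d: "d \<in> nats_upto y"
    define z where "z = y / real d"
    have z: "z \<ge> 1" using d by (auto simp: z_def mem_nats_upto field_simps)
    have "ln z \<le> ln (real (nat \<lfloor>z\<rfloor>) + 1)" using z by (subst ln_le_cancel_iff) linarith+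
    also have "\<dots> \<le> harm (nat \<lfloor>z\<rfloor>)" by (rule ln_le_harm)
    also have "\<dots> = (\<Sum>k\<in>nats_upto z. 1 / real k)"
      by (simp add: nats_upto_altdef harm_def inverse_eq_divide)
    finally show "ln (y / real d) \<le> (\<Sum>k\<in>nats_upto (y / real d). 1 / real k)" by (simp add: z_def)
  qed
  also have "\<dots> = (\<Sum>d\<in>nats_upto y. \<Sum>k\<in>nats_upto (y / real d). mangoldt d * (1 / real k))"
    by (simp add: sum_distrib_left)
  also have "\<dots> = (\<Sum>k\<in>nats_upto y. \<Sum>d\<in>nats_upto (y / real k). mangoldt d * (1 / real k))"
    by (rule sum_nats_upto_swap)
  also have "\<dots> = (\<Sum>k\<in>nats_upto y. psi (y / real k) * (1 / real k))"
    by (simp add: psi_def sum_divide_distrib)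
  also have "\<dots> \<le> (\<Sum>k\<in>nats_upto y. (8 * (y / real k)) * (1 / real k))"
    by (intro sum_mono mult_right_mono psi_bound) (use assms in auto)
  also have "\<dots> = 8 * y * (\<Sum>k\<in>nats_upto y. 1 / real k ^ 2)"
    by (simp add: sum_distrib_left power2_eq_square)
  also have "\<dots> \<le> 8 * y * 2"
    using assms unfolding nats_upto_altdef by (intro mult_left_mono sum_inverse_squares_le) auto
  finally show ?thesis by simp
qed

text \<open>The right-hand side is the integral of \<open>v * (u - v) powr (\<kappa> - 1)\<close> over \<open>[0, u]\<close>. The proof uses
  the junk value \<open>ln 0 = 0\<close> in the term \<open>ln (n - 1)\<close> for \<open>n = 1\<close>.\<close>
lemma sum_mangoldt_kernel_le:
  fixes u \<kappa> :: real
  assumes \<kappa>: "0 < \<kappa>" "\<kappa> < 1" and N: "N \<ge> 1" "ln (real N) \<le> u - 1"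
  shows "(\<Sum>n\<in>{1..N}. mangoldt n / real n * (ln (real n) * (u - ln (real n)) powr (\<kappa> - 1)))
           \<le> u powr (1 + \<kappa>) / (\<kappa> * (\<kappa> + 1)) + 19 * u"
proof -
  have lnN: "ln (real N) \<ge> 0" using N by simp
  have u: "u \<ge> 1" using N lnN by linarith
  define \<phi> where "\<phi> = (\<lambda>v. v * (u - v) powr (\<kappa> - 1))"
  \<comment> \<open>An antiderivative of \<phi> normalised to vanish at u, so that - \<Phi> 0 is the
    full integral.\<close>
  define \<Phi> where "\<Phi> = (\<lambda>v. - u * (u - v) powr \<kappa> / \<kappa> + (u - v) powr (\<kappa> + 1) / (\<kappa> + 1))"
  have deriv: "(\<Phi> has_real_derivative \<phi> v) (at v)" if "v < u" for v
  proof -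
    have "(\<Phi> has_real_derivative (u * (u - v) powr (\<kappa> - 1) - (u - v) powr \<kappa>)) (at v)"
      unfolding \<Phi>_def using that \<kappa> by (auto intro!: derivative_eq_intros)
    also have "(u - v) powr \<kappa> = (u - v) * (u - v) powr (\<kappa> - 1)"
      using that powr_add[of "u - v" 1 "\<kappa> - 1"] by simp
    also have "u * (u - v) powr (\<kappa> - 1) - (u - v) * (u - v) powr (\<kappa> - 1) = \<phi> v"
      by (simp add: \<phi>_def algebra_simps)
    finally show ?thesis .
  qed
  have mono: "\<phi> v \<le> \<phi> w" if "0 \<le> v" "v \<le> w" "w < u" for v w
    unfolding \<phi>_def
  proof (intro mult_mono)
    show "(u - v) powr (\<kappa> - 1) \<le> (u - w) powr (\<kappa> - 1)"
      using that \<kappa> by (intro powr_mono2') auto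
  qed (use that in auto)
  have phi_le: "\<phi> v \<le> u" if "0 \<le> v" "v \<le> u - 1" for v
  proof -
    have "(u - v) powr (\<kappa> - 1) \<le> (u - v) powr 0" using that \<kappa> by (intro powr_mono) auto
    hence "\<phi> v \<le> u * 1" unfolding \<phi>_def using that u by (intro mult_mono) auto
    thus ?thesis by simp
  qed
  have ln_mono: "ln (real n) \<le> ln (real m)" if "1 \<le> n" "n \<le> m" for n m :: nat
    using that by simp
  \<comment> \<open>A right-endpoint Riemann sum of an increasing function: as the steps have length
    at most 1, the excess over the integral is at most the increment of \<phi>, which
    telescopes.\<close>
  have riemann_step: "(ln (real (Suc n)) - ln (real n)) * \<phi> (ln (real (Suc n))) \<le>
       (\<Phi> (ln (real (Suc n))) - \<Phi> (ln (real n))) + (\<phi> (ln (real (Suc n))) - \<phi> (ln (real n)))"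
    if n: "1 \<le> n" "Suc n \<le> N" for n
  proof -
    define a b where "a = ln (real n)" and "b = ln (real (Suc n))"
    have ab: "0 \<le> a" "a < b" using n by (auto simp: a_def b_def)
    have bu: "b < u" using ln_mono[of "Suc n" N] n N unfolding b_def by linarith
    have "ln (1 + 1 / real n) \<le> 1 / real n" by (rule ln_add_one_self_le_self) simp
    moreover have "1 + 1 / real n = real (Suc n) / real n" using n by (simp add: field_simps)
    ultimately have "b - a \<le> 1 / real n" using n by (simp add: a_def b_def ln_div)
    also have "\<dots> \<le> 1" using n by simp
    finally have ba: "b - a \<le> 1" .
    have "\<exists>z. a < z \<and> z < b \<and> \<Phi> b - \<Phi> a = (b - a) * \<phi> z"
      by (rule MVT2[OF ab(2)]) (use deriv bu in auto)
    then obtain z where z: "a < z" "z < b" "\<Phi> b - \<Phi> a = (b - a) * \<phi> z" by blast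
    have "(b - a) * \<phi> a \<le> \<Phi> b - \<Phi> a"
      unfolding z(3) using z ab bu by (intro mult_left_mono mono) auto
    moreover have "(b - a) * (\<phi> b - \<phi> a) \<le> 1 * (\<phi> b - \<phi> a)"
      using ba mono[of a b] ab bu by (intro mult_right_mono) auto
    ultimately have "(b - a) * \<phi> a + (b - a) * (\<phi> b - \<phi> a) \<le> (\<Phi> b - \<Phi> a) + 1 * (\<phi> b - \<phi> a)"
      by (rule add_mono)
    also have "(b - a) * \<phi> a + (b - a) * (\<phi> b - \<phi> a) = (b - a) * \<phi> b" by (simp add: algebra_simps)
    finally show ?thesis by (simp add: a_def b_def)
  qed
  have riemann: "(\<Sum>n\<in>{1..M}. (ln (real n) - ln (real (n - 1))) * \<phi> (ln (real n))) \<le>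
        \<Phi> (ln (real M)) - \<Phi> 0 + \<phi> (ln (real M))" if "1 \<le> M" "M \<le> N" for M
    using that
  proof (induction M rule: dec_induct)
    case (step M)
    thus ?case using riemann_step[of M] by simp
  qed (simp add: \<phi>_def)
  \<comment> \<open>Partial summation evaluates the weight at N + 1; the cap at N keeps the argument
    at most u - 1, where \<phi> \<le> u.\<close>
  define w where "w = (\<lambda>n. \<phi> (ln (real (min n N))))"
  \<comment> \<open>Mertens' estimate bounds the partial sums of \<open>mangoldt n / n\<close> minus
    the increments of ln by 9, which costs 2 * 9 * u; the Riemann sum adds one more u, giving
    19.\<close>
  have abel: "\<bar>\<Sum>n\<in>{1..N}. (mangoldt n / real n - (ln (real n) - ln (real (n - 1)))) * w n\<bar> \<le> 9 * w 1 + 2 * 9 * w (Suc N)"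
  proof (rule sum_mult_increasing_le)
    have tele: "(\<Sum>k\<in>{1..n}. mangoldt k / real k - (ln (real k) - ln (real (k - 1)))) =
        (\<Sum>k\<in>{1..n}. mangoldt k / real k) - ln (real n)" for n
      by (induction n) auto
    have ps: "\<bar>\<Sum>k\<in>{1..n}. mangoldt k / real k - (ln (real k) - ln (real (k - 1)))\<bar> \<le> 9" for n
      unfolding tele using mertens[of "real n", unfolded nats_upto_of_nat] by (cases "n = 0") auto
    show "\<bar>\<Sum>k\<in>{1..n}. mangoldt k / real k - (ln (real k) - ln (real (k - 1)))\<bar> \<le> 9" for n
      by (rule ps)
    show "\<bar>\<Sum>k\<in>{1..n}. mangoldt k / real k - (ln (real k) - ln (real (k - 1)))\<bar> \<le> 9" if "1 \<le> n" for n
      by (rule ps)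
    show "w n \<le> w (Suc n)" if "1 \<le> n" for n
    proof -
      have "ln (real (min (Suc n) N)) \<le> ln (real N)" by (rule ln_mono) (use N in auto)
      hence "ln (real (min (Suc n) N)) < u" using N by linarith
      thus ?thesis unfolding w_def using that N by (intro mono) auto
    qed
  qed (use N in \<open>auto simp: w_def \<phi>_def\<close>)
  have "(\<Sum>n\<in>{1..N}. mangoldt n / real n * (ln (real n) * (u - ln (real n)) powr (\<kappa> - 1))) =
        (\<Sum>n\<in>{1..N}. (mangoldt n / real n - (ln (real n) - ln (real (n - 1)))) * w n) +
        (\<Sum>n\<in>{1..N}. (ln (real n) - ln (real (n - 1))) * \<phi> (ln (real n)))"
    unfolding sum.distrib[symmetric] by (intro sum.cong refl) (auto simp: w_def \<phi>_def algebra_simps)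
  also have "\<dots> \<le> (9 * w 1 + 2 * 9 * w (Suc N)) + (\<Phi> (ln (real N)) - \<Phi> 0 + \<phi> (ln (real N)))"
    using abel riemann[of N] N by (intro add_mono) auto
  also have "w 1 = 0" using N by (simp add: w_def \<phi>_def)
  also have "w (Suc N) = \<phi> (ln (real N))" by (simp add: w_def)
  also have "9 * 0 + 2 * 9 * \<phi> (ln (real N)) + (\<Phi> (ln (real N)) - \<Phi> 0 + \<phi> (ln (real N))) =
       \<Phi> (ln (real N)) - \<Phi> 0 + 19 * \<phi> (ln (real N))" by simp
  also have "\<Phi> (ln (real N)) \<le> 0"
  proof -
    define v where "v = u - ln (real N)"
    have v: "0 < v" "v \<le> u" using N lnN by (auto simp: v_def)
    have "v powr (\<kappa> + 1) / (\<kappa> + 1) \<le> u * v powr \<kappa> / \<kappa>"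
    proof (rule frac_le)
      have "v powr (\<kappa> + 1) = v powr \<kappa> * v" using v by (simp add: powr_add)
      also have "\<dots> \<le> v powr \<kappa> * u" using v by (intro mult_left_mono) auto
      finally show "v powr (\<kappa> + 1) \<le> u * v powr \<kappa>" by (simp add: mult.commute)
    qed (use \<kappa> u in auto)
    thus ?thesis by (simp add: \<Phi>_def v_def)
  qed
  also have "0 - \<Phi> 0 = u powr (1 + \<kappa>) / (\<kappa> * (\<kappa> + 1))"
  proof -
    have "u * u powr \<kappa> = u powr (1 + \<kappa>)" using u by (simp add: powr_add)
    thus ?thesis using \<kappa> by (simp add: \<Phi>_def field_simps)
  qed
  also have "\<phi> (ln (real N)) \<le> u" using lnN N by (intro phi_le) auto
  finally show ?thesis by simp
qed

section \<open>Selberg's formula restricted to the class\<close>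

context balanced_primes
begin

lemma f_mult: "f (m * n) = f m * f n"
  by (auto simp: f_def gen_mult_iff)

lemma psi_P_eq: "psi_P x = (\<Sum>n\<in>nats_upto x. f n * mangoldt n)"
  by (simp add: psi_P_def f_def)

lemma f_mangoldt_le: "f n * mangoldt n \<le> mangoldt n"
  using mult_right_mono[OF f_bounds(2)[of n] mangoldt_nonneg[of n]] by simp

lemma psi_P_le: "psi_P x \<le> psi x"
  unfolding psi_P_eq psi_def by (intro sum_mono f_mangoldt_le)

text \<open>f ln is the convolution of f and f \<open>mangoldt\<close>, because ln is the divisor
  sum of \<open>mangoldt\<close> and f is completely multiplicative; g is an arbitrary test
  function.\<close>

lemma sum_f_ln_mult:
  fixes g :: "nat \<Rightarrow> real"
  shows "(\<Sum>n\<in>nats_upto x. f n * ln (real n) * g n) =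
         (\<Sum>d\<in>nats_upto x. \<Sum>m\<in>nats_upto (x / real d). f d * mangoldt d * f m * g (d * m))"
proof -
  have "(\<Sum>n\<in>nats_upto x. f n * ln (real n) * g n) =
        (\<Sum>n\<in>nats_upto x. \<Sum>d | d dvd n. f d * mangoldt d * f (n div d) * g (d * (n div d)))"
  proof (intro sum.cong refl)
    fix n assume "n \<in> nats_upto x"
    hence n: "n \<noteq> 0" by (simp add: mem_nats_upto)
    have "f n * ln (real n) * g n = (\<Sum>d | d dvd n. f n * g n * mangoldt d)"
      using mangoldt_sum[OF n, where ?'a = real] by (simp flip: sum_distrib_left)
    also have "\<dots> = (\<Sum>d | d dvd n. f d * mangoldt d * f (n div d) * g (d * (n div d)))"
    proof (intro sum.cong refl)
      fix d assume "d \<in> {d. d dvd n}"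
      hence "n = d * (n div d)" by simp
      hence "f n = f d * f (n div d)" "g n = g (d * (n div d))" using f_mult by metis+
      thus "f n * g n * mangoldt d = f d * mangoldt d * f (n div d) * g (d * (n div d))" by simp
    qed
    finally show "f n * ln (real n) * g n = (\<Sum>d | d dvd n. f d * mangoldt d * f (n div d) * g (d * (n div d)))" .
  qed
  also have "\<dots> = (\<Sum>d\<in>nats_upto x. \<Sum>m\<in>nats_upto (x / real d). f d * mangoldt d * f m * g (d * m))"
    by (rule sum_nats_upto_divisors)
  finally show ?thesis .
qed

lemma sum_f_ln: "(\<Sum>n\<in>nats_upto x. f n * ln (real n)) = (\<Sum>m\<in>nats_upto x. f m * psi_P (x / real m))"
proof -
  have "(\<Sum>n\<in>nats_upto x. f n * ln (real n)) =
        (\<Sum>d\<in>nats_upto x. \<Sum>m\<in>nats_upto (x / real d). f m * (f d * mangoldt d))"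
    using sum_f_ln_mult[where g = "\<lambda>_. 1"] by (simp add: mult_ac)
  also have "\<dots> = (\<Sum>m\<in>nats_upto x. \<Sum>d\<in>nats_upto (x / real m). f m * (f d * mangoldt d))"
    by (rule sum_nats_upto_swap)
  finally show ?thesis by (simp add: psi_P_eq sum_distrib_left)
qed

text \<open>The summatory function of L_f log + L_f * L_f, with the convolution grouped by one
  factor.\<close>

definition selberg_sum :: "real \<Rightarrow> real" where
  "selberg_sum y = (\<Sum>d\<in>nats_upto y. f d * mangoldt d * (ln (real d) + psi_P (y / real d)))"

text \<open>One factor ln n is opened into a divisor sum and the other is split as ln d + ln m; the
  ln m part is evaluated by \<open>sum_f_ln\<close> once more.\<close>

lemma sum_f_ln_squared:
  "(\<Sum>n\<in>nats_upto x. f n * ln (real n) ^ 2) = (\<Sum>m\<in>nats_upto x. f m * selberg_sum (x / real m))"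
proof -
  have "(\<Sum>n\<in>nats_upto x. f n * ln (real n) ^ 2) = (\<Sum>n\<in>nats_upto x. f n * ln (real n) * ln (real n))"
    by (simp add: power2_eq_square mult.assoc)
  also have "\<dots> =
        (\<Sum>d\<in>nats_upto x. \<Sum>m\<in>nats_upto (x / real d). f d * mangoldt d * f m * ln (real (d * m)))"
    by (rule sum_f_ln_mult)
  also have "\<dots> = (\<Sum>d\<in>nats_upto x. \<Sum>m\<in>nats_upto (x / real d). f d * mangoldt d * f m * ln (real d)) +
        (\<Sum>d\<in>nats_upto x. f d * mangoldt d * (\<Sum>m\<in>nats_upto (x / real d). f m * ln (real m)))"
    unfolding sum.distrib[symmetric] sum_distrib_left
    by (intro sum.cong refl) (auto simp: mem_nats_upto ln_mult algebra_simps)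
  also have "(\<Sum>d\<in>nats_upto x. \<Sum>m\<in>nats_upto (x / real d). f d * mangoldt d * f m * ln (real d)) =
        (\<Sum>m\<in>nats_upto x. \<Sum>d\<in>nats_upto (x / real m). f d * mangoldt d * f m * ln (real d))"
    by (rule sum_nats_upto_swap)
  also have "(\<Sum>d\<in>nats_upto x. f d * mangoldt d * (\<Sum>m\<in>nats_upto (x / real d). f m * ln (real m))) =
        (\<Sum>d\<in>nats_upto x. \<Sum>m\<in>nats_upto (x / real d). f d * mangoldt d * (f m * psi_P (x / real m / real d)))"
    by (simp add: sum_f_ln sum_distrib_left mult.commute)
  also have "\<dots> = (\<Sum>m\<in>nats_upto x. \<Sum>d\<in>nats_upto (x / real m). f d * mangoldt d * (f m * psi_P (x / real m / real d)))"
    by (rule sum_nats_upto_swap)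
  finally show ?thesis
    unfolding selberg_sum_def sum_distrib_left sum.distrib[symmetric] by (simp add: algebra_simps)
qed

definition psi_log :: "real \<Rightarrow> real" where
  "psi_log y = (\<Sum>d\<in>nats_upto y. mangoldt d * ln (real d))"

lemma psi_log_bounds:
  assumes "y \<ge> 1"
  shows "psi_log y \<le> psi y * ln y" "psi y * ln y \<le> psi_log y + 16 * y"
proof -
  have eq: "psi y * ln y = psi_log y + (\<Sum>d\<in>nats_upto y. mangoldt d * ln (y / real d))"
  proof -
    have "(\<Sum>d\<in>nats_upto y. mangoldt d * ln (y / real d)) = (\<Sum>d\<in>nats_upto y. mangoldt d * ln y - mangoldt d * ln (real d))"
      by (intro sum.cong refl) (use assms in \<open>auto simp: mem_nats_upto ln_div right_diff_distrib\<close>)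
    thus ?thesis by (simp add: psi_log_def psi_def sum_subtractf sum_distrib_right)
  qed
  have "(\<Sum>d\<in>nats_upto y. mangoldt d * ln (y / real d)) \<ge> 0"
    by (intro sum_nonneg mult_nonneg_nonneg mangoldt_nonneg) (auto simp: mem_nats_upto field_simps)
  thus "psi_log y \<le> psi y * ln y" using eq by simp
  show "psi y * ln y \<le> psi_log y + 16 * y"
    using eq sum_mangoldt_ln_quotient_le[of y] assms by simp
qed

text \<open>Replacing \<open>psi_P\<close> by \<kappa> psi gives \<kappa> \<open>psi_log\<close> in
  the logarithmic part and, in both factors of the convolution, \<kappa>^2 times Selberg's
  convolution sum, at most \<kappa>^2 (2 y ln y - \<open>psi_log y\<close>) + O(y). The remaining
  \<open>psi_log\<close> is kept unevaluated and later reproduces the count.\<close>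

lemma selberg_sum_upper:
  assumes e: "e > 0"
  obtains C where "C \<ge> 0"
    "\<And>y. y \<ge> 1 \<Longrightarrow> selberg_sum y \<le> (2 * \<kappa>\<^sup>2 + e) * y * ln y + (\<kappa> - \<kappa>\<^sup>2) * psi_log y + C * y"
proof -
  \<comment> \<open>The error d y ln y arises three times: in the logarithmic part and for each
    factor of the convolution.\<close>
  define d where "d = e / 3"
  have d: "d > 0" using e by (simp add: d_def)
  obtain C1 where C1: "C1 \<ge> 0" "\<And>x. x \<ge> 1 \<Longrightarrow>
    psi x * ln x + (\<Sum>n\<in>nats_upto x. mangoldt n * psi (x / real n)) \<le> 2 * x * ln x + C1 * x"
    using selberg_upper by blast
  obtain C2 where C2: "C2 \<ge> 0" "\<And>x. x \<ge> 0 \<Longrightarrow> \<bar>psi_P x - \<kappa> * psi x\<bar> \<le> d * x + C2"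
    using psi_P_asymp[OF d] by blast
  define C where "C = 16 + C2 + C1 + 18 * d + 16 * C2"
  have "selberg_sum y \<le> (2 * \<kappa>\<^sup>2 + e) * y * ln y + (\<kappa> - \<kappa>\<^sup>2) * psi_log y + C * y" if y: "y \<ge> 1" for y
  proof -
    have lny: "0 \<le> ln y" "ln y \<le> y" using y ln_le_minus_one[of y] by auto
    have psiP: "psi_P z \<le> \<kappa> * psi z + d * z + C2" if "z \<ge> 0" for z
      using C2(2)[OF that] by (simp add: abs_le_iff)
    define M where "M = (\<Sum>n\<in>nats_upto y. mangoldt n / real n)"
    have M: "M \<le> ln y + 9" using mertens[OF y] by (simp add: M_def abs_le_iff)
    define Q where "Q = (\<Sum>n\<in>nats_upto y. mangoldt n * psi (y / real n))"
    have Vf: "(\<Sum>n\<in>nats_upto y. f n * mangoldt n * ln (real n)) \<le> psi_P y * ln y"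
      unfolding psi_P_eq sum_distrib_right
      by (intro sum_mono mult_left_mono mult_nonneg_nonneg f_bounds mangoldt_nonneg)
         (auto simp: mem_nats_upto)
    also have "\<dots> \<le> (\<kappa> * psi y + d * y + C2) * ln y"
      using y lny by (intro mult_right_mono psiP) auto
    also have "\<dots> = \<kappa> * (psi y * ln y) + d * y * ln y + C2 * ln y" by (simp add: algebra_simps)
    also have "\<dots> \<le> \<kappa> * (psi_log y + 16 * y) + d * y * ln y + C2 * y"
      using psi_log_bounds(2)[OF y] \<kappa> C2(1) lny d y by (intro add_mono mult_left_mono) auto
    also have "\<dots> \<le> \<kappa> * psi_log y + 16 * y + d * y * ln y + C2 * y"
      using mult_right_mono[of \<kappa> 1 "16 * y"] \<kappa> y by (simp add: algebra_simps)
    finally have 1: "(\<Sum>n\<in>nats_upto y. f n * mangoldt n * ln (real n)) \<le> \<kappa> * psi_log y + 16 * y + d * y * ln y + C2 * y" .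
    \<comment> \<open>By the symmetry of the convolution, the approximation of \<open>psi_P\<close>
      can be applied a second time, to the other factor.\<close>
    have swap: "(\<Sum>n\<in>nats_upto y. f n * mangoldt n * psi (y / real n)) = (\<Sum>n\<in>nats_upto y. mangoldt n * psi_P (y / real n))"
    proof -
      have "(\<Sum>n\<in>nats_upto y. f n * mangoldt n * psi (y / real n)) =
        (\<Sum>n\<in>nats_upto y. \<Sum>m\<in>nats_upto (y / real n). f n * mangoldt n * mangoldt m)"
        by (simp add: psi_def sum_distrib_left)
      also have "\<dots> = (\<Sum>m\<in>nats_upto y. \<Sum>n\<in>nats_upto (y / real m). f n * mangoldt n * mangoldt m)"
        by (rule sum_nats_upto_swap)
      finally show ?thesis by (simp add: psi_P_eq sum_distrib_left mult.commute)
    qed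
    have err: "(\<Sum>n\<in>nats_upto y. g n * (\<kappa> * psi (y / real n) + d * (y / real n) + C2)) \<le>
        \<kappa> * (\<Sum>n\<in>nats_upto y. g n * psi (y / real n)) + (d * y * ln y + 9 * d * y + 8 * C2 * y)"
      if g: "\<And>n. 0 \<le> g n" "\<And>n. g n \<le> mangoldt n" for g
    proof -
      have "(\<Sum>n\<in>nats_upto y. g n * (\<kappa> * psi (y / real n) + d * (y / real n) + C2)) =
        \<kappa> * (\<Sum>n\<in>nats_upto y. g n * psi (y / real n)) +
          (d * y * (\<Sum>n\<in>nats_upto y. g n / real n) + C2 * (\<Sum>n\<in>nats_upto y. g n))"
        by (simp add: algebra_simps sum.distrib sum_distrib_left)
      also have "d * y * (\<Sum>n\<in>nats_upto y. g n / real n) \<le> d * y * (ln y + 9)"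
      proof (intro mult_left_mono)
        show "(\<Sum>n\<in>nats_upto y. g n / real n) \<le> ln y + 9"
          by (rule order_trans[OF _ M]) (auto simp: M_def intro!: sum_mono divide_right_mono g)
      qed (use d y in auto)
      also have "C2 * (\<Sum>n\<in>nats_upto y. g n) \<le> C2 * (8 * y)"
      proof (intro mult_left_mono)
        show "(\<Sum>n\<in>nats_upto y. g n) \<le> 8 * y"
          by (rule order_trans[OF _ psi_bound]) (use y in \<open>auto simp: psi_def intro!: sum_mono g\<close>)
      qed (use C2 in auto)
      finally show ?thesis by (simp add: algebra_simps)
    qed
    have "(\<Sum>n\<in>nats_upto y. f n * mangoldt n * psi_P (y / real n)) \<le>
        (\<Sum>n\<in>nats_upto y. f n * mangoldt n * (\<kappa> * psi (y / real n) + d * (y / real n) + C2))"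
      using y by (intro sum_mono mult_left_mono psiP mult_nonneg_nonneg f_bounds mangoldt_nonneg) auto
    also have "\<dots> \<le> \<kappa> * (\<Sum>n\<in>nats_upto y. f n * mangoldt n * psi (y / real n)) + (d * y * ln y + 9 * d * y + 8 * C2 * y)"
      by (rule err) (auto intro!: mult_nonneg_nonneg f_bounds mangoldt_nonneg f_mangoldt_le)
    also have "(\<Sum>n\<in>nats_upto y. f n * mangoldt n * psi (y / real n)) \<le>
        (\<Sum>n\<in>nats_upto y. mangoldt n * (\<kappa> * psi (y / real n) + d * (y / real n) + C2))"
      unfolding swap using y by (intro sum_mono mult_left_mono psiP mangoldt_nonneg) auto
    also have "\<dots> \<le> \<kappa> * Q + (d * y * ln y + 9 * d * y + 8 * C2 * y)"
      unfolding Q_def by (rule err) (auto intro!: mangoldt_nonneg)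
    finally have "(\<Sum>n\<in>nats_upto y. f n * mangoldt n * psi_P (y / real n)) \<le>
        \<kappa> * (\<kappa> * Q + (d * y * ln y + 9 * d * y + 8 * C2 * y)) + (d * y * ln y + 9 * d * y + 8 * C2 * y)"
      using \<kappa> by simp
    also have "\<dots> \<le> \<kappa>\<^sup>2 * Q + 2 * (d * y * ln y + 9 * d * y + 8 * C2 * y)"
    proof -
      define X where "X = d * y * ln y + 9 * d * y + 8 * C2 * y"
      have "X \<ge> 0" using d y lny C2(1) unfolding X_def by (intro add_nonneg_nonneg mult_nonneg_nonneg) auto
      hence "\<kappa> * X \<le> 1 * X" using \<kappa> by (intro mult_right_mono) auto
      thus ?thesis unfolding X_def[symmetric] by (simp add: algebra_simps power2_eq_square)
    qed
    also have "\<kappa>\<^sup>2 * Q \<le> \<kappa>\<^sup>2 * (2 * y * ln y + C1 * y - psi_log y)"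
      using C1(2)[OF y] psi_log_bounds(1)[OF y] unfolding Q_def by (intro mult_left_mono) auto
    also have "\<dots> \<le> \<kappa>\<^sup>2 * (2 * y * ln y) + C1 * y - \<kappa>\<^sup>2 * psi_log y"
    proof -
      have "\<kappa>\<^sup>2 \<le> 1" using \<kappa> by (simp add: power_le_one)
      hence "\<kappa>\<^sup>2 * (C1 * y) \<le> 1 * (C1 * y)" using C1(1) y by (intro mult_right_mono) auto
      thus ?thesis by (simp add: algebra_simps)
    qed
    finally have 2: "(\<Sum>n\<in>nats_upto y. f n * mangoldt n * psi_P (y / real n)) \<le>
        \<kappa>\<^sup>2 * (2 * y * ln y) + C1 * y - \<kappa>\<^sup>2 * psi_log y + 2 * (d * y * ln y + 9 * d * y + 8 * C2 * y)" by simp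
    have "selberg_sum y = (\<Sum>n\<in>nats_upto y. f n * mangoldt n * ln (real n)) + (\<Sum>n\<in>nats_upto y. f n * mangoldt n * psi_P (y / real n))"
      by (simp add: selberg_sum_def ring_distribs sum.distrib)
    also have "\<dots> \<le> (\<kappa> * psi_log y + 16 * y + d * y * ln y + C2 * y) +
      (\<kappa>\<^sup>2 * (2 * y * ln y) + C1 * y - \<kappa>\<^sup>2 * psi_log y + 2 * (d * y * ln y + 9 * d * y + 8 * C2 * y))"
      by (intro add_mono 1 2)
    also have "\<dots> = (2 * \<kappa>\<^sup>2 + e) * y * ln y + (\<kappa> - \<kappa>\<^sup>2) * psi_log y + C * y"
      by (simp add: C_def d_def algebra_simps)
    finally show ?thesis .
  qed
  moreover have "C \<ge> 0" using C1(1) C2(1) d by (simp add: C_def)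
  ultimately show ?thesis using that by blast
qed

section \<open>The pointwise count and its contraction\<close>

definition gen_count :: "real \<Rightarrow> real" where "gen_count x = (\<Sum>n\<in>nats_upto x. f n)"

definition gen_density :: "real \<Rightarrow> real" where "gen_density x = gen_count x * ln x powr (1 - \<kappa>) / x"

lemma gen_count_nonneg: "gen_count x \<ge> 0"
  unfolding gen_count_def by (intro sum_nonneg f_bounds)

lemma gen_count_le: "x \<ge> 0 \<Longrightarrow> gen_count x \<le> x"
proof -
  assume "x \<ge> 0"
  have "gen_count x \<le> (\<Sum>n\<in>nats_upto x. 1)" unfolding gen_count_def by (intro sum_mono f_bounds)
  also have "\<dots> \<le> x" using card_nats_upto_bounds(1)[OF \<open>x \<ge> 0\<close>] by simp
  finally show ?thesis .
qed

lemma gen_count_conv_density: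
  assumes "x > 1"
  shows "gen_count x = gen_density x * x * ln x powr (\<kappa> - 1)"
proof -
  have "ln x powr (1 - \<kappa>) * ln x powr (\<kappa> - 1) = 1"
    using assms by (subst powr_add[symmetric]) simp
  thus ?thesis using assms by (simp add: gen_density_def)
qed

text \<open>The starting point of the contraction, which can improve only a finite bound. Here f ln
  suffices: Chebyshev's bound for \<open>psi_P\<close> reduces the sum of f n ln n to
  \<open>log_sum\<close>, and replacing ln n by ln x costs 2 x.\<close>

lemma gen_density_bounded: obtains B where "B \<ge> 0" "\<And>x. x \<ge> exp 1 \<Longrightarrow> gen_density x \<le> B"
proof -
  obtain K where K: "K \<ge> 0" "\<And>x. x \<ge> exp 1 \<Longrightarrow> log_sum x \<le> K * ln x powr \<kappa>" using log_sum_upper by blast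
  have "gen_density x \<le> 8 * K + 2" if x: "x \<ge> exp 1" for x
  proof -
    have x1: "x > 1" using x one_less_exp_iff[of "1::real"] by linarith
    have u: "ln x \<ge> 1" using x x1 by (subst ln_ge_iff) auto
    have "gen_count x * ln x = (\<Sum>n\<in>nats_upto x. f n * ln (real n)) + (\<Sum>n\<in>nats_upto x. f n * ln (x / real n))"
    proof -
      have "f n * ln x = f n * ln (real n) + f n * ln (x / real n)" if "n \<in> nats_upto x" for n
        using that x1 by (simp add: mem_nats_upto ln_div algebra_simps)
      thus ?thesis unfolding gen_count_def sum_distrib_right sum.distrib[symmetric] by (intro sum.cong refl)
    qed
    also have "(\<Sum>n\<in>nats_upto x. f n * ln (real n)) \<le> (\<Sum>m\<in>nats_upto x. f m * (8 * (x / real m)))"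
      unfolding sum_f_ln
    proof (intro sum_mono mult_left_mono f_bounds)
      fix m
      show "psi_P (x / real m) \<le> 8 * (x / real m)"
        using psi_P_le[of "x / real m"] psi_bound[of "x / real m"] x1 by simp
    qed
    also have "\<dots> = 8 * x * log_sum x" by (simp add: log_sum_def sum_distrib_left mult_ac)
    also have "(\<Sum>n\<in>nats_upto x. f n * ln (x / real n)) \<le> (\<Sum>n\<in>nats_upto x. 1 * ln (x / real n))"
      by (intro sum_mono mult_right_mono f_bounds) (auto simp: mem_nats_upto field_simps)
    also have "\<dots> \<le> 2 * x" using sum_ln_quotient_le[of x] x1 by simp
    also have "8 * x * log_sum x \<le> 8 * x * (K * ln x powr \<kappa>)" using x x1 by (intro mult_left_mono K) auto
    also have "2 * x \<le> 2 * x * ln x powr \<kappa>"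
      using x1 u \<kappa> ge_one_powr_ge_zero[of "ln x" \<kappa>] by (simp add: mult_left_mono)
    finally have *: "gen_count x * ln x \<le> (8 * K + 2) * x * ln x powr \<kappa>" by (simp add: algebra_simps)
    have "gen_density x * x * ln x powr \<kappa> = gen_count x * ln x"
    proof -
      have "ln x powr (1 - \<kappa>) * ln x powr \<kappa> = ln x"
        using u by (subst powr_add[symmetric]) simp
      thus ?thesis using x1 by (simp add: gen_density_def)
    qed
    with * have "gen_density x * (x * ln x powr \<kappa>) \<le> (8 * K + 2) * (x * ln x powr \<kappa>)" by (simp add: mult.assoc)
    moreover have "x * ln x powr \<kappa> > 0" using x1 u by simp
    ultimately show ?thesis by (rule mult_right_le_imp_le)
  qed
  thus ?thesis using that[of "8 * K + 2"] K(1) by auto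
qed

text \<open>For d \<le> x / y0 the argument x / d is at least y0 and the assumed density bound b
  applies. For larger d the trivial bound x / d is used, and two applications of Mertens' estimate
  give ln y0 + 18.\<close>

lemma sum_mangoldt_ln_gen_count_upper:
  assumes b: "b \<ge> 0" and y0: "y0 \<ge> exp 1" and db: "\<And>y. y \<ge> y0 \<Longrightarrow> gen_density y \<le> b" and x: "x \<ge> y0"
  shows "(\<Sum>d\<in>nats_upto x. mangoldt d * ln (real d) * gen_count (x / real d)) \<le>
     b * x * (ln x powr (1 + \<kappa>) / (\<kappa> * (\<kappa> + 1)) + 19 * ln x) + x * ln x * (ln y0 + 18)"
proof -
  define u where "u = ln x"
  have y1: "y0 > 1" using y0 one_less_exp_iff[of "1::real"] by linarith
  have lny0: "ln y0 \<ge> 1" using y0 y1 by (subst ln_ge_iff) auto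
  have x1: "x > 1" using x y1 by linarith
  have u0: "u > 0" using x1 by (simp add: u_def)
  \<comment> \<open>Since y0 \<ge> e, the cut at z also guarantees ln N \<le> u - 1, which keeps the
    kernel away from its singularity at u.\<close>
  define z where "z = x / y0"
  have z: "z \<ge> 1" "z \<le> x" using x y1 by (auto simp: z_def field_simps)
  define N where "N = nat \<lfloor>z\<rfloor>"
  have N: "N \<ge> 1" "real N \<le> z" using z unfolding N_def by linarith+
  have sub: "nats_upto z \<subseteq> nats_upto x" by (rule nats_upto_mono[OF z(2)])
  have large: "(\<Sum>d\<in>nats_upto x - nats_upto z. mangoldt d * ln (real d) * gen_count (x / real d)) \<le> x * u * (ln y0 + 18)"
  proof -
    have "(\<Sum>d\<in>nats_upto x - nats_upto z. mangoldt d * ln (real d) * gen_count (x / real d)) \<le>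
          (\<Sum>d\<in>nats_upto x - nats_upto z. mangoldt d * u * (x / real d))"
      using x1 by (intro sum_mono mult_mono gen_count_le gen_count_nonneg mult_left_mono mangoldt_nonneg mult_nonneg_nonneg)
        (auto simp: mem_nats_upto u_def)
    also have "\<dots> = x * u * (\<Sum>d\<in>nats_upto x - nats_upto z. mangoldt d / real d)"
      by (simp add: sum_distrib_left mult_ac)
    also have "(\<Sum>d\<in>nats_upto x - nats_upto z. mangoldt d / real d) =
        (\<Sum>d\<in>nats_upto x. mangoldt d / real d) - (\<Sum>d\<in>nats_upto z. mangoldt d / real d)"
      by (intro sum_diff sub) auto
    also have "\<dots> \<le> (ln x + 9) - (ln z - 9)"
      using mertens[of x] mertens[OF z(1)] x1 by (intro diff_mono) (auto simp: abs_le_iff)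
    also have "ln z = ln x - ln y0" using x1 y1 by (simp add: z_def ln_div)
    finally show ?thesis using x1 u0 by (simp add: mult_left_mono add.commute)
  qed
  have small: "(\<Sum>d\<in>nats_upto z. mangoldt d * ln (real d) * gen_count (x / real d)) \<le>
      b * x * (u powr (1 + \<kappa>) / (\<kappa> * (\<kappa> + 1)) + 19 * u)"
  proof -
    have "(\<Sum>d\<in>nats_upto z. mangoldt d * ln (real d) * gen_count (x / real d)) \<le>
          (\<Sum>d\<in>nats_upto z. mangoldt d * ln (real d) * (b * (x / real d) * (u - ln (real d)) powr (\<kappa> - 1)))"
    proof (intro sum_mono mult_left_mono mult_nonneg_nonneg mangoldt_nonneg)
      fix d assume d: "d \<in> nats_upto z"
      hence d0: "d > 0" "real d \<le> x / y0" by (auto simp: mem_nats_upto z_def)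
      have y: "x / real d \<ge> y0" using d0 y1 by (simp add: field_simps)
      have "gen_count (x / real d) = gen_density (x / real d) * (x / real d) * ln (x / real d) powr (\<kappa> - 1)"
        using y y1 by (intro gen_count_conv_density) auto
      also have "\<dots> \<le> b * (x / real d) * ln (x / real d) powr (\<kappa> - 1)"
        using x1 by (intro mult_right_mono db y) auto
      also have "ln (x / real d) = u - ln (real d)" using d0 x1 by (simp add: u_def ln_div)
      finally show "gen_count (x / real d) \<le> b * (x / real d) * (u - ln (real d)) powr (\<kappa> - 1)" .
      show "0 \<le> ln (real d)" using d0 by simp
    qed
    also have "\<dots> = b * x * (\<Sum>n\<in>{1..N}. mangoldt n / real n * (ln (real n) * (u - ln (real n)) powr (\<kappa> - 1)))"
      unfolding nats_upto_altdef N_def[symmetric] by (simp add: sum_distrib_left mult_ac)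
    also have "\<dots> \<le> b * x * (u powr (1 + \<kappa>) / (\<kappa> * (\<kappa> + 1)) + 19 * u)"
    proof (intro mult_left_mono sum_mangoldt_kernel_le \<kappa> N)
      have "ln (real N) \<le> ln z" using N by (subst ln_le_cancel_iff) auto
      also have "ln z = ln x - ln y0" using x1 y1 by (simp add: z_def ln_div)
      finally show "ln (real N) \<le> u - 1" using lny0 by (simp add: u_def)
    qed (use b x1 in auto)
    finally show ?thesis .
  qed
  have "(\<Sum>d\<in>nats_upto x. mangoldt d * ln (real d) * gen_count (x / real d)) =
      (\<Sum>d\<in>nats_upto x - nats_upto z. mangoldt d * ln (real d) * gen_count (x / real d)) +
      (\<Sum>d\<in>nats_upto z. mangoldt d * ln (real d) * gen_count (x / real d))"
    by (intro sum.subset_diff sub) auto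
  thus ?thesis using large small unfolding u_def by linarith
qed

text \<open>ln^2 x - ln^2 n is at most 2 ln x ln (x / n), and the sum of ln (x / n) is at most 2
  x.\<close>

lemma gen_count_ln_squared_le:
  assumes x: "x \<ge> 1"
  shows "gen_count x * ln x ^ 2 \<le> (\<Sum>m\<in>nats_upto x. f m * selberg_sum (x / real m)) + 4 * x * ln x"
proof -
  have "gen_count x * ln x ^ 2 = (\<Sum>n\<in>nats_upto x. f n * ln x ^ 2)" by (simp add: gen_count_def sum_distrib_right)
  also have "\<dots> \<le> (\<Sum>n\<in>nats_upto x. f n * ln (real n) ^ 2 + 2 * ln x * ln (x / real n))"
  proof (intro sum_mono)
    fix n assume n: "n \<in> nats_upto x"
    hence n0: "0 < n" "real n \<le> x" by (auto simp: mem_nats_upto)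
    define a b where "a = ln (real n)" and "b = ln x"
    have ab: "0 \<le> a" "a \<le> b" using n0 x by (auto simp: a_def b_def)
    have "f n * (b\<^sup>2 - a\<^sup>2) \<le> 1 * (b\<^sup>2 - a\<^sup>2)"
      using ab by (intro mult_right_mono f_bounds) (auto intro: power_mono)
    also have "1 * (b\<^sup>2 - a\<^sup>2) = (b + a) * (b - a)" by (simp add: algebra_simps power2_eq_square)
    also have "\<dots> \<le> 2 * b * (b - a)" using ab by (intro mult_right_mono) auto
    also have "b - a = ln (x / real n)" using n0 x by (simp add: a_def b_def ln_div)
    finally show "f n * ln x ^ 2 \<le> f n * ln (real n) ^ 2 + 2 * ln x * ln (x / real n)"
      by (simp add: a_def b_def algebra_simps)
  qed
  also have "\<dots> = (\<Sum>m\<in>nats_upto x. f m * selberg_sum (x / real m)) + 2 * ln x * (\<Sum>n\<in>nats_upto x. ln (x / real n))"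
    by (simp add: sum.distrib sum_f_ln_squared sum_distrib_left)
  also have "2 * ln x * (\<Sum>n\<in>nats_upto x. ln (x / real n)) \<le> 2 * ln x * (2 * x)"
    using x by (intro mult_left_mono sum_ln_quotient_le) auto
  finally show ?thesis by (simp add: mult_ac)
qed

text \<open>Summed against f, the term y ln y becomes the Riesz mean, while swapping the sums in the
  \<open>psi_log\<close> term brings back \<open>gen_count\<close>: this is where the recursion
  arises.\<close>

lemma sum_f_selberg_sum_upper:
  assumes "e > 0"
  obtains C where "C \<ge> 0" "\<And>x. x \<ge> 1 \<Longrightarrow> (\<Sum>m\<in>nats_upto x. f m * selberg_sum (x / real m)) \<le>
     (2 * \<kappa>\<^sup>2 + e) * x * riesz_sum x + (\<kappa> - \<kappa>\<^sup>2) * (\<Sum>d\<in>nats_upto x. mangoldt d * ln (real d) * gen_count (x / real d)) + C * x * log_sum x"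
proof -
  obtain C where C: "C \<ge> 0"
    "\<And>y. y \<ge> 1 \<Longrightarrow> selberg_sum y \<le> (2 * \<kappa>\<^sup>2 + e) * y * ln y + (\<kappa> - \<kappa>\<^sup>2) * psi_log y + C * y"
    using selberg_sum_upper[OF assms] by blast
  have "(\<Sum>m\<in>nats_upto x. f m * selberg_sum (x / real m)) \<le>
     (2 * \<kappa>\<^sup>2 + e) * x * riesz_sum x + (\<kappa> - \<kappa>\<^sup>2) * (\<Sum>d\<in>nats_upto x. mangoldt d * ln (real d) * gen_count (x / real d)) + C * x * log_sum x"
    if x: "x \<ge> 1" for x
  proof -
    define a where "a = 2 * \<kappa>\<^sup>2 + e"
    define b where "b = \<kappa> - \<kappa>\<^sup>2"
    have "(\<Sum>m\<in>nats_upto x. f m * selberg_sum (x / real m)) \<le>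
        (\<Sum>m\<in>nats_upto x. f m * (a * (x / real m) * ln (x / real m) + b * psi_log (x / real m) + C * (x / real m)))"
      unfolding a_def b_def by (intro sum_mono mult_left_mono f_bounds C(2)) (auto simp: mem_nats_upto field_simps)
    also have "\<dots> = a * x * riesz_sum x + b * (\<Sum>m\<in>nats_upto x. f m * psi_log (x / real m)) + C * x * log_sum x"
      by (simp add: riesz_sum_def log_sum_def ring_distribs sum.distrib sum_distrib_left mult_ac)
    also have "(\<Sum>m\<in>nats_upto x. f m * psi_log (x / real m)) =
        (\<Sum>m\<in>nats_upto x. \<Sum>d\<in>nats_upto (x / real m). mangoldt d * ln (real d) * f m)"
      by (simp add: psi_log_def sum_distrib_left mult_ac)
    also have "\<dots> = (\<Sum>d\<in>nats_upto x. \<Sum>m\<in>nats_upto (x / real d). mangoldt d * ln (real d) * f m)"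
      by (rule sum_nats_upto_swap)
    also have "\<dots> = (\<Sum>d\<in>nats_upto x. mangoldt d * ln (real d) * gen_count (x / real d))"
      by (simp add: gen_count_def sum_distrib_left)
    finally show ?thesis by (simp add: a_def b_def)
  qed
  thus ?thesis using that C(1) by blast
qed

text \<open>After division by x ln x powr (1 + \<kappa>) two terms survive: the Riesz mean gives 2
  \<kappa>^2 / (Gamma \<kappa> \<kappa> (\<kappa> + 1)), and the kernel integral 1 / (\<kappa>
  (\<kappa> + 1)) times \<kappa> - \<kappa>^2 gives the factor (1 - \<kappa>) / (1 + \<kappa>) of
  b.\<close>

lemma gen_density_contraction:
  assumes b: "b \<ge> 0" "eventually (\<lambda>x. gen_density x \<le> b) at_top" and e: "e > 0"
  shows "eventually (\<lambda>x. gen_density x \<le> (2 * \<kappa> / Gamma \<kappa> + (1 - \<kappa>) * b) / (1 + \<kappa>) + e) at_top"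
proof -
  define C where "C = 1 / (Gamma \<kappa> * \<kappa> * (\<kappa> + 1))"
  have G0: "Gamma \<kappa> > 0" using \<kappa>(1) by (rule Gamma_real_pos)
  have C0: "C > 0" using G0 \<kappa> by (simp add: C_def)
  have \<kappa>2: "\<kappa>\<^sup>2 \<le> \<kappa>" "\<kappa>\<^sup>2 > 0" using \<kappa> by (auto simp: power2_eq_square mult_le_cancel_left2)
  \<comment> \<open>One d serves as tolerance both in the Selberg sum and in the Riesz mean; their
    combined effect must stay below e / 2.\<close>
  obtain d where d: "d > 0" "(2 * \<kappa>\<^sup>2 + d) * (C + d) \<le> 2 * \<kappa>\<^sup>2 * C + e / 2"
  proof -
    have "((\<lambda>d. (2 * \<kappa>\<^sup>2 + d) * (C + d)) \<longlongrightarrow> (2 * \<kappa>\<^sup>2 + 0) * (C + 0)) (at_right 0)"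
      by (intro tendsto_intros)
    hence "eventually (\<lambda>d. (2 * \<kappa>\<^sup>2 + d) * (C + d) < 2 * \<kappa>\<^sup>2 * C + e / 2) (at_right 0)"
      by (rule order_tendstoD) (use e in auto)
    moreover have "eventually (\<lambda>d::real. d > 0) (at_right 0)" by (rule eventually_at_right_less)
    ultimately have "eventually (\<lambda>d. d > 0 \<and> (2 * \<kappa>\<^sup>2 + d) * (C + d) \<le> 2 * \<kappa>\<^sup>2 * C + e / 2) (at_right 0)"
      by eventually_elim auto
    thus ?thesis using that eventually_happens'[of "at_right (0::real)"] by auto
  qed
  obtain y1 where y1: "\<And>y. y \<ge> y1 \<Longrightarrow> gen_density y \<le> b"
    using b(2) unfolding eventually_at_top_linorder by blast
  define y0 where "y0 = max y1 (exp 1)"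
  have y0: "y0 \<ge> exp 1" "\<And>y. y \<ge> y0 \<Longrightarrow> gen_density y \<le> b" using y1 by (auto simp: y0_def)
  obtain K where K: "K \<ge> 0" "\<And>x. x \<ge> exp 1 \<Longrightarrow> log_sum x \<le> K * ln x powr \<kappa>" using log_sum_upper by blast
  obtain C1 where C1: "C1 \<ge> 0" "\<And>x. x \<ge> 1 \<Longrightarrow> (\<Sum>m\<in>nats_upto x. f m * selberg_sum (x / real m)) \<le>
     (2 * \<kappa>\<^sup>2 + d) * x * riesz_sum x + (\<kappa> - \<kappa>\<^sup>2) * (\<Sum>d\<in>nats_upto x. mangoldt d * ln (real d) * gen_count (x / real d)) + C1 * x * log_sum x"
    using sum_f_selberg_sum_upper[OF d(1)] by blast
  \<comment> \<open>The coefficient of x ln x: the kernel sum contributes all but the final 4, which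
    comes from \<open>gen_count_ln_squared_le\<close>.\<close>
  define A where "A = 19 * b + ln y0 + 18 + 4"
  have lim: "((\<lambda>u. A * u powr (- \<kappa>) + C1 * K * u powr - 1) \<longlongrightarrow> A * 0 + C1 * K * 0) at_top"
    by (intro tendsto_add tendsto_mult tendsto_const tendsto_neg_powr filterlim_ident) (use \<kappa> in auto)
  hence "eventually (\<lambda>u. A * u powr (- \<kappa>) + C1 * K * u powr - 1 < e / 2) at_top"
    by (rule order_tendstoD) (use e in auto)
  hence "eventually (\<lambda>x. A * ln x powr (- \<kappa>) + C1 * K * ln x powr - 1 < e / 2) at_top"
    using ln_at_top unfolding filterlim_iff by blast
  moreover have "eventually (\<lambda>x. riesz_sum x \<le> (C + d) * ln x powr (1 + \<kappa>)) at_top"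
    using riesz_sum_upper[OF d(1)] by (simp add: C_def)
  moreover have "eventually (\<lambda>x. x \<ge> y0) at_top" by (rule eventually_ge_at_top)
  ultimately show ?thesis
  proof eventually_elim
    case (elim x)
    define u where "u = ln x"
    define U where "U = u powr (1 + \<kappa>)"
    have x: "x \<ge> exp 1" "x > 1" using elim y0(1) one_less_exp_iff[of "1::real"] by linarith+
    have u: "u \<ge> 1" unfolding u_def using x by (subst ln_ge_iff) auto
    have lny0: "ln y0 \<ge> 0" using y0(1) one_less_exp_iff[of "1::real"] by (intro ln_ge_zero) linarith
    define Z where "Z = (\<Sum>d\<in>nats_upto x. mangoldt d * ln (real d) * gen_count (x / real d))"
    have Z: "Z \<le> b * x * (U / (\<kappa> * (\<kappa> + 1)) + 19 * u) + x * u * (ln y0 + 18)"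
      using sum_mangoldt_ln_gen_count_upper[OF b(1) y0 elim(3)] by (simp add: Z_def U_def u_def)
    have "gen_count x * u ^ 2 \<le> (2 * \<kappa>\<^sup>2 + d) * x * riesz_sum x + (\<kappa> - \<kappa>\<^sup>2) * Z + C1 * x * log_sum x + 4 * x * u"
      using gen_count_ln_squared_le[of x] C1(2)[of x] x by (simp add: Z_def u_def)
    also have "(2 * \<kappa>\<^sup>2 + d) * x * riesz_sum x \<le> (2 * \<kappa>\<^sup>2 + d) * x * ((C + d) * U)"
      using elim x d \<kappa>2 by (intro mult_left_mono) (auto simp: U_def u_def)
    also have "(2 * \<kappa>\<^sup>2 + d) * x * ((C + d) * U) = ((2 * \<kappa>\<^sup>2 + d) * (C + d)) * (x * U)" by simp
    also have "\<dots> \<le> (2 * \<kappa>\<^sup>2 * C + e / 2) * (x * U)"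
      using d x by (intro mult_right_mono) (auto simp: U_def)
    also have "(\<kappa> - \<kappa>\<^sup>2) * Z \<le> (\<kappa> - \<kappa>\<^sup>2) * (b * x * (U / (\<kappa> * (\<kappa> + 1)) + 19 * u) + x * u * (ln y0 + 18))"
      using Z \<kappa>2 by (intro mult_left_mono) auto
    also have "\<dots> = (\<kappa> - \<kappa>\<^sup>2) * b / (\<kappa> * (\<kappa> + 1)) * (x * U) + (\<kappa> - \<kappa>\<^sup>2) * ((19 * b + ln y0 + 18) * (x * u))"
      by (simp add: algebra_simps)
    also have "(\<kappa> - \<kappa>\<^sup>2) * ((19 * b + ln y0 + 18) * (x * u)) \<le> 1 * ((19 * b + ln y0 + 18) * (x * u))"
    proof (intro mult_right_mono)
      show "\<kappa> - \<kappa>\<^sup>2 \<le> 1" using \<kappa> \<kappa>2 by linarith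
    qed (use b lny0 x u in auto)
    also have "C1 * x * log_sum x \<le> C1 * x * (K * u powr \<kappa>)"
      using x C1(1) K(2)[of x] by (intro mult_left_mono) (auto simp: u_def)
    finally have main: "gen_count x * u ^ 2 \<le> (2 * \<kappa>\<^sup>2 * C + e / 2 + (\<kappa> - \<kappa>\<^sup>2) * b / (\<kappa> * (\<kappa> + 1))) * (x * U) +
        (A * u + C1 * K * u powr \<kappa>) * x"
      by (simp add: A_def algebra_simps)
    have rest: "A * u + C1 * K * u powr \<kappa> = (A * u powr (- \<kappa>) + C1 * K * u powr - 1) * U"
    proof -
      have "u powr (- \<kappa>) * U = u" "u powr - 1 * U = u powr \<kappa>"
        using u unfolding U_def powr_add[symmetric] by simp_all
      moreover have "(A * u powr (- \<kappa>) + C1 * K * u powr - 1) * U =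
          A * (u powr (- \<kappa>) * U) + C1 * K * (u powr - 1 * U)"
        by (simp only: distrib_right mult.assoc)
      ultimately show ?thesis by (simp only:)
    qed
    have "U > 0" using u by (simp add: U_def)
    have "(A * u powr (- \<kappa>) + C1 * K * u powr - 1) * U \<le> e / 2 * U"
      using elim(1) \<open>U > 0\<close> by (intro mult_right_mono) (auto simp: u_def)
    hence "(A * u + C1 * K * u powr \<kappa>) * x \<le> e / 2 * U * x"
      unfolding rest by (rule mult_right_mono) (use x in auto)
    with main have "gen_count x * u ^ 2 \<le> (2 * \<kappa>\<^sup>2 * C + e / 2 + (\<kappa> - \<kappa>\<^sup>2) * b / (\<kappa> * (\<kappa> + 1))) * (x * U) + e / 2 * U * x"
      by linarith
    also have "\<dots> = (2 * \<kappa>\<^sup>2 * C + (\<kappa> - \<kappa>\<^sup>2) * b / (\<kappa> * (\<kappa> + 1)) + e) * (x * U)"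
      by (simp add: algebra_simps)
    also have "gen_count x * u ^ 2 = gen_density x * (x * U)"
    proof -
      have "u ^ 2 = u powr 2" using u by simp
      also have "\<dots> = u powr (1 - \<kappa>) * U" unfolding U_def by (subst powr_add[symmetric]) simp
      finally show ?thesis using x by (simp add: gen_density_def u_def)
    qed
    finally have "gen_density x \<le> 2 * \<kappa>\<^sup>2 * C + (\<kappa> - \<kappa>\<^sup>2) * b / (\<kappa> * (\<kappa> + 1)) + e"
      using x \<open>U > 0\<close> by (simp add: mult_le_cancel_right)
    also have "2 * \<kappa>\<^sup>2 * C + (\<kappa> - \<kappa>\<^sup>2) * b / (\<kappa> * (\<kappa> + 1)) = (2 * \<kappa> / Gamma \<kappa> + (1 - \<kappa>) * b) / (1 + \<kappa>)"
    proof -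
      have "2 * \<kappa>\<^sup>2 * C = 2 * \<kappa> / Gamma \<kappa> / (1 + \<kappa>)"
      proof -
        have "2 * \<kappa>\<^sup>2 * C = (\<kappa> * (2 * \<kappa>)) / (\<kappa> * (Gamma \<kappa> * (1 + \<kappa>)))"
          by (simp add: C_def power2_eq_square mult_ac add.commute)
        also have "\<dots> = (2 * \<kappa>) / (Gamma \<kappa> * (1 + \<kappa>))"
          using \<kappa> by (subst mult_divide_mult_cancel_left) auto
        finally show ?thesis by simp
      qed
      moreover have "(\<kappa> - \<kappa>\<^sup>2) * b / (\<kappa> * (\<kappa> + 1)) = (1 - \<kappa>) * b / (1 + \<kappa>)"
      proof -
        have "\<kappa> - \<kappa>\<^sup>2 = \<kappa> * (1 - \<kappa>)" by (simp add: power2_eq_square algebra_simps)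
        thus ?thesis using \<kappa> by (simp add: add.commute)
      qed
      ultimately show ?thesis by (simp add: add_divide_distrib)
    qed
    finally show ?case by simp
  qed
qed

text \<open>The affine map of \<open>gen_density_contraction\<close> has slope (1 - \<kappa>) / (1 +
  \<kappa>) < 1 and fixed point 1 / Gamma \<kappa>. If the infimum of all eventual bounds were
  larger, the image of a bound close to it would fall below it.\<close>

theorem gen_density_upper:
  assumes "e > 0"
  shows "eventually (\<lambda>x. gen_density x \<le> 1 / Gamma \<kappa> + e) at_top"
proof -
  define B where "B = {b. b \<ge> 0 \<and> eventually (\<lambda>x. gen_density x \<le> b) at_top}"
  define c where "c = 1 / Gamma \<kappa>"
  have c: "c > 0" using Gamma_real_pos[OF \<kappa>(1)] by (simp add: c_def)
  obtain b0 where b0: "b0 \<ge> 0" "\<And>x. x \<ge> exp 1 \<Longrightarrow> gen_density x \<le> b0" using gen_density_bounded by blast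
  have "eventually (\<lambda>x. gen_density x \<le> b0) at_top"
    by (rule eventually_mono[OF eventually_ge_at_top[of "exp 1"]]) (rule b0(2))
  hence "b0 \<in> B" using b0(1) unfolding B_def by simp
  hence ne: "B \<noteq> {}" by auto
  have bdd: "bdd_below B" by (auto simp: B_def bdd_below_def)
  define \<beta> where "\<beta> = Inf B"
  have "\<beta> \<le> c"
  proof (rule ccontr)
    assume "\<not> \<beta> \<le> c"
    hence gt: "\<beta> > c" by simp
    \<comment> \<open>The affine map lowers \<beta> by 2 \<kappa> (\<beta> - c) / (1 + \<kappa>) = 3
      \<eta>; one \<eta> pays for b < \<beta> + \<eta>, another for the error of the
      contraction.\<close>
    define \<eta> where "\<eta> = 2 * \<kappa> * (\<beta> - c) / (1 + \<kappa>) / 3"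
    have \<eta>: "\<eta> > 0" using gt \<kappa> by (simp add: \<eta>_def)
    obtain b where b: "b \<in> B" "b < \<beta> + \<eta>"
      using cInf_less_iff[OF ne bdd, of "\<beta> + \<eta>"] \<eta> unfolding \<beta>_def by auto
    define b' where "b' = (2 * \<kappa> / Gamma \<kappa> + (1 - \<kappa>) * b) / (1 + \<kappa>) + \<eta>"
    have "eventually (\<lambda>x. gen_density x \<le> b') at_top"
      unfolding b'_def by (rule gen_density_contraction) (use b \<eta> in \<open>auto simp: B_def\<close>)
    moreover have "b' \<ge> 0" unfolding b'_def
      using \<kappa> \<eta> b(1) Gamma_real_pos[OF \<kappa>(1)] by (intro add_nonneg_nonneg divide_nonneg_nonneg mult_nonneg_nonneg) (auto simp: B_def)
    ultimately have "\<beta> \<le> b'" unfolding \<beta>_def by (intro cInf_lower bdd) (auto simp: B_def)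
    moreover have "b' < \<beta>"
    proof -
      have "(1 - \<kappa>) * b \<le> (1 - \<kappa>) * (\<beta> + \<eta>)" using b \<kappa> by (intro mult_left_mono) auto
      hence "b' \<le> (2 * \<kappa> * c + (1 - \<kappa>) * (\<beta> + \<eta>)) / (1 + \<kappa>) + \<eta>"
        unfolding b'_def c_def using \<kappa> by (intro add_right_mono divide_right_mono) auto
      also have "\<dots> = \<beta> - 3 * \<eta> + (1 - \<kappa>) / (1 + \<kappa>) * \<eta> + \<eta>"
        unfolding \<eta>_def using \<kappa> by (simp add: divide_simps) (simp add: algebra_simps)
      also have "(1 - \<kappa>) / (1 + \<kappa>) * \<eta> \<le> 1 * \<eta>"
        using \<kappa> \<eta> by (intro mult_right_mono) auto
      finally show ?thesis using \<eta> by linarith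
    qed
    ultimately show False by simp
  qed
  then obtain b where "b \<in> B" "b < c + e"
    using cInf_less_iff[OF ne bdd, of "c + e"] assms unfolding \<beta>_def by auto
  thus ?thesis unfolding B_def c_def by (auto elim: eventually_mono)
qed

end

section \<open>Gamma function, bases and maximal extensions\<close>

lemma Gamma_one_third_mult_two_thirds: "Gamma (1 / 3) * Gamma (2 / 3 :: real) = 2 * pi / sqrt 3"
proof -
  have "complex_of_real (Gamma (1 / 3) * Gamma (2 / 3)) = Gamma (1 / 3) * Gamma (1 - 1 / 3 :: complex)"
    by (simp add: Gamma_complex_of_real[symmetric])
  also have "\<dots> = of_real pi / sin (of_real pi * (1 / 3))" by (rule Gamma_reflection_complex)
  also have "of_real pi * (1 / 3) = complex_of_real (pi / 3)" by simp
  also have "of_real pi / sin (complex_of_real (pi / 3)) = complex_of_real (pi / sin (pi / 3))"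
    by (subst sin_of_real) (simp only: of_real_divide)
  finally have "Gamma (1 / 3) * Gamma (2 / 3) = pi / sin (pi / 3)"
    by (simp only: of_real_eq_iff)
  thus ?thesis by (simp add: sin_60)
qed

lemma Gamma_plus1_pos: "x > 0 \<Longrightarrow> Gamma (x + 1) = x * Gamma (x :: real)"
  by (rule Gamma_plus1) (auto elim!: nonpos_Ints_cases)

text \<open>Log-convexity gives Gamma (x + 1/3)^3 \<le> x Gamma(x)^3. At x = 4/3 this yields only
  4/3; shifting both arguments by 7 with the functional equation sharpens it to about 1.076.\<close>

lemma Gamma_five_thirds_le: "(Gamma (5 / 3) / Gamma (4 / 3 :: real)) ^ 3 \<le> 108 / 100"
proof -
  have shift: "Gamma (x + 7) = (x * (x + 1) * (x + 2) * (x + 3) * (x + 4) * (x + 5) * (x + 6)) * Gamma x"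
    if "x > 0" for x :: real
    using Gamma_plus1_pos[of x] Gamma_plus1_pos[of "x + 1"] Gamma_plus1_pos[of "x + 2"] Gamma_plus1_pos[of "x + 3"]
      Gamma_plus1_pos[of "x + 4"] Gamma_plus1_pos[of "x + 5"] Gamma_plus1_pos[of "x + 6"] that
    by (simp add: add.assoc mult_ac)
  define a b where "a = Gamma (4 / 3 :: real)" and "b = Gamma (5 / 3 :: real)"
  define A B C where "A = Gamma (25 / 3 :: real)" and "B = Gamma (26 / 3 :: real)" and "C = Gamma (28 / 3 :: real)"
  have pos: "a > 0" "b > 0" "A > 0" "B > 0" "C > 0"
    unfolding a_def b_def A_def B_def C_def by (auto intro!: Gamma_real_pos)
  have A: "A = (24344320 / 2187) * a" unfolding A_def a_def using shift[of "4 / 3"] by simp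
  have B: "B = (48171200 / 2187) * b" unfolding B_def b_def using shift[of "5 / 3"] by simp
  have C: "C = (25 / 3) * A" unfolding A_def C_def using Gamma_plus1_pos[of "25 / 3"] by simp
  have "(ln \<circ> Gamma) ((1 - 1 / 3) *\<^sub>R (25 / 3) + (1 / 3) *\<^sub>R (28 / 3)) \<le>
        (1 - 1 / 3) * (ln \<circ> Gamma) (25 / 3 :: real) + (1 / 3) * (ln \<circ> Gamma) (28 / 3)"
    by (rule convex_onD[OF log_convex_Gamma_real]) auto
  hence "ln B \<le> 2 / 3 * ln A + 1 / 3 * ln C" by (simp add: A_def B_def C_def)
  hence "ln (B ^ 3) \<le> ln (A ^ 2 * C)" using pos by (simp add: ln_mult_pos ln_realpow)
  hence "B ^ 3 \<le> A ^ 2 * C" using pos by (subst (asm) ln_le_cancel_iff) auto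
  hence "B ^ 3 \<le> 25 / 3 * A ^ 3" by (simp add: C power2_eq_square power3_eq_cube mult_ac)
  hence "(48171200 / 2187) ^ 3 * b ^ 3 \<le> 25 / 3 * ((24344320 / 2187) ^ 3 * a ^ 3)"
    unfolding A B power_mult_distrib .
  hence "896647065 * b ^ 3 \<le> 964430272 * a ^ 3" by (simp add: field_simps power_divide)
  moreover have "a ^ 3 > 0" using pos by simp
  ultimately have "b ^ 3 \<le> 108 / 100 * a ^ 3" by linarith
  thus ?thesis using pos unfolding a_def[symmetric] b_def[symmetric] by (simp add: power_divide divide_le_eq)
qed

text \<open>The reflection formula gives the product of Gamma(4/3) and Gamma(5/3), and
  \<open>Gamma_five_thirds_le\<close> bounds their quotient r; product over quotient is
  Gamma(4/3)^2.\<close>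

lemma Gamma_four_thirds_gt: "Gamma (4 / 3 :: real) > sqrt pi / 2"
proof -
  define a b where "a = Gamma (4 / 3 :: real)" and "b = Gamma (5 / 3 :: real)"
  have pos: "a > 0" "b > 0" unfolding a_def b_def by (auto intro!: Gamma_real_pos)
  have ab: "a * b = 4 * pi / (9 * sqrt 3)"
  proof -
    have "a = 1 / 3 * Gamma (1 / 3)" "b = 2 / 3 * Gamma (2 / 3)"
      unfolding a_def b_def using Gamma_plus1_pos[of "1 / 3"] Gamma_plus1_pos[of "2 / 3"] by simp_all
    hence "a * b = (1 / 3 * Gamma (1 / 3)) * (2 / 3 * Gamma (2 / 3))" by (simp only:)
    hence "a * b = 2 / 9 * (Gamma (1 / 3) * Gamma (2 / 3))" by simp
    thus ?thesis unfolding Gamma_one_third_mult_two_thirds by simp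
  qed
  define r where "r = b / a"
  have r: "r > 0" "r ^ 3 \<le> 108 / 100" using pos Gamma_five_thirds_le by (auto simp: r_def a_def b_def)
  \<comment> \<open>Exactly the bound that makes 4 pi / (9 sqrt 3 r) exceed pi / 4. Its cube is
    about 1.081, so 108/100 just suffices.\<close>
  have "r < 16 / (9 * sqrt 3)"
  proof (rule ccontr)
    assume "\<not> ?thesis"
    hence "(16 / (9 * sqrt 3)) ^ 3 \<le> r ^ 3" by (intro power_mono) auto
    also have "\<dots> \<le> 108 / 100" by (rule r(2))
    finally have "16 ^ 3 / (9 ^ 3 * (3 * sqrt 3)) \<le> (108 / 100 :: real)"
      by (simp add: power_divide power_mult_distrib power3_eq_cube)
    hence "16 ^ 3 * 100 \<le> 108 * (9 ^ 3 * (3 * sqrt 3))" by (simp add: field_simps)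
    hence "sqrt 3 \<ge> 17341 / 10000" by simp
    hence "(17341 / 10000) ^ 2 \<le> (sqrt 3) ^ 2" by (intro power_mono) auto
    thus False by (simp add: power2_eq_square)
  qed
  hence "r * (9 * sqrt 3) < 16" by (simp add: field_simps)
  have "a ^ 2 = a * b / r" using pos by (simp add: r_def power2_eq_square)
  also have "\<dots> = 4 * pi / (r * (9 * sqrt 3))" unfolding ab by (simp add: mult.commute)
  also have "\<dots> > 4 * pi / 16"
    using \<open>r * (9 * sqrt 3) < 16\<close> r(1) by (intro divide_strict_left_mono) auto
  finally have "(sqrt pi / 2) ^ 2 < a ^ 2" by (simp add: power_divide)
  thus ?thesis using pos unfolding a_def[symmetric] by (intro power_less_imp_less_base[of _ 2 a]) auto
qed

text \<open>For h \<ge> 4 the point 4/3 lies between 1 + 1/h and 3/2, so log-convexity bounds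
  Gamma(4/3) by the larger endpoint value. As Gamma(4/3) > Gamma(3/2), the value at 1 + 1/h cannot
  be below Gamma(3/2).\<close>

lemma Gamma_one_plus_ge:
  assumes "h \<ge> (2::nat)"
  shows "Gamma (1 + 1 / real h) \<ge> sqrt pi / 2"
proof -
  have half: "Gamma (3 / 2 :: real) = sqrt pi / 2"
    using Gamma_plus1_pos[of "1 / 2"] by (simp add: Gamma_one_half_real)
  consider "h = 2" | "h = 3" | "h \<ge> 4" using assms by linarith
  thus ?thesis
  proof cases
    case 1
    thus ?thesis using half by simp
  next
    case 2
    thus ?thesis using Gamma_four_thirds_gt by simp
  next
    case 3
    define t where "t = 1 + 1 / real h"
    have t: "1 < t" "t < 4 / 3" using 3 by (auto simp: t_def field_simps)
    show ?thesis
    proof (rule ccontr)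
      assume "\<not> ?thesis"
      hence lt: "Gamma t < sqrt pi / 2" by (simp add: t_def)
      have "convex_on {t..3 / 2} (ln \<circ> Gamma :: real \<Rightarrow> real)"
        by (rule convex_on_subset[OF log_convex_Gamma_real]) (use t in auto)
      hence "(ln \<circ> Gamma) (4 / 3) \<le> max ((ln \<circ> Gamma) t) ((ln \<circ> Gamma) (3 / 2))"
        by (rule convex_on_le_max) (use t in auto)
      moreover have "ln (Gamma t) \<le> ln (sqrt pi / 2)"
        using lt t Gamma_real_pos[of t] by (subst ln_le_cancel_iff) auto
      ultimately have "ln (Gamma (4 / 3)) \<le> ln (sqrt pi / 2)" by (auto simp: half)
      hence "Gamma (4 / 3) \<le> sqrt pi / 2"
        using Gamma_real_pos[of "4 / 3"] by (subst (asm) ln_le_cancel_iff) auto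
      thus False using Gamma_four_thirds_gt by simp
    qed
  qed
qed

section \<open>The basis property and maximal extensions\<close>

lemma gen_prod:
  assumes "\<And>x. x \<in> F \<Longrightarrow> g x \<in> gen P"
  shows "(\<Prod>x\<in>F. g x) \<in> gen P"
  using assms by (induction F rule: infinite_finite_induct) (auto simp: gen_mult_iff)

lemma mult_basis_colour_classes:
  fixes c :: "nat \<Rightarrow> nat"
  assumes c: "\<And>p. c p < h"
  shows "mult_basis h (\<Union>i<h. gen {p. c p = i})"
  unfolding mult_basis_def
proof (intro conjI allI impI)
  show "(\<Union>i<h. gen {p. c p = i}) \<subseteq> {0<..}" using gen_pos by auto
  fix n :: nat assume n: "n > 0"
  \<comment> \<open>The part of n composed of primes of one colour, equal to 1 if there are none.
    The shift by \<open>Suc\<close> matches the colours 0, ..., h - 1 with the indices 1, ...,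
    h.\<close>
  define a where "a = (\<lambda>i. \<Prod>p\<in>{p\<in>prime_factors n. Suc (c p) = i}. p ^ multiplicity p n)"
  have "a i \<in> (\<Union>i<h. gen {p. c p = i})" if i: "i \<in> {1..h}" for i
  proof -
    have "a i \<in> gen {p. c p = i - 1}"
      unfolding a_def
    proof (rule gen_prod)
      fix p assume "p \<in> {p \<in> prime_factors n. Suc (c p) = i}"
      hence p: "prime p" "c p = i - 1" by auto
      hence "p \<in> gen {p. c p = i - 1}"
        using prime_gt_0_nat[of p] by (auto simp: gen_def prime_factorization_prime)
      thus "p ^ multiplicity p n \<in> gen {p. c p = i - 1}"
        using gen_prod[of "{..<multiplicity p n}" "\<lambda>_. p"] by simp
    qed
    thus ?thesis using i by (intro UN_I[of "i - 1"]) auto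
  qed
  moreover have "(\<Prod>i=1..h. a i) = n"
  proof -
    have "(\<Prod>i=1..h. a i) = (\<Prod>p\<in>prime_factors n. p ^ multiplicity p n)"
      unfolding a_def by (rule prod.group) (use c in \<open>auto simp: Suc_le_eq\<close>)
    thus ?thesis using prime_factorization_nat[OF n] by simp
  qed
  ultimately show "\<exists>a. (\<forall>i\<in>{1..h}. a i \<in> (\<Union>i<h. gen {p. c p = i})) \<and> n = (\<Prod>i=1..h. a i)"
    by (intro exI[of _ a]) auto
qed

lemma mult_basis_superset:
  "mult_basis h A \<Longrightarrow> A \<subseteq> B \<Longrightarrow> B \<subseteq> {0<..} \<Longrightarrow> mult_basis h B"
  unfolding mult_basis_def by (meson subsetD)

text \<open>Zorn's lemma applies because each constraint involves only finitely many elements. In a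
  maximal B, adding a missing m > N must violate the bound at some n \<ge> m, so the count of B
  there is within 1 of \<Psi> n.\<close>

lemma maximal_superset_exists:
  fixes \<Psi> :: "nat \<Rightarrow> real"
  assumes A: "A \<subseteq> {0<..}" "\<And>n. real (card {a\<in>A. a \<le> n}) \<le> \<Psi> n"
    and small: "\<And>N. \<exists>n. \<Psi> n < real n - real N"
  shows "\<exists>B. A \<subseteq> B \<and> B \<subseteq> {0<..} \<and> (\<forall>n. real (card {a\<in>B. a \<le> n}) \<le> \<Psi> n) \<and>
    (\<forall>N. \<exists>n\<ge>N. real (card {a\<in>B. a \<le> n}) > \<Psi> n - 1)"
proof -
  define \<F> where "\<F> = {B. A \<subseteq> B \<and> B \<subseteq> {0<..} \<and> (\<forall>n. real (card {a\<in>B. a \<le> n}) \<le> \<Psi> n)}"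
  have "\<F> \<noteq> {}" using A by (auto simp: \<F>_def)
  moreover have "\<Union>C \<in> \<F>" if C: "C \<noteq> {}" "subset.chain \<F> C" for C
  proof -
    have CF: "C \<subseteq> \<F>" using C(2) by (simp add: subset.chain_def)
    have "real (card {a\<in>\<Union>C. a \<le> n}) \<le> \<Psi> n" for n
    proof -
      have "finite {a\<in>\<Union>C. a \<le> n}" by simp
      moreover have "{a\<in>\<Union>C. a \<le> n} \<subseteq> \<Union>C" by auto
      ultimately obtain B where B: "B \<in> C" "{a\<in>\<Union>C. a \<le> n} \<subseteq> B"
        using finite_subset_Union_chain[OF _ _ C(1) C(2)] by metis
      have "card {a\<in>\<Union>C. a \<le> n} \<le> card {a\<in>B. a \<le> n}" by (rule card_mono) (use B(2) in auto)
      also have "real \<dots> \<le> \<Psi> n" using B CF by (auto simp: \<F>_def)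
      finally show ?thesis by simp
    qed
    moreover have "A \<subseteq> \<Union>C" "\<Union>C \<subseteq> {0<..}" using C(1) CF unfolding \<F>_def by blast+
    ultimately show ?thesis by (simp add: \<F>_def)
  qed
  ultimately obtain B where B: "B \<in> \<F>" "\<And>X. X \<in> \<F> \<Longrightarrow> B \<subseteq> X \<Longrightarrow> X = B"
    using subset_Zorn_nonempty[of \<F>] by metis
  have Bn: "real (card {a\<in>B. a \<le> n}) \<le> \<Psi> n" for n using B(1) by (simp add: \<F>_def)
  have "\<exists>n\<ge>N. real (card {a\<in>B. a \<le> n}) > \<Psi> n - 1" for N
  proof -
    \<comment> \<open>If B contained every integer beyond N, its count would be at least n - N,
      contradicting \<open>small\<close>.\<close>
    have "\<exists>m>N. m \<notin> B"
    proof (rule ccontr)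
      assume "\<not> (\<exists>m>N. m \<notin> B)"
      hence all: "{N<..n} \<subseteq> {a\<in>B. a \<le> n}" for n by auto
      obtain n where n: "\<Psi> n < real n - real N" using small by blast
      have "real n - real N \<le> real (card {N<..n})" by simp
      also have "card {N<..n} \<le> card {a\<in>B. a \<le> n}" by (rule card_mono[OF _ all]) auto
      also have "real \<dots> \<le> \<Psi> n" by (rule Bn)
      finally show False using n by simp
    qed
    then obtain m where m: "m > N" "m \<notin> B" by blast
    have "insert m B \<notin> \<F>" using B(2)[of "insert m B"] m by auto
    moreover have "A \<subseteq> insert m B" "insert m B \<subseteq> {0<..}" using B(1) m by (auto simp: \<F>_def)
    ultimately obtain n where n: "real (card {a\<in>insert m B. a \<le> n}) > \<Psi> n"
      by (auto simp: \<F>_def not_le)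
    have "n \<ge> m"
    proof (rule ccontr)
      assume "\<not> n \<ge> m"
      hence "{a\<in>insert m B. a \<le> n} = {a\<in>B. a \<le> n}" by auto
      thus False using n Bn[of n] by simp
    qed
    hence "{a\<in>insert m B. a \<le> n} = insert m {a\<in>B. a \<le> n}" by auto
    moreover have "finite {a\<in>B. a \<le> n}" by simp
    ultimately have "card {a\<in>insert m B. a \<le> n} = Suc (card {a\<in>B. a \<le> n})" using m by simp
    thus ?thesis using n \<open>n \<ge> m\<close> m by (intro exI[of _ n]) auto
  qed
  moreover have "A \<subseteq> B" "B \<subseteq> {0<..}" using B(1) by (auto simp: \<F>_def)
  ultimately show ?thesis using Bn by (intro exI[of _ B]) simp
qed

lemma counting_fun_floor:
  assumes "x \<ge> 0"
  shows "counting_fun A x = card {a\<in>A. a \<le> nat \<lfloor>x\<rfloor>}"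
proof -
  have "real a \<le> x \<longleftrightarrow> a \<le> nat \<lfloor>x\<rfloor>" for a using assms by linarith
  thus ?thesis by (simp add: counting_fun_def)
qed

lemma basis_with_upper_density:
  assumes h: "h \<ge> 2"
  obtains A where "mult_basis h A"
    "\<And>e. e > 0 \<Longrightarrow> eventually (\<lambda>x. real (counting_fun A x) * ln x powr (1 - 1 / real h) / x \<le> 2 / sqrt pi + e) at_top"
proof -
  define \<kappa> where "\<kappa> = 1 / real h"
  have \<kappa>: "0 < \<kappa>" "\<kappa> < 1" using h by (auto simp: \<kappa>_def)
  obtain c :: "nat \<Rightarrow> nat" where c: "\<And>n. c n < h"
    "\<And>i. i < h \<Longrightarrow> (\<lambda>N. ln (real N) * (\<Sum>n\<in>{1..N}. (of_bool (c n = i) - 1 / real h) * prime_weight n)) \<longlonglongrightarrow> 0"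
    by (rule prime_colouring_exists[of h]) (use h in auto)
  define P where "P = (\<lambda>i. {p. c p = i})"
  define A where "A = (\<Union>i<h. gen (P i))"
  have bal: "balanced_primes (P i) \<kappa>" if "i < h" for i
    using c(2)[OF that] \<kappa> by unfold_locales (auto simp: P_def \<kappa>_def)
  have basis: "mult_basis h A" unfolding A_def P_def by (rule mult_basis_colour_classes[OF c(1)])
  have "eventually (\<lambda>x. real (counting_fun A x) * ln x powr (1 - \<kappa>) / x \<le> 2 / sqrt pi + e) at_top" if e: "e > 0" for e
  proof -
    have "eventually (\<lambda>x. balanced_primes.gen_density (P i) \<kappa> x \<le> 1 / Gamma \<kappa> + e / real h) at_top" if "i < h" for i
      by (rule balanced_primes.gen_density_upper[OF bal[OF that]]) (use e h in auto)
    hence "eventually (\<lambda>x. \<forall>i\<in>{..<h}. balanced_primes.gen_density (P i) \<kappa> x \<le> 1 / Gamma \<kappa> + e / real h) at_top"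
      by (intro eventually_ball_finite) auto
    thus ?thesis using eventually_gt_at_top[of 1]
    proof eventually_elim
      case (elim x)
      have S: "real (card (gen Q \<inter> nats_upto x)) = balanced_primes.gen_count Q x" if "balanced_primes Q \<kappa>" for Q
        unfolding balanced_primes.gen_count_def[OF that] balanced_primes.f_def[OF that] by (simp add: Int_commute)
      have "{a\<in>A. real a \<le> x} \<subseteq> (\<Union>i<h. gen (P i) \<inter> nats_upto x)"
        by (auto simp: A_def mem_nats_upto gen_pos)
      hence "counting_fun A x \<le> card (\<Union>i<h. gen (P i) \<inter> nats_upto x)"
        unfolding counting_fun_def by (intro card_mono) auto
      also have "\<dots> \<le> (\<Sum>i<h. card (gen (P i) \<inter> nats_upto x))" by (rule card_UN_le) auto
      finally have "real (counting_fun A x) \<le> (\<Sum>i<h. real (card (gen (P i) \<inter> nats_upto x)))"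
        by (simp flip: of_nat_sum)
      also have "\<dots> = (\<Sum>i<h. balanced_primes.gen_count (P i) x)"
        by (intro sum.cong refl S bal) auto
      finally have "real (counting_fun A x) * (ln x powr (1 - \<kappa>) / x) \<le> (\<Sum>i<h. balanced_primes.gen_count (P i) x) * (ln x powr (1 - \<kappa>) / x)"
        using elim by (intro mult_right_mono) auto
      also have "\<dots> = (\<Sum>i<h. balanced_primes.gen_density (P i) \<kappa> x)"
        unfolding sum_distrib_right
        by (intro sum.cong refl) (simp add: balanced_primes.gen_density_def[OF bal])
      also have "\<dots> \<le> (\<Sum>i<h. 1 / Gamma \<kappa> + e / real h)" using elim by (intro sum_mono) auto
      also have "\<dots> = real h / Gamma \<kappa> + e" using h by (simp add: field_simps)
      also have "real h / Gamma \<kappa> = 1 / Gamma (1 + 1 / real h)"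
        using Gamma_plus1_pos[OF \<kappa>(1)] h by (simp add: \<kappa>_def add.commute)
      also have "\<dots> \<le> 1 / (sqrt pi / 2)"
        using Gamma_one_plus_ge[OF h] by (intro divide_left_mono mult_pos_pos) (auto intro: less_le_trans[of 0 "sqrt pi / 2"])
      finally show ?case by simp
    qed
  qed
  thus ?thesis using that[OF basis] by (simp add: \<kappa>_def)
qed

theorem corollary10:
  fixes h :: nat
  assumes "h \<ge> 2"
  shows "\<exists>A. mult_basis h A \<and>
    Limsup at_top (\<lambda>x::real. ereal (real (counting_fun A x) * ln x powr (1 - 1 / real h) / x))
      = ereal (2 / sqrt pi)"
proof -
  define \<alpha> where "\<alpha> = 1 - 1 / real h"
  have \<alpha>: "0 < \<alpha>" "\<alpha> < 1" using assms by (auto simp: \<alpha>_def)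
  define L where "L = 2 / sqrt pi"
  have L: "L > 0" by (simp add: L_def)
  obtain A where A: "mult_basis h A"
    "\<And>e. e > 0 \<Longrightarrow> eventually (\<lambda>x. real (counting_fun A x) * ln x powr \<alpha> / x \<le> L + e) at_top"
    using basis_with_upper_density[OF assms] unfolding \<alpha>_def L_def by blast
  have A_pos: "A \<subseteq> {0<..}" using A(1) by (simp add: mult_basis_def)
  define cnt where "cnt = (\<lambda>B n. real (card {a\<in>B. a \<le> (n::nat)}))"
  define \<Phi> where "\<Phi> = (\<lambda>n::nat. L * real n / ln (real n) powr \<alpha>)"
  \<comment> \<open>A itself may exceed the target \<Phi> by a factor 1 + o(1). The maximum makes A
    admissible for the extension without raising the limsup above L.\<close>
  define \<Psi> where "\<Psi> = (\<lambda>n. max (\<Phi> n) (cnt A n))"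
  have evA: "eventually (\<lambda>n. cnt A n \<le> (L + e) * real n / ln (real n) powr \<alpha>) sequentially" if "e > 0" for e
  proof -
    have "eventually (\<lambda>n. real (counting_fun A (real n)) * ln (real n) powr \<alpha> / real n \<le> L + e) sequentially"
      by (rule eventually_compose_filterlim[OF A(2)[OF that] filterlim_real_sequentially])
    thus ?thesis using eventually_ge_at_top[of 2]
    proof eventually_elim
      case (elim n)
      have "ln (real n) powr \<alpha> > 0" "real n > 0" using elim by auto
      moreover have "real (counting_fun A (real n)) = cnt A n"
        by (simp add: counting_fun_def cnt_def)
      ultimately show ?case using elim by (simp add: field_simps)
    qed
  qed
  have ln_powr_top: "filterlim (\<lambda>n::nat. ln (real n) powr - \<alpha>) (nhds 0) sequentially"
    by (rule tendsto_neg_powr[OF _ filterlim_compose[OF ln_at_top filterlim_real_sequentially]]) (use \<alpha> in auto)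
  have small: "\<exists>n. \<Psi> n < real n - real N" for N
  proof -
    have "(\<lambda>n. (L + 1) * ln (real n) powr - \<alpha>) \<longlonglongrightarrow> (L + 1) * 0"
      by (intro tendsto_intros ln_powr_top)
    hence "eventually (\<lambda>n. (L + 1) * ln (real n) powr - \<alpha> < 1 / 2) sequentially"
      by (rule order_tendstoD) auto
    hence "eventually (\<lambda>n. \<Psi> n < real n - real N) sequentially"
      using evA[of 1, OF zero_less_one] eventually_gt_at_top[of "2 * N + 2"]
    proof eventually_elim
      case (elim n)
      have "\<Phi> n \<le> (L + 1) * real n / ln (real n) powr \<alpha>"
        unfolding \<Phi>_def by (intro divide_right_mono mult_right_mono) auto
      hence "\<Psi> n \<le> (L + 1) * real n / ln (real n) powr \<alpha>" using elim by (simp add: \<Psi>_def)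
      also have "\<dots> = ((L + 1) * ln (real n) powr - \<alpha>) * real n" by (simp add: powr_minus_divide)
      also have "\<dots> \<le> 1 / 2 * real n" using elim by (intro mult_right_mono) auto
      also have "\<dots> < real n - real N" using elim by simp
      finally show ?case .
    qed
    thus ?thesis by (rule eventually_happens'[rotated]) simp
  qed
  have A_le: "real (card {a\<in>A. a \<le> n}) \<le> \<Psi> n" for n by (simp add: \<Psi>_def cnt_def)
  obtain B where B: "A \<subseteq> B" "B \<subseteq> {0<..}" "\<forall>n. real (card {a\<in>B. a \<le> n}) \<le> \<Psi> n"
    "\<forall>N. \<exists>n\<ge>N. real (card {a\<in>B. a \<le> n}) > \<Psi> n - 1"
    using maximal_superset_exists[OF A_pos A_le small] by blast
  define R where "R = (\<lambda>x. real (counting_fun B x) * ln x powr \<alpha> / x)"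
  have upper: "Limsup at_top (\<lambda>x. ereal (R x)) \<le> ereal L"
  proof (rule ereal_le_epsilon2)
    fix e :: real assume e: "e > 0"
    \<comment> \<open>Counts change only at integers, while ln x keeps growing up to the next one;
      passing from n to x costs at most ln x / ln (x - 1), and L (1 + d) = L + e.\<close>
    define d where "d = e / L"
    have d: "d > 0" using e L by (simp add: d_def)
    have "eventually (\<lambda>x::real. ln x / ln (x - 1) \<le> 1 + d) at_top" using d by real_asymp
    moreover note A(2)[OF e]
    moreover have "eventually (\<lambda>x::real. x > 5) at_top" by (rule eventually_gt_at_top)
    ultimately have "eventually (\<lambda>x. R x \<le> L + e) at_top"
    proof eventually_elim
      case (elim x)
      define n where "n = nat \<lfloor>x\<rfloor>"
      have n: "real n \<le> x" "real n \<ge> x - 1" "real n > 3" using elim unfolding n_def by linarith+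
      have lnx: "ln x > 0" "ln (real n) > 0" using elim n by auto
      have cB: "real (counting_fun B x) \<le> \<Psi> n"
        using spec[OF B(3), of n] elim by (simp add: counting_fun_floor cnt_def n_def)
      have "R x \<le> \<Psi> n * (ln x powr \<alpha> / x)"
        using cB elim unfolding R_def by (simp add: divide_right_mono mult_right_mono)
      also have "\<dots> \<le> L + e"
      proof (cases "\<Phi> n \<le> cnt A n")
        case True
        hence "\<Psi> n = real (counting_fun A x)"
          using elim by (simp add: \<Psi>_def counting_fun_floor cnt_def n_def)
        thus ?thesis using elim by simp
      next
        case False
        hence "\<Psi> n * (ln x powr \<alpha> / x) = L * (real n / x) * (ln x / ln (real n)) powr \<alpha>"
          using lnx by (simp add: \<Psi>_def \<Phi>_def powr_divide)
        also have "\<dots> \<le> L * 1 * (1 + d)"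
        proof (intro mult_mono)
          have "1 \<le> ln x / ln (real n)" using lnx n by simp
          hence "(ln x / ln (real n)) powr \<alpha> \<le> (ln x / ln (real n)) powr 1" using \<alpha> by (intro powr_mono) auto
          also have "\<dots> = ln x / ln (real n)" using lnx by simp
          also have "\<dots> \<le> ln x / ln (x - 1)" using lnx n elim by (intro divide_left_mono) auto
          also have "\<dots> \<le> 1 + d" using elim by simp
          finally show "(ln x / ln (real n)) powr \<alpha> \<le> 1 + d" .
        qed (use L n elim in auto)
        also have "\<dots> = L + e" using L by (simp add: d_def field_simps)
        finally show ?thesis .
      qed
      finally show ?case .
    qed
    thus "Limsup at_top (\<lambda>x. ereal (R x)) \<le> ereal L + ereal e"
      by (intro Limsup_bounded) auto
  qed
  have lower: "Limsup at_top (\<lambda>x. ereal (R x)) \<ge> ereal L"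
  proof (rule ccontr)
    assume "\<not> ?thesis"
    hence "Limsup at_top (\<lambda>x. ereal (R x)) < ereal L" by simp
    then obtain y where y: "Limsup at_top (\<lambda>x. ereal (R x)) < ereal y" "y < L"
      using ereal_dense2 by (metis less_ereal.simps(1))
    have "eventually (\<lambda>x. R x < y) at_top"
      using Limsup_lessD[OF y(1)] by simp
    hence "eventually (\<lambda>n. R (real n) < y) sequentially"
      by (rule eventually_compose_filterlim[OF _ filterlim_real_sequentially])
    moreover have "eventually (\<lambda>n. ln (real n) powr \<alpha> / real n < L - y) sequentially"
    proof (rule order_tendstoD)
      have "((\<lambda>x::real. x powr \<alpha> / exp x) \<longlongrightarrow> 0) at_top" by real_asymp
      hence "(\<lambda>n. ln (real n) powr \<alpha> / exp (ln (real n))) \<longlonglongrightarrow> 0"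
        by (rule filterlim_compose[OF _ filterlim_compose[OF ln_at_top filterlim_real_sequentially]])
      thus "(\<lambda>n. ln (real n) powr \<alpha> / real n) \<longlonglongrightarrow> 0"
        by (rule Lim_transform_eventually) (auto intro!: eventually_mono[OF eventually_gt_at_top[of 0]])
    qed (use y in auto)
    moreover have "eventually (\<lambda>n::nat. n \<ge> 2) sequentially" by (rule eventually_ge_at_top)
    ultimately have "eventually (\<lambda>n. R (real n) < y \<and> ln (real n) powr \<alpha> / real n < L - y \<and> n \<ge> 2) sequentially"
      by eventually_elim auto
    then obtain N where N: "\<And>n. n \<ge> N \<Longrightarrow> R (real n) < y \<and> ln (real n) powr \<alpha> / real n < L - y \<and> n \<ge> 2"
      unfolding eventually_sequentially by blast
    obtain n where n: "n \<ge> N" "cnt B n > \<Psi> n - 1" using B(4) by (auto simp: cnt_def)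
    have n2: "n \<ge> 2" using N[OF n(1)] by simp
    have "ln (real n) powr \<alpha> > 0" using n2 by simp
    \<comment> \<open>The single element by which B may fall short of \<Psi> n is worth ln n powr
      \<alpha> / n, which is eventually below the gap L - y.\<close>
    have "L - ln (real n) powr \<alpha> / real n = (\<Phi> n - 1) * (ln (real n) powr \<alpha> / real n)"
      using n2 by (simp add: \<Phi>_def field_simps)
    also have "\<dots> \<le> cnt B n * (ln (real n) powr \<alpha> / real n)"
      using n(2) by (intro mult_right_mono) (auto simp: \<Psi>_def)
    also have "\<dots> = R (real n)" by (simp add: R_def counting_fun_def cnt_def)
    finally show False using N[OF n(1)] by linarith
  qed
  have "mult_basis h B" by (rule mult_basis_superset[OF A(1) B(1,2)])
  moreover have "Limsup at_top (\<lambda>x. ereal (R x)) = ereal L" using upper lower by (rule antisym)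
  ultimately show ?thesis unfolding R_def L_def \<alpha>_def by blast
qed

end
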